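(* Let $(\mathscr M,g,d\mu)$ be a smooth metric measure space of dimension $n\ge2$ with $\mathscr M$ closed and $d\mu=e^{-\varphi}dv_g$, and let $\mathscr Ric_\varphi^m(g)\ge-(m-1)k\,g$ on $\mathscr M$ for some $k\ge0$ and $m\ge n$. Let $1<p\le1+1/\sqrt{m-1}$, $T>0$, and let $u$ be a positive smooth solution on $\mathscr M\times[0,T]$ of $$\partial_tu(x,t)-\Delta_\varphi u^p(x,t)=\mathscr N(t,x,u(x,t)).$$ Set $v=\frac p{p-1}u^{p-1}$ and $$\Sigma(t,x,v)=p\left[\frac{(p-1)v}{p}\right]^{\frac{p-2}{p-1}}\mathscr N\left(t,x,\left[\frac{(p-1)v}{p}\right]^{\frac1{p-1}}\right)\qquad(v>0).$$ Let $\Gamma=\Gamma(v)$, $v>0$, be a given function of class $\mathscr C^2$ and assume that the following conditions hold for some constant $a\in\mathbb R$ (with $v=v(x,t)$, at all $(x,t)\in\mathscr M\times[0,T]$): 1. $\Gamma'(v)\,\Sigma(t,x,v)\le0$; 2. $\Gamma'(v)+v\,\Gamma''(v)\ge0$; 3. $\langle\nabla v,\Sigma_x(t,x,v)\rangle\le0$; 4. $\Sigma_v(t,x,v)+\dfrac{\Sigma(t,x,v)}{2(p-1)v}\le a$. Then for every $x\in\mathscr M$ and $0<t\le T$, $$\left[v^{\frac1{p-1}}|\nabla v|^2\right](x,t)\le e^{2(MK+a)t}\left\{\max_{\mathscr M}\left[v^{\frac1{p-1}}|\nabla v|^2+\Gamma(v)\right]_{t=0}-\Gamma(v(x,t))\right\},$$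 where $M=\sup_{\mathscr M\times[0,T]}v$ and $K=(p-1)(m-1)k$.
   Context: A smooth metric measure space $(\mathscr M,g,d\mu)$ is a smooth Riemannian manifold $(\mathscr M,g)$ of dimension $n\ge2$ with the weighted measure $d\mu=e^{-\varphi}dv_g$, where $dv_g$ is the Riemannian volume measure and $\varphi$ is a smooth function on $\mathscr M$. Closed means compact without boundary. The $\varphi$-Laplacian is $\Delta_\varphi w=\Delta w-\langle\nabla\varphi,\nabla w\rangle$, with $\Delta$ the Laplace-Beltrami operator. The Bakry-Émery $m$-Ricci curvature tensor is $$\mathscr Ric_\varphi^m(g)=\mathscr Ric(g)+\nabla\nabla\varphi-\frac{\nabla\varphi\otimes\nabla\varphi}{m-n},\qquad m\ge n,$$ where $\mathscr Ric(g)$ is the Ricci tensor of $g$ and $\nabla\nabla\varphi$ is the Hessian of $\varphi$; when $m=n$, by convention $\varphi$ is only allowed to be constant and $\mathscr Ric_\varphi^n(g)=\mathscr Ric(g)$. $\mathscr N=\mathscr N(t,x,u)$ is a sufficiently smooth real-valued function of $(t,x,u)$, $u>0$. $\Sigma_v$ denotes the partial derivative of $\Sigma$ in its argument $v$, and $\Sigma_x$ denotes the gradient of $\Sigma(t,x,v)$ in the space variable $x$ with $t$ and $v$ held fixed. *)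

theory Defs
  imports "HOL-Analysis.Analysis"
begin

section \<open>Functions of class \<open>C\<^sup>k\<close> and smooth functions\<close>

text \<open>
  The derivatives are taken within the domain \<open>D\<close>. They are uniquely determined for the domains
  used below, which are open sets, or products of open sets with a compact time interval
  \<open>{0..T}\<close>, \<open>T > 0\<close>. In the latter case the derivatives at the times \<open>0\<close> and \<open>T\<close> are one-sided
  in the time direction, so that the functions are regular up to and including these times.
\<close>

primrec Ck_on :: "nat \<Rightarrow> 'e::euclidean_space set \<Rightarrow> ('e \<Rightarrow> real) \<Rightarrow> bool" where
  "Ck_on 0 D f \<longleftrightarrow> continuous_on D f"
| "Ck_on (Suc k) D f \<longleftrightarrow>
     f differentiable_on D \<and>
     (\<forall>b\<in>Basis. Ck_on k D (\<lambda>y. frechet_derivative f (at y within D) b))"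

definition smooth_on :: "'e::euclidean_space set \<Rightarrow> ('e \<Rightarrow> real) \<Rightarrow> bool" where
  "smooth_on D f \<longleftrightarrow> (\<forall>k. Ck_on k D f)"

definition pd :: "'n::finite \<Rightarrow> (real^'n \<Rightarrow> real) \<Rightarrow> real^'n \<Rightarrow> real" where
  "pd i f y = frechet_derivative f (at y) (axis i 1)"

section \<open>Smooth manifolds\<close>

text \<open>
  A chart is a pair of a domain in the manifold and a coordinate map, whose values outside the
  domain are irrelevant.
\<close>

type_synonym ('a, 'n) chart = "'a set \<times> ('a \<Rightarrow> real^'n)"

abbreviation cdom :: "('a, 'n::finite) chart \<Rightarrow> 'a set" where
  "cdom c \<equiv> fst c"

abbreviation cmap :: "('a, 'n::finite) chart \<Rightarrow> 'a \<Rightarrow> real^'n" where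
  "cmap c \<equiv> snd c"

abbreviation crange :: "('a, 'n::finite) chart \<Rightarrow> (real^'n) set" where
  "crange c \<equiv> cmap c ` cdom c"

definition cinv :: "('a, 'n::finite) chart \<Rightarrow> real^'n \<Rightarrow> 'a" where
  "cinv c = inv_into (cdom c) (cmap c)"

definition transition ::
  "('a, 'n::finite) chart \<Rightarrow> ('a, 'n) chart \<Rightarrow> real^'n \<Rightarrow> real^'n" where
  "transition c d = (\<lambda>y. cmap d (cinv c y))"

locale smooth_manifold =
  fixes X :: "'a topology" and A :: "('a, 'n::finite) chart set"
  assumes Hausdorff: "Hausdorff_space X"
    and second_countable: "second_countable X"
    and cdom_open: "c \<in> A \<Longrightarrow> openin X (cdom c)"
    and crange_open: "c \<in> A \<Longrightarrow> open (crange c)"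
    and chart_homeomorphic:
      "c \<in> A \<Longrightarrow>
        homeomorphic_map (subtopology X (cdom c)) (top_of_set (crange c)) (cmap c)"
    and charts_cover: "(\<Union>c\<in>A. cdom c) = topspace X"
    and transition_smooth:
      "c \<in> A \<Longrightarrow> d \<in> A \<Longrightarrow>
        smooth_on (cmap c ` (cdom c \<inter> cdom d)) (\<lambda>y. transition c d y $ i)"

locale closed_manifold = smooth_manifold +
  assumes compact: "compact_space X"

definition smooth_function :: "('a, 'n::finite) chart set \<Rightarrow> ('a \<Rightarrow> real) \<Rightarrow> bool" where
  "smooth_function A f \<longleftrightarrow> (\<forall>c\<in>A. smooth_on (crange c) (\<lambda>y. f (cinv c y)))"

text \<open>Functions \<open>u x t\<close> that are smooth on the manifold times \<open>{0..T}\<close>.\<close>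

definition smooth_spacetime ::
  "('a, 'n::finite) chart set \<Rightarrow> real \<Rightarrow> ('a \<Rightarrow> real \<Rightarrow> real) \<Rightarrow> bool" where
  "smooth_spacetime A T u \<longleftrightarrow>
     (\<forall>c\<in>A. smooth_on (crange c \<times> {0..T}) (\<lambda>(y, s). u (cinv c y) s))"

text \<open>Functions \<open>N t x r\<close> of class \<open>C\<^sup>1\<close> in all arguments, \<open>t \<in> {0..T}\<close>, \<open>r > 0\<close>.\<close>

definition C1_nonlinearity ::
  "('a, 'n::finite) chart set \<Rightarrow> real \<Rightarrow> (real \<Rightarrow> 'a \<Rightarrow> real \<Rightarrow> real) \<Rightarrow> bool" where
  "C1_nonlinearity A T N \<longleftrightarrow>
     (\<forall>c\<in>A. Ck_on 1 ({0..T} \<times> crange c \<times> {0<..}) (\<lambda>(s, y, r). N s (cinv c y) r))"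

section \<open>Riemannian manifolds\<close>

text \<open>
  A covariant tensor field of order two is given by its matrix of components in every chart, as a
  function of the coordinates. For the metric, the components in different charts are related
  by the transformation law of covariant tensors.
\<close>

type_synonym ('a, 'n) tensor2 = "('a, 'n) chart \<Rightarrow> real^'n \<Rightarrow> real^'n^'n"

locale riemannian_manifold = smooth_manifold X A
  for X :: "'a topology" and A :: "('a, 'n::finite) chart set" +
  fixes g :: "('a, 'n) tensor2"
  assumes metric_smooth: "c \<in> A \<Longrightarrow> smooth_on (crange c) (\<lambda>y. g c y $ i $ j)"
    and metric_symmetric: "c \<in> A \<Longrightarrow> y \<in> crange c \<Longrightarrow> transpose (g c y) = g c y"
    and metric_positive:
      "c \<in> A \<Longrightarrow> y \<in> crange c \<Longrightarrow> \<xi> \<noteq> 0 \<Longrightarrow> \<xi> \<bullet> (g c y *v \<xi>) > 0"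
    and metric_transform:
      "c \<in> A \<Longrightarrow> d \<in> A \<Longrightarrow> x \<in> cdom c \<inter> cdom d \<Longrightarrow>
        (let J = jacobian (transition c d) (at (cmap c x)) in
         g c (cmap c x) = transpose J ** g d (cmap d x) ** J)"

definition christoffel ::
  "('a, 'n::finite) tensor2 \<Rightarrow> ('a, 'n) chart \<Rightarrow> 'n \<Rightarrow> 'n \<Rightarrow> 'n \<Rightarrow> real^'n \<Rightarrow> real" where
  "christoffel g c k i j y =
     1/2 * (\<Sum>l\<in>UNIV. matrix_inv (g c y) $ k $ l *
       (pd i (\<lambda>z. g c z $ j $ l) y + pd j (\<lambda>z. g c z $ i $ l) y - pd l (\<lambda>z. g c z $ i $ j) y))"

text \<open>
  The components \<open>R\<^sup>l\<^sub>k\<^sub>i\<^sub>j\<close> of \<open>R(\<partial>\<^sub>i, \<partial>\<^sub>j)\<partial>\<^sub>k\<close>, with the sign convention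
  \<open>R(X, Y)Z = \<nabla>\<^sub>X\<nabla>\<^sub>Y Z - \<nabla>\<^sub>Y\<nabla>\<^sub>X Z - \<nabla>\<^bsub>[X, Y]\<^esub> Z\<close>; the Ricci tensor of the round sphere is then positive.
\<close>

definition riemann ::
  "('a, 'n::finite) tensor2 \<Rightarrow> ('a, 'n) chart \<Rightarrow> 'n \<Rightarrow> 'n \<Rightarrow> 'n \<Rightarrow> 'n \<Rightarrow> real^'n \<Rightarrow> real" where
  "riemann g c l k i j y =
     pd i (christoffel g c l j k) y - pd j (christoffel g c l i k) y
     + (\<Sum>q\<in>UNIV. christoffel g c l i q y * christoffel g c q j k y
                 - christoffel g c l j q y * christoffel g c q i k y)"

definition ricci :: "('a, 'n::finite) tensor2 \<Rightarrow> ('a, 'n) tensor2" where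
  "ricci g c y = (\<chi> j k. \<Sum>i\<in>UNIV. riemann g c i k i j y)"

definition hessian :: "('a, 'n::finite) tensor2 \<Rightarrow> ('a \<Rightarrow> real) \<Rightarrow> ('a, 'n) tensor2" where
  "hessian g f c y =
     (let h = (\<lambda>z. f (cinv c z)) in
      \<chi> i j. pd i (pd j h) y - (\<Sum>k\<in>UNIV. christoffel g c k i j y * pd k h y))"

definition differential :: "('a \<Rightarrow> real) \<Rightarrow> ('a, 'n::finite) chart \<Rightarrow> real^'n \<Rightarrow> real^'n" where
  "differential f c y = (\<chi> i. pd i (\<lambda>z. f (cinv c z)) y)"

definition gradient ::
  "('a, 'n::finite) tensor2 \<Rightarrow> ('a \<Rightarrow> real) \<Rightarrow> ('a, 'n) chart \<Rightarrow> real^'n \<Rightarrow> real^'n" where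
  "gradient g f c y = matrix_inv (g c y) *v differential f c y"

text \<open>
  Scalar quantities on the manifold are evaluated in some chart around the given point. By the
  transformation laws of the tensors involved, their values do not depend on the choice.
\<close>

definition chart_at :: "('a, 'n::finite) chart set \<Rightarrow> 'a \<Rightarrow> ('a, 'n) chart" where
  "chart_at A x = (SOME c. c \<in> A \<and> x \<in> cdom c)"

definition grad_inner ::
  "('a, 'n::finite) chart set \<Rightarrow> ('a, 'n) tensor2 \<Rightarrow> ('a \<Rightarrow> real) \<Rightarrow> ('a \<Rightarrow> real) \<Rightarrow> 'a \<Rightarrow> real" where
  "grad_inner A g f h x =
     (let c = chart_at A x; y = cmap c x in gradient g f c y \<bullet> (g c y *v gradient g h c y))"

definition laplace_beltrami ::
  "('a, 'n::finite) chart set \<Rightarrow> ('a, 'n) tensor2 \<Rightarrow> ('a \<Rightarrow> real) \<Rightarrow> 'a \<Rightarrow> real" where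
  "laplace_beltrami A g f x =
     (let c = chart_at A x; y = cmap c x in trace (matrix_inv (g c y) ** hessian g f c y))"

section \<open>Smooth metric measure spaces\<close>

text \<open>
  The Riemannian volume measure is the Borel measure which is given by
  \<open>sqrt (det g) dy\<close> in every chart.
\<close>

definition is_riemannian_volume ::
  "'a topology \<Rightarrow> ('a, 'n::finite) chart set \<Rightarrow> ('a, 'n) tensor2 \<Rightarrow> 'a measure \<Rightarrow> bool" where
  "is_riemannian_volume X A g \<nu> \<longleftrightarrow>
     space \<nu> = topspace X \<and>
     sets \<nu> = sigma_sets (topspace X) {U. openin X U} \<and>
     (\<forall>c\<in>A. \<forall>B\<in>sets \<nu>. B \<subseteq> cdom c \<longrightarrow>
        emeasure \<nu> B = (\<integral>\<^sup>+y\<in>cmap c ` B. ennreal (sqrt (det (g c y))) \<partial>lborel))"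

locale metric_measure_space = riemannian_manifold X A g
  for X :: "'a topology" and A :: "('a, 'n::finite) chart set" and g :: "('a, 'n) tensor2" +
  fixes \<phi> :: "'a \<Rightarrow> real" and \<mu> :: "'a measure"
  assumes weight_smooth: "smooth_function A \<phi>"
    and weighted_measure:
      "\<exists>\<nu>. is_riemannian_volume X A g \<nu> \<and> \<mu> = density \<nu> (\<lambda>x. ennreal (exp (- \<phi> x)))"

definition weighted_laplacian ::
  "('a, 'n::finite) chart set \<Rightarrow> ('a, 'n) tensor2 \<Rightarrow> ('a \<Rightarrow> real) \<Rightarrow> ('a \<Rightarrow> real) \<Rightarrow> 'a \<Rightarrow> real" where
  "weighted_laplacian A g \<phi> f x = laplace_beltrami A g f x - grad_inner A g \<phi> f x"

text \<open>
  For \<open>m = n\<close> the tensor is only considered for constant \<open>\<phi>\<close>; this restriction is a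
  separate hypothesis wherever the tensor is used.
\<close>

definition bakry_emery_ricci ::
  "('a, 'n::finite) tensor2 \<Rightarrow> ('a \<Rightarrow> real) \<Rightarrow> real \<Rightarrow> ('a, 'n) tensor2" where
  "bakry_emery_ricci g \<phi> m c y =
     (if m = real CARD('n) then ricci g c y
      else ricci g c y + hessian g \<phi> c y
        - (1 / (m - real CARD('n))) *\<^sub>R
            (\<chi> i j. differential \<phi> c y $ i * differential \<phi> c y $ j))"

text \<open>The inequality \<open>S \<ge> r g\<close> of quadratic forms at every point.\<close>

definition tensor_ge ::
  "('a, 'n::finite) chart set \<Rightarrow> ('a, 'n) tensor2 \<Rightarrow> ('a, 'n) tensor2 \<Rightarrow> real \<Rightarrow> bool" where
  "tensor_ge A g S r \<longleftrightarrow>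
     (\<forall>c\<in>A. \<forall>y\<in>crange c. \<forall>\<xi>. \<xi> \<bullet> (S c y *v \<xi>) \<ge> r * (\<xi> \<bullet> (g c y *v \<xi>)))"

end

theory Submission
  imports Defs
begin

text \<open>
  The function \<open>v\<close> is the pressure of the porous medium equation. With \<open>w = |\<nabla>v|\<^sup>2\<close> and the weighted
  Laplacian \<open>L = \<Delta>_\<phi> v\<close>, the equation for \<open>u\<close> becomes
  \<open>\<partial>_t v = (p - 1) v L + w + \<Sigma>(t, x, v)\<close> (\<open>pressure_equation\<close>). The estimate says that
  \<open>F = e^(-\<kappa> t) v^\<beta> w + \<Gamma>(v)\<close>, where \<open>\<beta> = 1/(p - 1)\<close> and \<open>\<kappa> = 2 (M K + a)\<close>, never exceeds its
  initial maximum. By the maximum principle it is enough that \<open>\<partial>_t F \<le> 0\<close> wherever \<open>F(\<sqdot>, t)\<close> has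
  a spatial maximum.

  At such a point \<open>\<nabla>F = 0\<close>, and since \<open>F\<close> depends on \<open>v\<close> and \<open>w\<close> only, \<open>\<nabla>w = 2 \<mu> \<nabla>v\<close> for a number
  \<open>\<mu>\<close>; that is, \<open>\<nabla>v\<close> is an eigenvector of the Hessian of \<open>v\<close> with eigenvalue \<open>\<mu>\<close>. The trace
  inequality on the complement of the eigenvector, together with the contribution of
  \<open>\<nabla>\<phi> \<otimes> \<nabla>\<phi>/(m - n)\<close>, improves the term \<open>|Hess v|\<^sup>2\<close> of the Bochner formula to at least
  \<open>\<mu>\<^sup>2 + (L - \<mu>)\<^sup>2/(m - 1)\<close>, instead of the usual \<open>L\<^sup>2/m\<close>. This improvement is what makes the range
  \<open>p \<le> 1 + 1/\<surd>(m - 1)\<close> sufficient: after all substitutions, maximizing over \<open>L - \<mu>\<close> leaves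
  \<open>(p - 1)(m - 1) - 1/(p - 1)\<close> as coefficient of \<open>w\<^sup>2/(2 v)\<close>. The exponent \<open>\<beta>\<close> is the one for which
  the mixed terms \<open>\<langle>\<nabla>v, \<nabla>w\<rangle>\<close> cancel, and the sign conditions on \<open>\<Gamma>\<close>, \<open>\<Sigma>\<close> control the
  remaining terms (\<open>maximum_point_inequality\<close>, \<open>spacetime_maximum\<close>).

  Everything is computed in coordinates, for functions on an open set with a matrix-valued
  metric. The Bochner formula is obtained as a statement on arbitrary vector fields \<open>V\<close>,
  \<open>div(\<nabla>_V V) = V(div V) + tr((\<nabla>V)\<^sup>2) + Ric(V, V)\<close>, in which only the symmetry of the Christoffel
  symbols is used. Since the Laplacian on the manifold is evaluated in a chart chosen separately
  at each point, differentiating the equation requires the Laplacian to be independent of the chart;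
  this follows from an expression of the Hessian by iterated inner products of gradients
  (\<open>hess_polarization\<close>), for which invariance is immediate.
\<close>

text \<open>
  Sums without a range run over all values of the index type, as usual for tensor components.
\<close>

no_notation suminf (binder \<open>\<Sum>\<close> 10)

abbreviation (input) index_sum :: "('i \<Rightarrow> 'b::comm_monoid_add) \<Rightarrow> 'b" (binder \<open>\<Sum>\<close> 10) where
  "index_sum f \<equiv> sum f UNIV"

section \<open>Calculus of functions of class \<open>C\<^sup>k\<close> on open sets\<close>

definition dirderiv :: "'e::euclidean_space \<Rightarrow> ('e \<Rightarrow> real) \<Rightarrow> 'e \<Rightarrow> real" where
  "dirderiv b f y = frechet_derivative f (at y) b"

lemma pd_dirderiv: "pd i f = dirderiv (axis i 1) f"
  by (simp add: fun_eq_iff pd_def dirderiv_def)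

lemma axis_Basis: "axis i (1::real) \<in> Basis"
  by (simp add: axis_in_Basis_iff)

lemma dirderiv_eqI: "(f has_derivative f') (at y) \<Longrightarrow> dirderiv b f y = f' b"
  by (simp add: dirderiv_def flip: frechet_derivative_at)

lemma has_derivative_dirderiv: "f differentiable (at y) \<Longrightarrow> (f has_derivative (\<lambda>b. dirderiv b f y)) (at y)"
  by (simp add: dirderiv_def[abs_def] frechet_derivative_works)

lemma has_derivative_cong_open:
  assumes "open D" "y \<in> D" "\<And>z. z \<in> D \<Longrightarrow> f z = g z"
  shows "(f has_derivative f') (at y) \<longleftrightarrow> (g has_derivative f') (at y)"
  using assms has_derivative_transform_within_open[of f f' y UNIV D g]
    has_derivative_transform_within_open[of g f' y UNIV D f] by auto

lemma dirderiv_cong: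
  assumes "open D" "y \<in> D" "\<And>z. z \<in> D \<Longrightarrow> f z = g z"
  shows "dirderiv b f y = dirderiv b g y"
  using has_derivative_cong_open[OF assms] by (simp add: dirderiv_def frechet_derivative_def)

lemma differentiable_cong_open:
  assumes "open D" "y \<in> D" "\<And>z. z \<in> D \<Longrightarrow> f z = g z"
  shows "f differentiable (at y) \<longleftrightarrow> g differentiable (at y)"
  using has_derivative_cong_open[OF assms] by (simp add: differentiable_def)

lemma dirderiv_const [simp]: "dirderiv b (\<lambda>z. c) y = 0"
  by (simp add: dirderiv_def)

lemma dirderiv_add:
  assumes "f differentiable (at y)" "h differentiable (at y)"
  shows "dirderiv b (\<lambda>z. f z + h z) y = dirderiv b f y + dirderiv b h y"
  by (rule dirderiv_eqI[OF has_derivative_add[OF assms[THEN has_derivative_dirderiv]]])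

lemma dirderiv_diff:
  assumes "f differentiable (at y)" "h differentiable (at y)"
  shows "dirderiv b (\<lambda>z. f z - h z) y = dirderiv b f y - dirderiv b h y"
  by (rule dirderiv_eqI[OF has_derivative_diff[OF assms[THEN has_derivative_dirderiv]]])

lemma dirderiv_mult:
  assumes "f differentiable (at y)" "h differentiable (at y)"
  shows "dirderiv b (\<lambda>z. f z * h z) y = dirderiv b f y * h y + f y * dirderiv b h y"
  by (subst dirderiv_eqI[OF has_derivative_mult[OF assms[THEN has_derivative_dirderiv]]]) simp

lemma dirderiv_cmult:
  assumes "f differentiable (at y)"
  shows "dirderiv b (\<lambda>z. c * f z) y = c * dirderiv b f y"
  by (rule dirderiv_eqI[OF has_derivative_mult_right[OF assms[THEN has_derivative_dirderiv]]])

lemma dirderiv_sum: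
  assumes "\<And>i. i \<in> I \<Longrightarrow> f i differentiable (at y)"
  shows "dirderiv b (\<lambda>z. \<Sum>i\<in>I. f i z) y = (\<Sum>i\<in>I. dirderiv b (f i) y)"
  by (rule dirderiv_eqI[OF has_derivative_sum]) (use assms has_derivative_dirderiv in blast)

lemma dirderiv_compose_real:
  assumes "f differentiable (at y)" "(h has_real_derivative h') (at (f y))"
  shows "dirderiv b (\<lambda>z. h (f z)) y = h' * dirderiv b f y"
    and "(\<lambda>z. h (f z)) differentiable (at y)"
proof -
  have "((\<lambda>z. h (f z)) has_derivative (\<lambda>b. h' * dirderiv b f y)) (at y)"
    using has_derivative_compose[OF has_derivative_dirderiv[OF assms(1)]] assms(2)
    by (simp add: has_field_derivative_def)
  then show "dirderiv b (\<lambda>z. h (f z)) y = h' * dirderiv b f y" "(\<lambda>z. h (f z)) differentiable (at y)"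
    by (auto intro: dirderiv_eqI differentiableI)
qed

lemma has_real_derivative_line:
  assumes "f differentiable (at (p + r *\<^sub>R a))"
  shows "((\<lambda>r. f (p + r *\<^sub>R a)) has_real_derivative dirderiv a f (p + r *\<^sub>R a)) (at r)"
proof -
  have "((\<lambda>r. p + r *\<^sub>R a) has_derivative (\<lambda>h. h *\<^sub>R a)) (at r)"
    by (auto intro!: derivative_eq_intros)
  from has_derivative_compose[OF this has_derivative_dirderiv[OF assms]]
  have "((\<lambda>r. f (p + r *\<^sub>R a)) has_derivative (\<lambda>h. dirderiv (h *\<^sub>R a) f (p + r *\<^sub>R a))) (at r)" .
  moreover have "dirderiv (h *\<^sub>R a) f (p + r *\<^sub>R a) = dirderiv a f (p + r *\<^sub>R a) * h" for h
    using linear_scale[OF linear_frechet_derivative[OF assms]] by (simp add: dirderiv_def)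
  ultimately show ?thesis by (simp add: has_field_derivative_def)
qed

lemma dirderiv_expand:
  fixes f :: "real^'n \<Rightarrow> real"
  assumes "f differentiable (at y)"
  shows "dirderiv \<xi> f y = (\<Sum>i. \<xi> $ i * pd i f y)"
proof -
  interpret linear "\<lambda>b. dirderiv b f y"
    using linear_frechet_derivative[OF assms] by (simp add: dirderiv_def[abs_def])
  have "dirderiv \<xi> f y = dirderiv (\<Sum>i. \<xi> $ i *\<^sub>R axis i 1) f y"
    by (simp add: basis_expansion flip: scalar_mult_eq_scaleR)
  then show ?thesis by (simp add: sum scale pd_dirderiv)
qed

text \<open>
  On an open set the derivative within the domain is the derivative at the point, so that the class
  \<open>C^k\<close> can be unfolded by directional derivatives at points. The closure properties below are
  inductions based on this form.
\<close>

lemma Ck_on_Suc_open: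
  assumes "open D"
  shows "Ck_on (Suc k) D f \<longleftrightarrow>
    (\<forall>y\<in>D. f differentiable (at y)) \<and> (\<forall>b\<in>Basis. Ck_on k D (dirderiv b f))"
proof -
  have *: "Ck_on k D h \<longleftrightarrow> Ck_on k D h'" if "\<And>y. y \<in> D \<Longrightarrow> h y = h' y" for h h'
    using that
  proof (induction k arbitrary: h h')
    case 0
    then show ?case by (simp cong: continuous_on_cong)
  next
    case (Suc k)
    have "h differentiable (at y within D) \<longleftrightarrow> h' differentiable (at y within D)"
      "frechet_derivative h (at y within D) = frechet_derivative h' (at y within D)" if "y \<in> D" for y
      using differentiable_cong_open[OF assms that Suc.prems] dirderiv_cong[OF assms that Suc.prems]
        at_within_open[OF that assms] by (auto simp: dirderiv_def fun_eq_iff)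
    then show ?case
      using Suc.IH[of "\<lambda>y. frechet_derivative h (at y within D) b"
          "\<lambda>y. frechet_derivative h' (at y within D) b" for b]
      by (simp add: differentiable_on_def)
  qed
  have "Ck_on k D (\<lambda>y. frechet_derivative f (at y within D) b) \<longleftrightarrow> Ck_on k D (dirderiv b f)" for b
    by (rule *) (simp add: dirderiv_def at_within_open[OF _ assms])
  then show ?thesis
    by (simp add: differentiable_on_def at_within_open[OF _ assms])
qed

lemma Ck_on_cong:
  assumes "open D" "\<And>y. y \<in> D \<Longrightarrow> f y = h y"
  shows "Ck_on k D f \<longleftrightarrow> Ck_on k D h"
  using assms(2)
proof (induction k arbitrary: f h)
  case 0
  then show ?case by (simp cong: continuous_on_cong)
next
  case (Suc k)
  have "Ck_on k D (dirderiv b f) \<longleftrightarrow> Ck_on k D (dirderiv b h)" for b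
    by (rule Suc.IH) (use Suc.prems assms(1) dirderiv_cong in blast)
  moreover have "f differentiable (at y) \<longleftrightarrow> h differentiable (at y)" if "y \<in> D" for y
    using Suc.prems assms(1) that by (rule differentiable_cong_open[rotated 2])
  ultimately show ?case by (simp add: Ck_on_Suc_open[OF assms(1)] del: Ck_on.simps)
qed

text \<open>
  This restricts functions on a cylinder with closed time interval to its interior, where all
  derivatives are derivatives at points.
\<close>

lemma Ck_on_open_subset:
  assumes "open E" "E \<subseteq> D" "Ck_on k D f"
  shows "Ck_on k E f"
  using assms(3)
proof (induction k arbitrary: f)
  case 0
  then show ?case using assms(2) continuous_on_subset by auto
next
  case (Suc k)
  have *: "at y within D = at y" if "y \<in> E" for y
    using at_within_open_subset[OF that assms(1,2)] .
  have "Ck_on k E (\<lambda>y. frechet_derivative f (at y within D) b)" if "b \<in> Basis" for b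
    using Suc that by simp
  moreover have "Ck_on k E (\<lambda>y. frechet_derivative f (at y within D) b) \<longleftrightarrow> Ck_on k E (dirderiv b f)" for b
    by (rule Ck_on_cong[OF assms(1)]) (simp add: * dirderiv_def)
  moreover have "f differentiable (at y)" if "y \<in> E" for y
    using Suc.prems that assms(2) *[OF that]
    by (metis Ck_on.simps(2) differentiable_on_def subsetD)
  ultimately show ?case by (simp add: Ck_on_Suc_open[OF assms(1)] del: Ck_on.simps)
qed

lemma Ck_on_Suc_imp: "Ck_on (Suc k) D f \<Longrightarrow> Ck_on k D f"
proof (induction k arbitrary: f)
  case 0
  then show ?case by (simp add: differentiable_imp_continuous_on)
next
  case (Suc k)
  then show ?case
    using Ck_on.simps(2)[of "Suc k" D f] Ck_on.simps(2)[of k D f] by blast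
qed

lemma Ck_on_const: "open D \<Longrightarrow> Ck_on k D (\<lambda>y. c)"
proof (induction k arbitrary: c)
  case (Suc k)
  have "dirderiv b (\<lambda>y. c) = (\<lambda>y. 0)" for b :: 'a by (simp add: fun_eq_iff)
  then show ?case using Suc by (simp add: Ck_on_Suc_open del: Ck_on.simps)
qed simp

lemma Ck_on_add:
  assumes "open D" "Ck_on k D f" "Ck_on k D h"
  shows "Ck_on k D (\<lambda>y. f y + h y)"
  using assms(2,3)
proof (induction k arbitrary: f h)
  case 0
  then show ?case by (simp add: continuous_on_add)
next
  case (Suc k)
  note S = Suc.prems[unfolded Ck_on_Suc_open[OF assms(1)]]
  have "Ck_on k D (dirderiv b (\<lambda>y. f y + h y))" if "b \<in> Basis" for b
  proof -
    have "Ck_on k D (\<lambda>y. dirderiv b f y + dirderiv b h y)" using Suc.IH S that by blast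
    then show ?thesis
      by (rule Ck_on_cong[THEN iffD1, OF assms(1), rotated]) (use S dirderiv_add[of f _ h b] in auto)
  qed
  with S show ?case by (simp add: Ck_on_Suc_open[OF assms(1)] del: Ck_on.simps)
qed

lemma Ck_on_mult:
  assumes "open D" "Ck_on k D f" "Ck_on k D h"
  shows "Ck_on k D (\<lambda>y. f y * h y)"
  using assms(2,3)
proof (induction k arbitrary: f h)
  case 0
  then show ?case by (simp add: continuous_on_mult)
next
  case (Suc k)
  note S = Suc.prems[unfolded Ck_on_Suc_open[OF assms(1)]]
  have "Ck_on k D (dirderiv b (\<lambda>y. f y * h y))" if "b \<in> Basis" for b
  proof -
    have "Ck_on k D (\<lambda>y. dirderiv b f y * h y + f y * dirderiv b h y)"
      using Suc.IH S that Suc.prems[THEN Ck_on_Suc_imp] by (intro Ck_on_add[OF assms(1)]) blast+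
    then show ?thesis
      by (rule Ck_on_cong[THEN iffD1, OF assms(1), rotated]) (use S dirderiv_mult[of f _ h b] in auto)
  qed
  with S show ?case by (simp add: Ck_on_Suc_open[OF assms(1)] del: Ck_on.simps)
qed

lemma Ck_on_compose_real:
  fixes h :: "real \<Rightarrow> real"
  assumes "open D" "open S" "\<And>y. y \<in> D \<Longrightarrow> f y \<in> S" "Ck_on k S h" "Ck_on k D f"
  shows "Ck_on k D (\<lambda>y. h (f y))"
  using assms(4,5)
proof (induction k arbitrary: h)
  case 0
  then have "continuous_on D (h \<circ> f)"
    using assms(3) by (intro continuous_on_compose) (auto intro: continuous_on_subset)
  then show ?case by (simp add: o_def)
next
  case (Suc k)
  note S = Suc.prems(2)[unfolded Ck_on_Suc_open[OF assms(1)]]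
  note H = Suc.prems(1)[unfolded Ck_on_Suc_open[OF assms(2)]]
  have der: "(h has_real_derivative dirderiv 1 h (f y)) (at (f y))" if "y \<in> D" for y
    using has_real_derivative_line[of h 0 "f y" 1] H assms(3)[OF that] by simp
  have "Ck_on k D (dirderiv b (\<lambda>y. h (f y)))" if "b \<in> Basis" for b
  proof -
    have "Ck_on k D (\<lambda>y. dirderiv 1 h (f y) * dirderiv b f y)"
      using Suc.IH[of "dirderiv 1 h"] S that Suc.prems(2)[THEN Ck_on_Suc_imp] H
      by (intro Ck_on_mult[OF assms(1)]) auto
    then show ?thesis
      by (rule Ck_on_cong[THEN iffD1, OF assms(1), rotated])
        (rule dirderiv_compose_real(1)[of f _ h, symmetric], use S der in auto)
  qed
  moreover have "(\<lambda>y. h (f y)) differentiable (at y)" if "y \<in> D" for y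
    by (rule dirderiv_compose_real(2)[of f y h, OF _ der[OF that]]) (use S that in simp)
  ultimately show ?case unfolding Ck_on_Suc_open[OF assms(1)] by simp
qed

text \<open>
  The derivative of \<open>1/x\<close> is \<open>-(1/x)\<sqdot>(1/x)\<close>, so each order of regularity follows from the
  previous one by the product rule.
\<close>

lemma Ck_on_inverse: "Ck_on k (- {0}) (inverse :: real \<Rightarrow> real)"
proof (induction k)
  case 0
  show ?case by (auto intro: continuous_intros)
next
  case (Suc k)
  have o: "open (- {0::real})" by auto
  have d: "(inverse has_derivative (\<lambda>b. - (inverse y * b * inverse y))) (at y)" if "y \<in> -{0}" for y :: real
    using that has_derivative_inverse' by auto
  have "Ck_on k (-{0}) (dirderiv 1 inverse :: real \<Rightarrow> real)"
  proof (rule Ck_on_cong[THEN iffD1, OF o])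
    show "Ck_on k (-{0}) (\<lambda>y::real. (-1) * (inverse y * inverse y))"
      by (intro Ck_on_mult Ck_on_const o Suc)
    show "(-1) * (inverse y * inverse y) = dirderiv 1 inverse y" if "y \<in> -{0}" for y :: real
      using dirderiv_eqI[OF d[OF that], of 1] by simp
  qed
  then show ?case using d by (auto simp: Ck_on_Suc_open[OF o] differentiable_def simp del: Ck_on.simps)
qed

lemma Ck_on_powr: "Ck_on k {0<..} (\<lambda>x::real. x powr \<alpha>)"
proof (induction k arbitrary: \<alpha>)
  case 0
  show ?case by (auto intro!: continuous_intros)
next
  case (Suc k)
  have o: "open {0::real<..}" by auto
  have d: "((\<lambda>x. x powr \<alpha>) has_derivative (\<lambda>b. \<alpha> * y powr (\<alpha> - 1) * b)) (at y)" if "y \<in> {0<..}" for y :: real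
    using has_real_derivative_powr[of y \<alpha>] that by (simp add: has_field_derivative_def)
  have "Ck_on k {0<..} (dirderiv 1 (\<lambda>x::real. x powr \<alpha>))"
  proof (rule Ck_on_cong[THEN iffD1, OF o])
    show "Ck_on k {0<..} (\<lambda>y::real. \<alpha> * y powr (\<alpha> - 1))"
      by (intro Ck_on_mult Ck_on_const o Suc)
    show "\<alpha> * y powr (\<alpha> - 1) = dirderiv 1 (\<lambda>x. x powr \<alpha>) y" if "y \<in> {0<..}" for y :: real
      using dirderiv_eqI[OF d[OF that], of 1] by simp
  qed
  then show ?case using d by (auto simp: Ck_on_Suc_open[OF o] differentiable_def simp del: Ck_on.simps)
qed

lemma smooth_on_Ck: "smooth_on D f \<Longrightarrow> Ck_on k D f"
  by (simp add: smooth_on_def)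

lemma smooth_on_cong:
  assumes "open D" "\<And>y. y \<in> D \<Longrightarrow> f y = h y"
  shows "smooth_on D f \<longleftrightarrow> smooth_on D h"
  using Ck_on_cong[OF assms] by (simp add: smooth_on_def)

lemma smooth_on_open_subset: "open E \<Longrightarrow> E \<subseteq> D \<Longrightarrow> smooth_on D f \<Longrightarrow> smooth_on E f"
  unfolding smooth_on_def by (metis Ck_on_open_subset)

lemma smooth_on_const: "open D \<Longrightarrow> smooth_on D (\<lambda>y. c)"
  by (simp add: smooth_on_def Ck_on_const)

lemma smooth_on_add:
  "open D \<Longrightarrow> smooth_on D f \<Longrightarrow> smooth_on D h \<Longrightarrow> smooth_on D (\<lambda>y. f y + h y)"
  by (simp add: smooth_on_def Ck_on_add)

lemma smooth_on_mult:
  "open D \<Longrightarrow> smooth_on D f \<Longrightarrow> smooth_on D h \<Longrightarrow> smooth_on D (\<lambda>y. f y * h y)"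
  by (simp add: smooth_on_def Ck_on_mult)

lemma smooth_on_diff:
  assumes "open D" "smooth_on D f" "smooth_on D h"
  shows "smooth_on D (\<lambda>y. f y - h y)"
  using smooth_on_add[OF assms(1,2) smooth_on_mult[OF assms(1) smooth_on_const[OF assms(1), of "-1"] assms(3)]]
  by simp

lemma smooth_on_sum:
  assumes "open D" "\<And>i. i \<in> I \<Longrightarrow> smooth_on D (f i)"
  shows "smooth_on D (\<lambda>y. \<Sum>i\<in>I. f i y)"
  using assms(2)
  by (induction I rule: infinite_finite_induct) (simp_all add: smooth_on_const smooth_on_add assms(1))

lemma smooth_on_prod:
  assumes "open D" "\<And>i. i \<in> I \<Longrightarrow> smooth_on D (f i)"
  shows "smooth_on D (\<lambda>y. \<Prod>i\<in>I. f i y)"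
  using assms(2)
  by (induction I rule: infinite_finite_induct) (simp_all add: smooth_on_const smooth_on_mult assms(1))

lemma smooth_on_powr:
  assumes "open D" "smooth_on D f" "\<And>y. y \<in> D \<Longrightarrow> f y > 0"
  shows "smooth_on D (\<lambda>y. f y powr \<alpha>)"
  using assms Ck_on_compose_real[OF assms(1) open_greaterThan, of f 0 _ "\<lambda>x. x powr \<alpha>"] Ck_on_powr
  by (auto simp: smooth_on_def)

lemma smooth_on_inverse:
  assumes "open D" "smooth_on D f" "\<And>y. y \<in> D \<Longrightarrow> f y \<noteq> 0"
  shows "smooth_on D (\<lambda>y. inverse (f y))"
  using assms Ck_on_compose_real[OF assms(1), of "-{0}" f _ inverse] Ck_on_inverse
  by (auto simp: smooth_on_def)

lemma smooth_on_dirderiv: "open D \<Longrightarrow> smooth_on D f \<Longrightarrow> b \<in> Basis \<Longrightarrow> smooth_on D (dirderiv b f)"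
  unfolding smooth_on_def using Ck_on_Suc_open by blast

lemma smooth_on_pd: "open D \<Longrightarrow> smooth_on D f \<Longrightarrow> smooth_on D (pd i f)"
  by (simp add: pd_dirderiv smooth_on_dirderiv axis_Basis)

lemma smooth_on_differentiable: "open D \<Longrightarrow> smooth_on D f \<Longrightarrow> y \<in> D \<Longrightarrow> f differentiable (at y)"
  unfolding smooth_on_def using Ck_on_Suc_open[of D 0 f] by blast

lemma pd_cong:
  assumes "open D" "y \<in> D" "\<And>z. z \<in> D \<Longrightarrow> f z = g z"
  shows "pd i f y = pd i g y"
  unfolding pd_dirderiv using assms by (rule dirderiv_cong)

lemma
  assumes "f differentiable (at y)" "h differentiable (at y)"
  shows pd_add: "pd i (\<lambda>z. f z + h z) y = pd i f y + pd i h y"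
    and pd_diff: "pd i (\<lambda>z. f z - h z) y = pd i f y - pd i h y"
    and pd_mult: "pd i (\<lambda>z. f z * h z) y = pd i f y * h y + f y * pd i h y"
  unfolding pd_dirderiv using assms by (simp_all add: dirderiv_add dirderiv_diff dirderiv_mult)

lemma pd_cmult: "f differentiable (at y) \<Longrightarrow> pd i (\<lambda>z. c * f z) y = c * pd i f y"
  by (simp add: pd_dirderiv dirderiv_cmult)

lemma pd_sum:
  assumes "\<And>j. j \<in> I \<Longrightarrow> f j differentiable (at y)"
  shows "pd i (\<lambda>z. \<Sum>j\<in>I. f j z) y = (\<Sum>j\<in>I. pd i (f j) y)"
  unfolding pd_dirderiv using assms by (rule dirderiv_sum)

lemma pd_compose_real:
  assumes "f differentiable (at y)" "(h has_real_derivative h') (at (f y))"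
  shows "pd i (\<lambda>z. h (f z)) y = h' * pd i f y"
  unfolding pd_dirderiv using assms by (rule dirderiv_compose_real)

lemma pd_const [simp]: "pd i (\<lambda>z. c) y = 0"
  by (simp add: pd_dirderiv)

lemmas smooth_intros = smooth_on_add smooth_on_diff smooth_on_mult smooth_on_sum smooth_on_const
  smooth_on_pd

text \<open>
  The mean value theorem, applied in direction \<open>a\<close> and then in direction \<open>b\<close>, writes a second difference
  as a mixed derivative at a nearby point.
\<close>

lemma second_difference_mean_value:
  assumes "open D" "Ck_on 2 D f" "a \<in> Basis" "b \<in> Basis" "s > 0" "cball y (2 * s) \<subseteq> D"
  shows "\<exists>\<xi>\<in>cball y (2 * s).
    f (y + s *\<^sub>R a + s *\<^sub>R b) - f (y + s *\<^sub>R a) - f (y + s *\<^sub>R b) + f y = s * s * dirderiv b (dirderiv a f) \<xi>"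
proof -
  have D1: "f differentiable (at z)" "dirderiv a f differentiable (at z)" if "z \<in> D" for z
    using assms(2,3) that
    by (auto simp: numeral_2_eq_2 Ck_on_Suc_open[OF assms(1)] simp del: Ck_on.simps)
  have in_cball: "y + r *\<^sub>R a + q *\<^sub>R b \<in> cball y (2 * s)" if "0 \<le> r" "r \<le> s" "0 \<le> q" "q \<le> s" for r q
  proof -
    have "norm (r *\<^sub>R a + q *\<^sub>R b) \<le> r + q"
      using norm_triangle_ineq[of "r *\<^sub>R a" "q *\<^sub>R b"] that assms(3,4) by simp
    then have "dist y (y + (r *\<^sub>R a + q *\<^sub>R b)) \<le> 2 * s"
      using that by (simp add: dist_norm del: minus_add_distrib)
    then show ?thesis by (simp add: add.assoc)
  qed
  have inD: "y + r *\<^sub>R a + q *\<^sub>R b \<in> D" if "0 \<le> r" "r \<le> s" "0 \<le> q" "q \<le> s" for r q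
    using in_cball[OF that] assms(6) by blast
  define \<phi> where "\<phi> r = f (y + s *\<^sub>R b + r *\<^sub>R a) - f (y + r *\<^sub>R a)" for r
  have "(\<phi> has_real_derivative (dirderiv a f (y + s *\<^sub>R b + r *\<^sub>R a) - dirderiv a f (y + r *\<^sub>R a))) (at r)"
    if "0 \<le> r" "r \<le> s" for r
    unfolding \<phi>_def
    using inD[of r s] inD[of r 0] that assms(5)
    by (intro DERIV_diff has_real_derivative_line D1) (auto simp: algebra_simps)
  from MVT2[OF assms(5) this]
  obtain r where r: "0 < r" "r < s"
    "\<phi> s - \<phi> 0 = s * (dirderiv a f (y + s *\<^sub>R b + r *\<^sub>R a) - dirderiv a f (y + r *\<^sub>R a))" by auto
  define \<psi> where "\<psi> q = dirderiv a f (y + r *\<^sub>R a + q *\<^sub>R b)" for q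
  have "(\<psi> has_real_derivative dirderiv b (dirderiv a f) (y + r *\<^sub>R a + q *\<^sub>R b)) (at q)"
    if "0 \<le> q" "q \<le> s" for q
    unfolding \<psi>_def using inD[of r q] that r by (intro has_real_derivative_line D1) auto
  from MVT2[OF assms(5) this]
  obtain q where q: "0 < q" "q < s" "\<psi> s - \<psi> 0 = s * dirderiv b (dirderiv a f) (y + r *\<^sub>R a + q *\<^sub>R b)" by auto
  have "\<phi> s - \<phi> 0 = s * (\<psi> s - \<psi> 0)"
    using r(3) by (simp add: \<psi>_def algebra_simps)
  then have "\<phi> s - \<phi> 0 = s * s * dirderiv b (dirderiv a f) (y + r *\<^sub>R a + q *\<^sub>R b)" using q(3) by simp
  moreover have "\<phi> s - \<phi> 0 = f (y + s *\<^sub>R a + s *\<^sub>R b) - f (y + s *\<^sub>R a) - f (y + s *\<^sub>R b) + f y"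
    by (simp add: \<phi>_def algebra_simps)
  ultimately show ?thesis using in_cball[of r q] r q by force
qed

text \<open>
  The second difference is symmetric in the two directions, so both mixed derivatives are limits
  of the same quotients.
\<close>

lemma dirderiv_commute:
  assumes "open D" "Ck_on 2 D f" "a \<in> Basis" "b \<in> Basis" "y \<in> D"
  shows "dirderiv a (dirderiv b f) y = dirderiv b (dirderiv a f) y"
proof (rule ccontr)
  assume neq: "dirderiv a (dirderiv b f) y \<noteq> dirderiv b (dirderiv a f) y"
  define e where "e = \<bar>dirderiv a (dirderiv b f) y - dirderiv b (dirderiv a f) y\<bar> / 2"
  have "e > 0" using neq by (simp add: e_def)
  have c: "isCont (dirderiv b (dirderiv a f)) y" "isCont (dirderiv a (dirderiv b f)) y"
    using assms by (auto simp: numeral_2_eq_2 Ck_on_Suc_open[OF assms(1)] continuous_on_eq_continuous_at[OF assms(1)] simp del: Ck_on.simps(2))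
  obtain d1 where d1: "d1 > 0" "\<And>z. dist z y < d1 \<Longrightarrow> dist (dirderiv b (dirderiv a f) z) (dirderiv b (dirderiv a f) y) < e"
    using c(1) \<open>e > 0\<close> unfolding continuous_at_eps_delta by (metis dist_commute)
  obtain d2 where d2: "d2 > 0" "\<And>z. dist z y < d2 \<Longrightarrow> dist (dirderiv a (dirderiv b f) z) (dirderiv a (dirderiv b f) y) < e"
    using c(2) \<open>e > 0\<close> unfolding continuous_at_eps_delta by (metis dist_commute)
  obtain d3 where d3: "d3 > 0" "cball y d3 \<subseteq> D"
    using assms(1,5) open_contains_cball by blast
  define s where "s = min d3 (min d1 d2) / 3"
  have s: "s > 0" "2 * s < d1" "2 * s < d2" "2 * s < d3" using d1(1) d2(1) d3(1) by (auto simp: s_def)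
  have sub: "cball y (2 * s) \<subseteq> D" using d3(2) s(4) subset_cball[of "2 * s" d3 y] by auto
  obtain \<xi> where xi: "\<xi> \<in> cball y (2 * s)"
    "f (y + s *\<^sub>R a + s *\<^sub>R b) - f (y + s *\<^sub>R a) - f (y + s *\<^sub>R b) + f y = s * s * dirderiv b (dirderiv a f) \<xi>"
    using second_difference_mean_value[OF assms(1-4) s(1) sub] by blast
  obtain \<eta> where eta: "\<eta> \<in> cball y (2 * s)"
    "f (y + s *\<^sub>R b + s *\<^sub>R a) - f (y + s *\<^sub>R b) - f (y + s *\<^sub>R a) + f y = s * s * dirderiv a (dirderiv b f) \<eta>"
    using second_difference_mean_value[OF assms(1,2,4,3) s(1) sub] by blast
  have "s * s * dirderiv b (dirderiv a f) \<xi> = s * s * dirderiv a (dirderiv b f) \<eta>"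
    using xi(2) eta(2) by (simp add: algebra_simps)
  then have "dirderiv b (dirderiv a f) \<xi> = dirderiv a (dirderiv b f) \<eta>" using s(1) by simp
  moreover have "dist (dirderiv b (dirderiv a f) \<xi>) (dirderiv b (dirderiv a f) y) < e" "dist (dirderiv a (dirderiv b f) \<eta>) (dirderiv a (dirderiv b f) y) < e"
    using d1(2)[of \<xi>] d2(2)[of \<eta>] xi(1) eta(1) s by (auto simp: dist_commute)
  ultimately have "\<bar>dirderiv a (dirderiv b f) y - dirderiv b (dirderiv a f) y\<bar> < 2 * e" by (auto simp: dist_real_def)
  then show False by (simp add: e_def)
qed

lemma pd_commute:
  assumes "open D" "Ck_on 2 D f" "y \<in> D"
  shows "pd i (pd j f) y = pd j (pd i f) y"
  using dirderiv_commute[OF assms(1,2) axis_Basis axis_Basis assms(3)] by (simp add: pd_dirderiv)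

lemma pd_eq_0_at_max:
  assumes "open D" "y \<in> D" "f differentiable (at y)" "\<And>z. z \<in> D \<Longrightarrow> f z \<le> f y"
  shows "pd i f y = 0"
  using differential_zero_maxmin[OF assms(2,1) has_derivative_dirderiv[OF assms(3)]] assms(4)
  by (simp add: pd_dirderiv fun_eq_iff)

text \<open>
  Along a line through the maximum the first derivative vanishes at the maximum; a positive second
  derivative would make the function increase.
\<close>

lemma second_derivative_nonpos_at_max:
  fixes f :: "real^'n \<Rightarrow> real"
  assumes "open D" "y \<in> D" "Ck_on 2 D f" "\<And>z. z \<in> D \<Longrightarrow> f z \<le> f y"
  shows "(\<Sum>i j. \<xi> $ i * \<xi> $ j * pd i (pd j f) y) \<le> 0"
proof (rule ccontr)
  assume pos: "\<not> ?thesis"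
  have d: "f differentiable (at z)" "pd j f differentiable (at z)" if "z \<in> D" for z j
    using assms(3) that axis_Basis
    by (auto simp: pd_dirderiv numeral_2_eq_2 Ck_on_Suc_open[OF assms(1)] simp del: Ck_on.simps)
  define h where "h z = (\<Sum>j. \<xi> $ j * pd j f z)" for z
  have h: "dirderiv \<xi> f z = h z" if "z \<in> D" for z using dirderiv_expand[OF d(1)[OF that]] by (simp add: h_def)
  have hd: "h differentiable (at y)"
    unfolding h_def using d(2)[OF assms(2)]
    by (intro differentiable_sum differentiable_mult differentiable_const) auto
  have dh: "dirderiv \<xi> h y = (\<Sum>i j. \<xi> $ i * \<xi> $ j * pd i (pd j f) y)"
    unfolding dirderiv_expand[OF hd] unfolding h_def pd_dirderiv
    using d(2)[OF assms(2)]
    by (subst dirderiv_sum) (simp_all add: dirderiv_cmult sum_distrib_left mult.assoc pd_dirderiv)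
  obtain e where e: "e > 0" "ball y e \<subseteq> D" using assms(1,2) open_contains_ball by blast
  define d0 where "d0 = e / (norm \<xi> + 1)"
  have d0: "d0 > 0" using e by (simp add: d0_def add_nonneg_pos)
  have inD: "y + r *\<^sub>R \<xi> \<in> D" if "\<bar>r\<bar> < d0" for r
  proof -
    have "\<bar>r\<bar> * norm \<xi> \<le> \<bar>r\<bar> * (norm \<xi> + 1)" by (simp add: mult_left_mono)
    also have "... < e" using that by (simp add: d0_def pos_less_divide_eq add_nonneg_pos)
    finally have "dist y (y + r *\<^sub>R \<xi>) < e" by (simp add: dist_norm)
    then show ?thesis using e by auto
  qed
  have "((\<lambda>r. h (y + r *\<^sub>R \<xi>)) has_real_derivative dirderiv \<xi> h y) (at 0)"
    using has_real_derivative_line[of h y 0 \<xi>] hd by simp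
  from DERIV_pos_inc_right[OF this] pos dh
  obtain d1 where d1: "d1 > 0" "\<And>r. 0 < r \<Longrightarrow> r < d1 \<Longrightarrow> h y < h (y + r *\<^sub>R \<xi>)" by auto
  have hy: "h y = 0"
    unfolding h_def using pd_eq_0_at_max[OF assms(1,2) d(1)[OF assms(2)] assms(4)] by simp
  define s where "s = min d0 d1 / 2"
  have s: "0 < s" "s < d0" "s < d1" using d0 d1(1) by (auto simp: s_def)
  have "((\<lambda>r. f (y + r *\<^sub>R \<xi>)) has_real_derivative h (y + r *\<^sub>R \<xi>)) (at r)" if "0 \<le> r" "r \<le> s" for r
    using has_real_derivative_line[of f y r \<xi>] inD[of r] d(1) h that s by auto
  from MVT2[OF s(1) this] obtain r where "0 < r" "r < s" "f (y + s *\<^sub>R \<xi>) - f y = s * h (y + r *\<^sub>R \<xi>)" by auto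
  moreover from this have "s * h (y + r *\<^sub>R \<xi>) > 0" using d1(2)[of r] hy s by auto
  ultimately show False using assms(4)[OF inD[of s]] s by auto
qed

lemma Prod_Basis: "b \<in> Basis \<Longrightarrow> (b, 0) \<in> Basis" "(0, 1) \<in> (Basis :: ('e::euclidean_space \<times> real) set)"
  by (auto simp: Basis_prod_def)

lemma dirderiv_slice:
  fixes F :: "'e::euclidean_space \<times> real \<Rightarrow> real"
  assumes "F differentiable (at (y, t))"
  shows "dirderiv b (\<lambda>z. F (z, t)) y = dirderiv (b, 0) F (y, t)" "(\<lambda>z. F (z, t)) differentiable (at y)"
    "((\<lambda>s. F (y, s)) has_real_derivative dirderiv (0, 1) F (y, t)) (at t)"
proof -
  have "((\<lambda>z. (z, t)) has_derivative (\<lambda>h. (h, 0))) (at y)"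
    by (rule has_derivative_Pair[OF has_derivative_ident has_derivative_const])
  from has_derivative_compose[OF this has_derivative_dirderiv[OF assms]]
  have slice: "((\<lambda>z. F (z, t)) has_derivative (\<lambda>h. dirderiv (h, 0) F (y, t))) (at y)" .
  show "dirderiv b (\<lambda>z. F (z, t)) y = dirderiv (b, 0) F (y, t)" by (rule dirderiv_eqI[OF slice])
  show "(\<lambda>z. F (z, t)) differentiable (at y)" by (rule differentiableI[OF slice])
  have "((\<lambda>s. (y, s)) has_derivative (\<lambda>h. (0, h))) (at t)"
    by (rule has_derivative_Pair[OF has_derivative_const has_derivative_ident])
  from has_derivative_compose[OF this has_derivative_dirderiv[OF assms]]
  have "((\<lambda>s. F (y, s)) has_derivative (\<lambda>h. dirderiv (0, h) F (y, t))) (at t)" .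
  moreover have "(\<lambda>h. dirderiv (0, h) F (y, t)) = (*) (dirderiv (0, 1) F (y, t))"
  proof
    show "dirderiv (0, h) F (y, t) = dirderiv (0, 1) F (y, t) * h" for h
      using linear_scale[OF linear_frechet_derivative[OF assms], of h "(0, 1)"] by (simp add: dirderiv_def)
  qed
  ultimately show "((\<lambda>s. F (y, s)) has_real_derivative dirderiv (0, 1) F (y, t)) (at t)"
    by (simp add: has_field_derivative_def)
qed

lemma smooth_on_slice:
  fixes F :: "'e::euclidean_space \<times> real \<Rightarrow> real"
  assumes "open D" "open J" "smooth_on (D \<times> J) F" "t \<in> J"
  shows "smooth_on D (\<lambda>y. F (y, t))"
proof -
  have o: "open (D \<times> J)" using assms by (simp add: open_Times)
  have "Ck_on k D (\<lambda>y. F (y, t))" if "Ck_on k (D \<times> J) F" for k and F :: "'e \<times> real \<Rightarrow> real"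
    using that
  proof (induction k arbitrary: F)
    case 0
    then show ?case using assms(4)
      by (auto intro!: continuous_on_compose2[of "D \<times> J" F] continuous_intros)
  next
    case (Suc k)
    note S = Suc.prems[unfolded Ck_on_Suc_open[OF o]]
    have "Ck_on k D (dirderiv b (\<lambda>y. F (y, t)))" if "b \<in> Basis" for b
    proof -
      have "Ck_on k D (\<lambda>y. dirderiv (b, 0) F (y, t))" using S Suc.IH Prod_Basis(1)[OF that] by blast
      then show ?thesis
        by (rule Ck_on_cong[THEN iffD1, OF assms(1), rotated])
          (rule dirderiv_slice(1)[of F _ t b, symmetric], use S assms(4) in simp)
    qed
    moreover have "(\<lambda>y. F (y, t)) differentiable (at y)" if "y \<in> D" for y
      by (rule dirderiv_slice(2)[of F y t]) (use S that assms(4) in simp)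
    ultimately show ?case unfolding Ck_on_Suc_open[OF assms(1)] by simp
  qed
  then show ?thesis using assms(3) by (simp add: smooth_on_def)
qed

section \<open>Traces of products of symmetric matrices\<close>

lemma sum_swap_pairs:
  fixes f :: "'i \<Rightarrow> 'j \<Rightarrow> 'k \<Rightarrow> 'l \<Rightarrow> real"
  shows "(\<Sum>i\<in>I. \<Sum>j\<in>J. \<Sum>k\<in>K. \<Sum>l\<in>L. f i j k l) = (\<Sum>k\<in>K. \<Sum>l\<in>L. \<Sum>i\<in>I. \<Sum>j\<in>J. f i j k l)"
proof -
  have "(\<Sum>i\<in>I. \<Sum>j\<in>J. \<Sum>k\<in>K. \<Sum>l\<in>L. f i j k l) = (\<Sum>i\<in>I. \<Sum>k\<in>K. \<Sum>j\<in>J. \<Sum>l\<in>L. f i j k l)"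
    by (intro sum.cong refl sum.swap)
  also have "\<dots> = (\<Sum>k\<in>K. \<Sum>i\<in>I. \<Sum>l\<in>L. \<Sum>j\<in>J. f i j k l)"
    by (subst sum.swap) (intro sum.cong refl sum.swap)
  also have "\<dots> = (\<Sum>k\<in>K. \<Sum>l\<in>L. \<Sum>i\<in>I. \<Sum>j\<in>J. f i j k l)"
    by (intro sum.cong refl sum.swap)
  finally show ?thesis .
qed

lemma quadratic_form_shift:
  fixes M :: "'n::finite \<Rightarrow> 'n \<Rightarrow> real"
  assumes sym: "\<And>i j. M i j = M j i"
  shows "(\<Sum>i j. (\<xi> i + (if i = k then r else 0)) * M i j * (\<xi> j + (if j = k then r else 0)))
    = (\<Sum>i j. \<xi> i * M i j * \<xi> j) + 2 * r * (\<Sum>j. M k j * \<xi> j) + r * r * M k k"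
proof -
  have "(\<Sum>j. (\<xi> i + (if i = k then r else 0)) * M i j * (\<xi> j + (if j = k then r else 0)))
      = (\<Sum>j. \<xi> i * M i j * \<xi> j) + (if i = k then r * (\<Sum>j. M k j * \<xi> j) else 0)
        + r * (\<xi> i * M k i) + (if i = k then r * r * M k k else 0)" for i
  proof -
    have "(\<xi> i + (if i = k then r else 0)) * M i j * (\<xi> j + (if j = k then r else 0))
      = \<xi> i * M i j * \<xi> j + (if i = k then r * (M k j * \<xi> j) else 0)
       + (if j = k then r * (\<xi> i * M i j) else 0) + (if j = k then if i = k then r * r * M i j else 0 else 0)" for j
      by (auto simp: algebra_simps)
    then show ?thesis
      by (simp add: sum.distrib sum.delta sum_distrib_left sym[of i k])
  qed
  then show ?thesis
    by (simp add: sum.distrib sum.delta mult.commute flip: sum_distrib_left)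
qed

text \<open>
  This is \<open>tr(M N) \<ge> 0\<close> for positive semidefinite \<open>M\<close> and \<open>N\<close>. Instead of diagonalizing, one row and
  column of \<open>M\<close> is cleared by subtracting a matrix of rank one, as in the Cholesky decomposition;
  the rank-one part contributes a value of the quadratic form of \<open>N\<close>.
\<close>

lemma sum_psd_product_nonneg:
  fixes M N :: "'n::finite \<Rightarrow> 'n \<Rightarrow> real"
  assumes "\<And>i j. M i j = M j i" "\<And>\<xi>. (\<Sum>i j. \<xi> i * M i j * \<xi> j) \<ge> 0"
    and N: "\<And>\<xi>. (\<Sum>i j. \<xi> i * N i j * \<xi> j) \<ge> 0"
  shows "(\<Sum>i j. M i j * N i j) \<ge> 0"
  using assms(1,2)
proof (induction "card {i. \<exists>j. M i j \<noteq> 0}" arbitrary: M rule: less_induct)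
  case less
  note sym = less.prems(1) and psd = less.prems(2)
  show ?case
  proof (cases "\<exists>k j. M k j \<noteq> 0")
    case False
    then show ?thesis by simp
  next
    case True
    then obtain k j where kj: "M k j \<noteq> 0" by blast
    have Mkk0: "M k k \<ge> 0"
      using psd[of "\<lambda>i. 0 + (if i = k then 1 else 0)"] quadratic_form_shift[OF sym, of "\<lambda>i. 0" k 1] by simp
    have "M k k \<noteq> 0"
    proof
      assume 0: "M k k = 0"
      define e where "e i = (if i = j then 1 else 0 :: real)" for i
      have "(\<Sum>i l. e i * M i l * e l) = M j j" "(\<Sum>l. M k l * e l) = M k j"
        by (simp_all add: e_def if_distrib[of "\<lambda>x. _ * x"] if_distrib[of "\<lambda>x. x * _"] sum.delta cong: if_cong)
      then have "M j j + 2 * r * M k j \<ge> 0" for r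
        using psd[of "\<lambda>i. e i + (if i = k then r else 0)"] quadratic_form_shift[OF sym, of e k r] 0 by simp
      \<comment> \<open>With a vanishing diagonal entry the form is affine in \<open>r\<close> along this line, and takes the value \<open>-1\<close>.\<close>
      from this[of "- (M j j + 1) / (2 * M k j)"] show False using kj by (simp add: field_simps)
    qed
    with Mkk0 have Mkk: "M k k > 0" by simp
    define M' where "M' i j = M i j - M k i * M k j / M k k" for i j
    have sym': "M' i j = M' j i" for i j using sym[of i j] by (simp add: M'_def)
    have psd': "(\<Sum>i j. \<xi> i * M' i j * \<xi> j) \<ge> 0" for \<xi>
    proof -
      \<comment> \<open>The form of \<open>M'\<close> at \<open>\<xi>\<close> is the minimum of the form of \<open>M\<close> on the line through \<open>\<xi>\<close> in direction \<open>k\<close>.\<close>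
      define b where "b = (\<Sum>j. M k j * \<xi> j)"
      have "(\<Sum>i j. \<xi> i * M' i j * \<xi> j)
        = (\<Sum>i j. \<xi> i * M i j * \<xi> j) - (\<Sum>i j. (M k i * \<xi> i) * (M k j * \<xi> j)) / M k k"
        by (simp add: M'_def algebra_simps sum_subtractf sum_divide_distrib)
      also have "(\<Sum>i j. (M k i * \<xi> i) * (M k j * \<xi> j)) = b * b"
        by (simp add: b_def sum_product)
      also have "(\<Sum>i j. \<xi> i * M i j * \<xi> j) - b * b / M k k
        = (\<Sum>i j. (\<xi> i + (if i = k then - b / M k k else 0)) * M i j * (\<xi> j + (if j = k then - b / M k k else 0)))"
        unfolding quadratic_form_shift[OF sym] b_def[symmetric] using Mkk by (simp add: field_simps)
      finally show ?thesis using psd[of "\<lambda>i. \<xi> i + (if i = k then - b / M k k else 0)"] by simp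
    qed
    have "M' k j = 0" for j using Mkk by (simp add: M'_def)
    moreover have "M' i j = 0" if "\<forall>j. M i j = 0" for i j
      using that sym[of k i] by (simp add: M'_def)
    ultimately have "{i. \<exists>j. M' i j \<noteq> 0} \<subset> {i. \<exists>j. M i j \<noteq> 0}" using kj by blast
    then have "card {i. \<exists>j. M' i j \<noteq> 0} < card {i. \<exists>j. M i j \<noteq> 0}" by (intro psubset_card_mono) auto
    from less.hyps[OF this sym' psd'] have "(\<Sum>i j. M' i j * N i j) \<ge> 0" .
    moreover have "(\<Sum>i j. M i j * N i j)
      = (\<Sum>i j. M' i j * N i j) + (\<Sum>i j. M k i * N i j * M k j) / M k k"
      by (simp add: M'_def algebra_simps sum_subtractf sum_divide_distrib)
    moreover have "(\<Sum>i j. M k i * N i j * M k j) \<ge> 0" using N .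
    ultimately show ?thesis using Mkk by (simp add: divide_nonneg_pos)
  qed
qed

text \<open>
  The trace of \<open>(P S)\<^sup>2\<close> is the entrywise inner product of the two positive semidefinite
  matrices \<open>P\<close> and \<open>S P S\<close>.
\<close>

lemma trace_square_nonneg:
  fixes P S :: "'n::finite \<Rightarrow> 'n \<Rightarrow> real"
  assumes P: "\<And>i j. P i j = P j i" "\<And>\<xi>. (\<Sum>i j. \<xi> i * P i j * \<xi> j) \<ge> 0"
    and S: "\<And>i j. S i j = S j i"
  shows "(\<Sum>i k. (\<Sum>l. P i l * S k l) * (\<Sum>m. P k m * S i m)) \<ge> 0"
proof -
  define N where "N i l = (\<Sum>k m. S k l * P k m * S i m)" for i l
  have "(\<Sum>i k. (\<Sum>l. P i l * S k l) * (\<Sum>m. P k m * S i m))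
    = (\<Sum>i k l m. P i l * (S k l * P k m * S i m))"
    by (simp add: sum_product mult.assoc)
  also have "\<dots> = (\<Sum>i l. P i l * N i l)"
    unfolding N_def sum_distrib_left by (intro sum.cong refl sum.swap)
  also have "\<dots> \<ge> 0"
  proof (rule sum_psd_product_nonneg[OF P])
    fix \<xi> :: "'n \<Rightarrow> real"
    define \<eta> where "\<eta> k = (\<Sum>l. S k l * \<xi> l)" for k
    have "(\<Sum>i l. \<xi> i * N i l * \<xi> l) = (\<Sum>i l k m. (S k l * \<xi> l) * P k m * (S m i * \<xi> i))"
      unfolding N_def sum_distrib_left sum_distrib_right
    proof (intro sum.cong refl)
      show "\<xi> i * (S k l * P k m * S i m) * \<xi> l = S k l * \<xi> l * P k m * (S m i * \<xi> i)" for i l k m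
        using S[of i m] by simp
    qed
    also have "\<dots> = (\<Sum>k m i l. (S k l * \<xi> l) * P k m * (S m i * \<xi> i))"
      by (rule sum_swap_pairs)
    also have "\<dots> = (\<Sum>k m. \<eta> k * P k m * \<eta> m)"
      unfolding \<eta>_def sum_distrib_left sum_distrib_right by simp
    finally show "(\<Sum>i l. \<xi> i * N i l * \<xi> l) \<ge> 0" using P(2)[of \<eta>] by simp
  qed
  finally show ?thesis .
qed

text \<open>
  For a \<open>g\<close>-self-adjoint operator \<open>A\<close> with eigenvalue \<open>\<mu>\<close>, this is the Cauchy--Schwarz inequality
  for the trace on the \<open>(n - 1)\<close>-dimensional orthogonal complement of the eigenvector \<open>V\<close>. It
  results from \<open>tr((P S)\<^sup>2) \<ge> 0\<close> for \<open>S = H - s g - r d \<otimes> d\<close>, where \<open>P = g^(-1)\<close>, the number \<open>r\<close> is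
  chosen to remove the eigenvector, and \<open>s\<close> is the mean of the remaining eigenvalues.
\<close>

lemma trace_square_eigenvector_bound:
  fixes P g H :: "'n::finite \<Rightarrow> 'n \<Rightarrow> real" and d :: "'n \<Rightarrow> real"
  assumes P: "\<And>i j. P i j = P j i" "\<And>\<xi>. (\<Sum>i j. \<xi> i * P i j * \<xi> j) \<ge> 0"
    and g: "\<And>i j. g i j = g j i" "\<And>i k. (\<Sum>j. P i j * g j k) = (if i = k then 1 else 0)"
    and H: "\<And>i j. H i j = H j i"
    and V: "\<And>i. V i = (\<Sum>j. P i j * d j)"
    and eigen: "\<And>i. (\<Sum>j. H i j * V j) = \<mu> * d i"
    and w: "w = (\<Sum>i. V i * d i)" "w > 0"
    and A: "\<And>i k. A i k = (\<Sum>l. P i l * H k l)"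
    and n: "CARD('n) \<ge> 2"
  shows "\<mu>\<^sup>2 + ((\<Sum>i. A i i) - \<mu>)\<^sup>2 / (real CARD('n) - 1) \<le> (\<Sum>i k. A i k * A k i)"
proof -
  define n where "n = real CARD('n)"
  have n1: "n - 1 > 0" using n by (simp add: n_def)
  define t where "t = (\<Sum>i. A i i)"
  \<comment> \<open>These values minimize the trace of \<open>(P S)\<^sup>2\<close>.\<close>
  define s where "s = (t - \<mu>) / (n - 1)"
  define r where "r = (\<mu> - s) / w"
  define S where "S i j = H i j - s * g i j - r * (d i * d j)" for i j
  have S: "S i j = S j i" for i j using H[of i j] g(1)[of i j] by (simp add: S_def)
  define \<delta> where "\<delta> i k = (if i = k then 1 else 0 :: real)" for i k :: 'n
  have PS: "(\<Sum>l. P i l * S k l) = A i k - s * \<delta> i k - r * (V i * d k)" for i k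
  proof -
    have "(\<Sum>l. P i l * S k l) = (\<Sum>l. P i l * H k l) - s * (\<Sum>l. P i l * g l k) - r * ((\<Sum>l. P i l * d l) * d k)"
      unfolding S_def sum_distrib_left sum_distrib_right
      by (simp add: algebra_simps sum_subtractf sum.distrib g(1)[of k])
    then show ?thesis by (simp add: A V g(2) \<delta>_def)
  qed
  have AV: "(\<Sum>k. A i k * V k) = \<mu> * V i" for i
  proof -
    have "(\<Sum>k. A i k * V k) = (\<Sum>k l. P i l * (H l k * V k))"
      by (simp add: A sum_distrib_right mult.assoc H)
    also have "\<dots> = (\<Sum>l. P i l * (\<Sum>k. H l k * V k))"
      by (subst sum.swap) (simp add: sum_distrib_left)
    finally show ?thesis unfolding eigen V[of i] sum_distrib_left by (simp add: mult_ac)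
  qed
  have AVd: "(\<Sum>i k. A i k * V k * d i) = \<mu> * w"
    unfolding w(1) sum_distrib_left
    by (intro sum.cong refl) (simp add: AV flip: sum_distrib_right mult.assoc)
  have 1: "(\<Sum>i k. (A i k - s * \<delta> i k - r * (V i * d k)) * (A k i - s * \<delta> k i - r * (V k * d i)))
    = (\<Sum>i k. A i k * A k i) - 2 * s * t + s * s * n - 2 * r * (\<mu> * w) + 2 * s * r * w + r * r * w * w"
  proof -
    have e: "(A i k - s * \<delta> i k - r * (V i * d k)) * (A k i - s * \<delta> k i - r * (V k * d i))
      = A i k * A k i - (if k = i then 2 * s * A i i else 0) + (if k = i then s * s else 0)
       - r * (A i k * V k * d i) - r * (A k i * V i * d k) + (if k = i then 2 * s * r * (V i * d i) else 0)
       + r * r * ((V i * d i) * (V k * d k))" for i k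
      by (simp add: \<delta>_def algebra_simps)
    have "(\<Sum>i k. r * (A k i * V i * d k)) = r * (\<mu> * w)"
      by (subst sum.swap) (simp add: AVd flip: sum_distrib_left)
    moreover have "(\<Sum>i k. r * (A i k * V k * d i)) = r * (\<mu> * w)"
      by (simp add: AVd flip: sum_distrib_left)
    moreover have "(\<Sum>i k. r * r * ((V i * d i) * (V k * d k))) = r * r * (w * w)"
      unfolding w(1) by (simp add: sum_product flip: sum_distrib_left)
    moreover have "(\<Sum>i. 2 * s * r * (V i * d i)) = 2 * s * r * w" "(\<Sum>i. 2 * s * A i i) = 2 * s * t"
      by (simp_all add: w(1) t_def sum_distrib_left)
    ultimately show ?thesis
      unfolding e by (simp add: sum.distrib sum_subtractf sum.delta n_def algebra_simps)
  qed
  have "0 \<le> (\<Sum>i k. A i k * A k i) - 2 * s * t + s * s * n - 2 * r * (\<mu> * w) + 2 * s * r * w + r * r * w * w"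
    using trace_square_nonneg[of P S, OF P S] unfolding PS 1 .
  also have "\<dots> = (\<Sum>i k. A i k * A k i) - 2 * s * t + s * s * n - 2 * (r * w) * \<mu> + 2 * s * (r * w) + (r * w) * (r * w)"
    by (simp add: algebra_simps)
  also have "r * w = \<mu> - s" using w(2) by (simp add: r_def)
  finally have "0 \<le> (\<Sum>i k. A i k * A k i) - \<mu> * \<mu> - 2 * s * (t - \<mu>) + s * (s * (n - 1))"
    by (simp add: algebra_simps)
  moreover have "s * (n - 1) = t - \<mu>" using n1 by (simp add: s_def)
  ultimately have "0 \<le> (\<Sum>i k. A i k * A k i) - \<mu> * \<mu> - 2 * (s * (t - \<mu>)) + s * (t - \<mu>)" by simp
  then have "\<mu> * \<mu> + s * (t - \<mu>) \<le> (\<Sum>i k. A i k * A k i)" by linarith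
  moreover have "s * (t - \<mu>) = (t - \<mu>)\<^sup>2 / (n - 1)" by (simp add: s_def power2_eq_square)
  ultimately show ?thesis by (simp add: t_def n_def power2_eq_square)
qed

section \<open>Riemannian metrics in coordinates\<close>

text \<open>
  The tensors of the metric as functions of its coordinate matrix \<open>G\<close> alone, so that they can be considered
  on parts of a chart range. For \<open>G = g c\<close> they are the components in the chart \<open>c\<close>
  (\<open>christoffel_eq\<close>, \<open>ricci_eq\<close>, \<open>hessian_eq\<close>, \<open>gradient_eq\<close>).
\<close>

definition ginv :: "(real^'n \<Rightarrow> real^'n^'n) \<Rightarrow> 'n::finite \<Rightarrow> 'n \<Rightarrow> real^'n \<Rightarrow> real" where
  "ginv G i j y = matrix_inv (G y) $ i $ j"

definition chr :: "(real^'n \<Rightarrow> real^'n^'n) \<Rightarrow> 'n::finite \<Rightarrow> 'n \<Rightarrow> 'n \<Rightarrow> real^'n \<Rightarrow> real" where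
  "chr G k i j y = 1/2 * (\<Sum>l. ginv G k l y *
     (pd i (\<lambda>z. G z $ j $ l) y + pd j (\<lambda>z. G z $ i $ l) y - pd l (\<lambda>z. G z $ i $ j) y))"

text \<open>
  The contraction of the curvature tensor in terms of the Christoffel symbols.
\<close>

definition ric :: "(real^'n \<Rightarrow> real^'n^'n) \<Rightarrow> 'n::finite \<Rightarrow> 'n \<Rightarrow> real^'n \<Rightarrow> real" where
  "ric G j k y = (\<Sum>i. pd i (chr G i j k) y - pd j (chr G i i k) y
     + (\<Sum>q. chr G i i q y * chr G q j k y - chr G i j q y * chr G q i k y))"

definition hess :: "(real^'n \<Rightarrow> real^'n^'n) \<Rightarrow> (real^'n \<Rightarrow> real) \<Rightarrow> 'n::finite \<Rightarrow> 'n \<Rightarrow> real^'n \<Rightarrow> real" where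
  "hess G f i j y = pd i (pd j f) y - (\<Sum>k. chr G k i j y * pd k f y)"

definition grad :: "(real^'n \<Rightarrow> real^'n^'n) \<Rightarrow> (real^'n \<Rightarrow> real) \<Rightarrow> 'n::finite \<Rightarrow> real^'n \<Rightarrow> real" where
  "grad G f k y = (\<Sum>l. ginv G k l y * pd l f y)"

definition ginner :: "(real^'n \<Rightarrow> real^'n^'n) \<Rightarrow> (real^'n \<Rightarrow> real) \<Rightarrow> (real^'n \<Rightarrow> real) \<Rightarrow> real^'n::finite \<Rightarrow> real" where
  "ginner G f h y = (\<Sum>k. grad G f k y * pd k h y)"

definition lap :: "(real^'n \<Rightarrow> real^'n^'n) \<Rightarrow> (real^'n \<Rightarrow> real) \<Rightarrow> real^'n::finite \<Rightarrow> real" where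
  "lap G f y = (\<Sum>i l. ginv G i l y * hess G f i l y)"

text \<open>
  The Hessian with its first index raised, as an endomorphism of the tangent space: the covariant
  derivative \<open>\<nabla>_i \<nabla>^k f\<close>.
\<close>

definition hess_raised :: "(real^'n \<Rightarrow> real^'n^'n) \<Rightarrow> (real^'n \<Rightarrow> real) \<Rightarrow> 'n::finite \<Rightarrow> 'n \<Rightarrow> real^'n \<Rightarrow> real" where
  "hess_raised G f k i y = (\<Sum>l. ginv G k l y * hess G f i l y)"

lemma smooth_on_det:
  fixes M :: "real^'n::finite \<Rightarrow> real^'m^'m"
  assumes "open D" "\<And>i j. smooth_on D (\<lambda>y. M y $ i $ j)"
  shows "smooth_on D (\<lambda>y. det (M y))"
  unfolding det_def
  by (intro smooth_on_sum smooth_on_mult smooth_on_const smooth_on_prod assms)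

lemma invertible_matrix_inv:
  fixes A :: "real^'n^'n"
  assumes "invertible A"
  shows "A ** matrix_inv A = mat 1" "matrix_inv A ** A = mat 1"
  using someI_ex[OF assms[unfolded invertible_def]] by (simp_all add: matrix_inv_def)

lemma matrix_inv_cramer:
  fixes A :: "real^'n^'n"
  assumes "invertible A"
  shows "matrix_inv A $ k $ j = det (\<chi> i l. if l = k then axis j 1 $ i else A $ i $ l) * inverse (det A)"
proof -
  have A: "A *v (matrix_inv A *v axis j 1) = axis j 1"
    by (simp add: matrix_vector_mul_assoc invertible_matrix_inv[OF assms])
  moreover have "(matrix_inv A *v axis j 1) $ k = matrix_inv A $ k $ j"
    unfolding matrix_vector_mult_basis by (simp add: column_def)
  ultimately show ?thesis
    using cramer_lemma[of k A "matrix_inv A *v axis j 1", unfolded A] assms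
    by (simp add: invertible_det_nz)
qed

text \<open>
  The outer function is only of class \<open>C\<^sup>2\<close>, as is the function \<open>\<Gamma>\<close> in the gradient estimate.
\<close>

lemma pd_pd_compose_real:
  fixes f :: "real^'n::finite \<Rightarrow> real"
  assumes "open U" "open S" "Ck_on 2 S h" "smooth_on U f" "\<And>z. z \<in> U \<Longrightarrow> f z \<in> S" "y \<in> U"
  shows "pd i (\<lambda>z. h (f z)) y = deriv h (f y) * pd i f y"
    and "pd i (pd j (\<lambda>z. h (f z))) y
      = deriv (deriv h) (f y) * (pd i f y * pd j f y) + deriv h (f y) * pd i (pd j f) y"
proof -
  have h1: "(h has_real_derivative dirderiv 1 h r) (at r)"
    and h2': "(dirderiv 1 h has_real_derivative dirderiv 1 (dirderiv 1 h) r) (at r)" if "r \<in> S" for r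
    using has_real_derivative_line[of h 0 r 1] has_real_derivative_line[of "dirderiv 1 h" 0 r 1] assms(3) that
    by (auto simp: numeral_2_eq_2 Ck_on_Suc_open[OF assms(2)] simp del: Ck_on.simps)
  have dh: "deriv h r = dirderiv 1 h r" if "r \<in> S" for r
    using h1[OF that] by (rule DERIV_imp_deriv)
  have h2: "(deriv h has_real_derivative deriv (deriv h) r) (at r)" if "r \<in> S" for r
  proof -
    have "(deriv h has_real_derivative dirderiv 1 (dirderiv 1 h) r) (at r)"
      by (rule has_field_derivative_transform_within_open[OF h2'[OF that] assms(2) that]) (simp add: dh)
    then show ?thesis by (simp add: DERIV_imp_deriv)
  qed
  have h1: "(h has_real_derivative deriv h r) (at r)" if "r \<in> S" for r
    using h1[OF that] dh[OF that] by simp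
  note df = smooth_on_differentiable[OF assms(1,4)]
  have 1: "pd i (\<lambda>z. h (f z)) z = deriv h (f z) * pd i f z" if "z \<in> U" for z i
    using df[OF that] h1[of "f z"] dh[of "f z"] assms(5)[OF that] by (intro pd_compose_real) auto
  show "pd i (\<lambda>z. h (f z)) y = deriv h (f y) * pd i f y" using 1 assms(6) .
  have "pd i (pd j (\<lambda>z. h (f z))) y = pd i (\<lambda>z. deriv h (f z) * pd j f z) y"
    by (rule pd_cong[OF assms(1,6)]) (rule 1)
  also have "\<dots> = pd i (\<lambda>z. deriv h (f z)) y * pd j f y + deriv h (f y) * pd i (pd j f) y"
    using dirderiv_compose_real(2)[OF df h2] assms(5,6) smooth_on_differentiable[OF assms(1) smooth_on_pd]
    by (intro pd_mult) (auto simp: assms)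
  also have "pd i (\<lambda>z. deriv h (f z)) y = deriv (deriv h) (f y) * pd i f y"
    using df h2 assms(5,6) by (intro pd_compose_real) auto
  finally show "pd i (pd j (\<lambda>z. h (f z))) y
      = deriv (deriv h) (f y) * (pd i f y * pd j f y) + deriv h (f y) * pd i (pd j f) y" by simp
qed

locale coordinate_metric =
  fixes U :: "(real^'n::finite) set" and G :: "real^'n \<Rightarrow> real^'n^'n"
  assumes open_U: "open U"
    and G_smooth: "smooth_on U (\<lambda>y. G y $ i $ j)"
    and G_sym: "y \<in> U \<Longrightarrow> G y $ i $ j = G y $ j $ i"
    and G_pos: "y \<in> U \<Longrightarrow> \<xi> \<noteq> 0 \<Longrightarrow> \<xi> \<bullet> (G y *v \<xi>) > 0"
begin

lemma diffable: "smooth_on U f \<Longrightarrow> y \<in> U \<Longrightarrow> f differentiable (at y)"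
  using smooth_on_differentiable[OF open_U] .

lemma invertible_G: "y \<in> U \<Longrightarrow> invertible (G y)"
  unfolding invertible_left_inverse matrix_left_invertible_ker
  using G_pos by (metis inner_zero_right less_irrefl)

lemma ginv_left: "y \<in> U \<Longrightarrow> (\<Sum>j. ginv G i j y * G y $ j $ k) = (if i = k then 1 else 0)"
  using arg_cong[OF invertible_matrix_inv(2)[OF invertible_G], of y "\<lambda>A. A $ i $ k"]
  by (simp add: ginv_def matrix_matrix_mult_def mat_def)

lemma ginv_right: "y \<in> U \<Longrightarrow> (\<Sum>j. G y $ i $ j * ginv G j k y) = (if i = k then 1 else 0)"
  using arg_cong[OF invertible_matrix_inv(1)[OF invertible_G], of y "\<lambda>A. A $ i $ k"]
  by (simp add: ginv_def matrix_matrix_mult_def mat_def)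

text \<open>
  All contractions of the metric with its inverse are reduced to this lemma and the next.
\<close>

lemma raise_lower: "y \<in> U \<Longrightarrow> (\<Sum>k. ginv G l k y * (\<Sum>q. G y $ k $ q * X q)) = X l"
proof -
  assume y: "y \<in> U"
  have "(\<Sum>k. ginv G l k y * (\<Sum>q. G y $ k $ q * X q)) = (\<Sum>q. (\<Sum>k. ginv G l k y * G y $ k $ q) * X q)"
    unfolding sum_distrib_left sum_distrib_right by (subst sum.swap) (simp add: mult.assoc)
  then show ?thesis by (simp add: ginv_left[OF y] if_distrib[of "\<lambda>x. x * _"] sum.delta cong: if_cong)
qed

lemma lower_raise: "y \<in> U \<Longrightarrow> (\<Sum>k. G y $ l $ k * (\<Sum>q. ginv G k q y * X q)) = X l"
proof -
  assume y: "y \<in> U"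
  have "(\<Sum>k. G y $ l $ k * (\<Sum>q. ginv G k q y * X q)) = (\<Sum>q. (\<Sum>k. G y $ l $ k * ginv G k q y) * X q)"
    unfolding sum_distrib_left sum_distrib_right by (subst sum.swap) (simp add: mult.assoc)
  then show ?thesis by (simp add: ginv_right[OF y] if_distrib[of "\<lambda>x. x * _"] sum.delta cong: if_cong)
qed

lemma ginv_sym:
  assumes y: "y \<in> U"
  shows "ginv G i j y = ginv G j i y"
proof -
  have "(\<Sum>q. G y $ k $ q * ginv G i q y) = (if k = i then 1 else 0)" for k
    using ginv_left[OF y, of i k] G_sym[OF y, of k] by (simp add: mult.commute)
  then have "ginv G i j y = (\<Sum>k. ginv G j k y * (if k = i then 1 else 0))"
    using raise_lower[OF y, of j "\<lambda>q. ginv G i q y"] by simp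
  then show ?thesis by (simp add: if_distrib sum.delta cong: if_cong)
qed

text \<open>
  With \<open>\<xi> = g^(-1) d\<close> the form is \<open>\<langle>\<xi>, g \<xi>\<rangle>\<close>.
\<close>

lemma ginv_pos:
  assumes y: "y \<in> U"
  shows "(\<Sum>i j. d i * ginv G i j y * d j) \<ge> 0"
    and "d k \<noteq> 0 \<Longrightarrow> (\<Sum>i j. d i * ginv G i j y * d j) > 0"
proof -
  define \<xi> where "\<xi> = (\<chi> i. \<Sum>j. ginv G i j y * d j)"
  have Gxi: "G y *v \<xi> = (\<chi> i. d i)"
    using lower_raise[OF y, of _ d] by (simp add: vec_eq_iff matrix_vector_mult_def \<xi>_def)
  have eq: "(\<Sum>i j. d i * ginv G i j y * d j) = \<xi> \<bullet> (G y *v \<xi>)"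
    unfolding Gxi by (simp add: \<xi>_def inner_vec_def sum_distrib_right sum_distrib_left mult_ac)
  show "(\<Sum>i j. d i * ginv G i j y * d j) \<ge> 0"
    unfolding eq using G_pos[OF y, of \<xi>] by (cases "\<xi> = 0") auto
  assume "d k \<noteq> 0"
  then have "(G y *v \<xi>) $ k \<noteq> 0" unfolding Gxi by simp
  then have "\<xi> \<noteq> 0" by auto
  then show "(\<Sum>i j. d i * ginv G i j y * d j) > 0" unfolding eq using G_pos[OF y] by blast
qed

text \<open>
  Cramer's rule makes the entries of the inverse rational functions of the entries of the metric.
\<close>

lemma smooth_ginv: "smooth_on U (ginv G i j)"
proof -
  have "smooth_on U (\<lambda>y. det (\<chi> a b. if b = i then axis j 1 $ a else G y $ a $ b) * inverse (det (G y)))"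
  proof (intro smooth_on_mult smooth_on_det smooth_on_inverse open_U G_smooth)
    show "smooth_on U (\<lambda>y. (\<chi> a b. if b = i then axis j 1 $ a else G y $ a $ b) $ a $ b)" for a b
      by (cases "b = i") (simp_all add: smooth_on_const open_U G_smooth)
    show "det (G y) \<noteq> 0" if "y \<in> U" for y using invertible_G[OF that] by (simp add: invertible_det_nz)
  qed
  then show ?thesis
    by (rule smooth_on_cong[THEN iffD1, OF open_U, rotated])
      (simp add: ginv_def matrix_inv_cramer[OF invertible_G])
qed

lemma smooth_chr: "smooth_on U (chr G k i j)"
  unfolding chr_def[abs_def] by (intro smooth_intros open_U G_smooth smooth_ginv)

lemma smooth_grad: "smooth_on U f \<Longrightarrow> smooth_on U (grad G f k)"
  unfolding grad_def[abs_def] by (intro smooth_intros open_U smooth_ginv)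

lemma smooth_inner: "smooth_on U f \<Longrightarrow> smooth_on U h \<Longrightarrow> smooth_on U (ginner G f h)"
  unfolding ginner_def[abs_def] by (intro smooth_intros open_U smooth_grad)

lemma smooth_hess: "smooth_on U f \<Longrightarrow> smooth_on U (hess G f i j)"
  unfolding hess_def[abs_def] by (intro smooth_intros open_U smooth_chr)

lemma smooth_lap: "smooth_on U f \<Longrightarrow> smooth_on U (lap G f)"
  unfolding lap_def[abs_def] by (intro smooth_intros open_U smooth_hess smooth_ginv)

lemma pd_G_sym: "y \<in> U \<Longrightarrow> pd l (\<lambda>z. G z $ i $ j) y = pd l (\<lambda>z. G z $ j $ i) y"
  by (rule pd_cong[OF open_U]) (auto intro: G_sym)

lemma chr_sym:
  assumes y: "y \<in> U"
  shows "chr G k i j y = chr G k j i y"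
  unfolding chr_def by (simp add: pd_G_sym[OF y, of _ i j] algebra_simps)

lemma hess_sym:
  assumes "smooth_on U f" "y \<in> U"
  shows "hess G f i j y = hess G f j i y"
  using pd_commute[OF open_U smooth_on_Ck[OF assms(1)] assms(2)] chr_sym[OF assms(2)]
  by (simp add: hess_def)

lemma lower_chr:
  assumes y: "y \<in> U"
  shows "(\<Sum>k. G y $ l $ k * chr G k i j y)
    = 1/2 * (pd i (\<lambda>z. G z $ j $ l) y + pd j (\<lambda>z. G z $ i $ l) y - pd l (\<lambda>z. G z $ i $ j) y)"
  using lower_raise[OF y, of l "\<lambda>l. pd i (\<lambda>z. G z $ j $ l) y + pd j (\<lambda>z. G z $ i $ l) y - pd l (\<lambda>z. G z $ i $ j) y"]
  unfolding chr_def by (simp add: sum_distrib_left mult_ac flip: sum_divide_distrib)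

text \<open>
  Metric compatibility of the Levi-Civita connection.
\<close>

lemma pd_G:
  assumes y: "y \<in> U"
  shows "pd i (\<lambda>z. G z $ j $ l) y = (\<Sum>k. G y $ l $ k * chr G k i j y) + (\<Sum>k. G y $ j $ k * chr G k i l y)"
  unfolding lower_chr[OF y] using pd_G_sym[OF y, of i l j] by (simp add: field_simps)

text \<open>
  Metric compatibility for the inverse metric, obtained by differentiating \<open>g^(-1) g = 1\<close>.
\<close>

lemma pd_ginv:
  assumes y: "y \<in> U"
  shows "pd i (ginv G k l) y
    = - (\<Sum>j. chr G k i j y * ginv G j l y) - (\<Sum>j. chr G l i j y * ginv G k j y)"
proof -
  have diff: "(\<Sum>j. G y $ m $ j * pd i (ginv G k j) y) = - (\<Sum>j. ginv G k j y * pd i (\<lambda>z. G z $ j $ m) y)" for m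
  proof -
    have "0 = pd i (\<lambda>z. \<Sum>j. ginv G k j z * G z $ j $ m) y"
      using pd_cong[OF open_U y, of "\<lambda>z. \<Sum>j. ginv G k j z * G z $ j $ m" "\<lambda>z. if k = m then 1 else 0" i]
        ginv_left by simp
    also have "\<dots> = (\<Sum>j. pd i (ginv G k j) y * G y $ j $ m + ginv G k j y * pd i (\<lambda>z. G z $ j $ m) y)"
      by (subst pd_sum) (simp_all add: pd_mult diffable smooth_ginv G_smooth y differentiable_mult)
    finally show ?thesis using G_sym[OF y, of m] by (simp add: sum.distrib mult.commute)
  qed
  have low: "(\<Sum>j. ginv G k j y * pd i (\<lambda>z. G z $ j $ m) y)
    = (\<Sum>q. G y $ m $ q * (\<Sum>j. chr G q i j y * ginv G k j y)) + chr G k i m y" for m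
  proof -
    have "(\<Sum>j. ginv G k j y * pd i (\<lambda>z. G z $ j $ m) y)
      = (\<Sum>j. ginv G k j y * (\<Sum>q. G y $ m $ q * chr G q i j y)) + (\<Sum>j. ginv G k j y * (\<Sum>q. G y $ j $ q * chr G q i m y))"
      by (simp add: pd_G[OF y] algebra_simps sum.distrib)
    also have "(\<Sum>j. ginv G k j y * (\<Sum>q. G y $ m $ q * chr G q i j y)) = (\<Sum>q. G y $ m $ q * (\<Sum>j. chr G q i j y * ginv G k j y))"
      unfolding sum_distrib_left by (subst sum.swap) (simp add: mult_ac)
    finally show ?thesis by (simp add: raise_lower[OF y])
  qed
  have "pd i (ginv G k l) y = (\<Sum>m. ginv G l m y * (\<Sum>j. G y $ m $ j * pd i (ginv G k j) y))"
    by (simp add: raise_lower[OF y])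
  also have "\<dots> = - (\<Sum>m. ginv G l m y * (\<Sum>q. G y $ m $ q * (\<Sum>j. chr G q i j y * ginv G k j y)))
      - (\<Sum>m. ginv G l m y * chr G k i m y)"
    unfolding diff low by (simp add: algebra_simps sum.distrib sum_negf sum_subtractf)
  finally show ?thesis
    unfolding raise_lower[OF y] by (simp add: ginv_sym[OF y, of l] mult.commute)
qed

text \<open>
  The derivative of the inverse metric contributes two Christoffel terms: one completes the second derivatives
  of \<open>f\<close> to the Hessian, the other belongs to the covariant derivative of the gradient.
\<close>

lemma pd_grad:
  assumes f: "smooth_on U f" and y: "y \<in> U"
  shows "pd i (grad G f k) y = hess_raised G f k i y - (\<Sum>j. chr G k i j y * grad G f j y)"
proof -
  have "pd i (grad G f k) y = (\<Sum>l. pd i (ginv G k l) y * pd l f y) + (\<Sum>l. ginv G k l y * pd i (pd l f) y)"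
    unfolding grad_def[abs_def]
    by (subst pd_sum) (simp_all add: pd_mult diffable smooth_ginv smooth_on_pd open_U f y differentiable_mult sum.distrib)
  also have "(\<Sum>l. pd i (ginv G k l) y * pd l f y)
    = - (\<Sum>l j. chr G k i j y * ginv G j l y * pd l f y) - (\<Sum>l j. chr G l i j y * ginv G k j y * pd l f y)"
    unfolding pd_ginv[OF y] by (simp add: algebra_simps sum_distrib_left sum_distrib_right sum_negf sum_subtractf)
  also have "(\<Sum>l j. chr G k i j y * ginv G j l y * pd l f y) = (\<Sum>j. chr G k i j y * grad G f j y)"
    unfolding grad_def sum_distrib_left by (subst sum.swap) (simp add: mult_ac)
  also have "(\<Sum>l j. chr G l i j y * ginv G k j y * pd l f y) = (\<Sum>j. ginv G k j y * (\<Sum>l. chr G l i j y * pd l f y))"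
    unfolding sum_distrib_left by (subst sum.swap) (simp add: mult_ac)
  finally show ?thesis
    by (simp add: hess_raised_def hess_def algebra_simps sum_subtractf)
qed

lemma inner_grad: "ginner G f h y = (\<Sum>i j. pd j f y * ginv G i j y * pd i h y)"
  by (simp add: ginner_def grad_def sum_distrib_left sum_distrib_right mult_ac)

lemma inner_sym:
  assumes "y \<in> U"
  shows "ginner G f h y = ginner G h f y"
  unfolding inner_grad by (subst sum.swap) (simp add: ginv_sym[OF assms] mult_ac)

lemma hess_raised_contract:
  assumes y: "y \<in> U"
  shows "(\<Sum>k. hess_raised G f k i y * pd k h y) = (\<Sum>l. hess G f i l y * grad G h l y)"
  unfolding hess_raised_def grad_def sum_distrib_left sum_distrib_right
  by (subst sum.swap) (simp add: ginv_sym[OF y] mult_ac)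

text \<open>
  The Christoffel term in the derivative of \<open>\<nabla>f\<close> completes the second derivatives of \<open>h\<close> to the
  Hessian of \<open>h\<close>, because the connection is metric.
\<close>

lemma pd_inner:
  assumes f: "smooth_on U f" and h: "smooth_on U h" and y: "y \<in> U"
  shows "pd i (ginner G f h) y = (\<Sum>l. hess G f i l y * grad G h l y) + (\<Sum>l. hess G h i l y * grad G f l y)"
proof -
  have "pd i (ginner G f h) y = (\<Sum>k. pd i (grad G f k) y * pd k h y) + (\<Sum>k. grad G f k y * pd i (pd k h) y)"
    unfolding ginner_def[abs_def]
    by (subst pd_sum) (simp_all add: pd_mult diffable smooth_grad smooth_on_pd open_U f h y differentiable_mult sum.distrib)
  also have "(\<Sum>k. pd i (grad G f k) y * pd k h y) = (\<Sum>k. hess_raised G f k i y * pd k h y)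
      - (\<Sum>k j. chr G k i j y * grad G f j y * pd k h y)"
    unfolding pd_grad[OF f y] by (simp add: algebra_simps sum_distrib_left sum_distrib_right sum_subtractf)
  also have "(\<Sum>k j. chr G k i j y * grad G f j y * pd k h y) = (\<Sum>j. (\<Sum>k. chr G k i j y * pd k h y) * grad G f j y)"
    unfolding sum_distrib_right by (subst sum.swap) (simp add: mult_ac)
  finally show ?thesis
    unfolding hess_raised_contract[OF y] hess_def[of G h]
    by (simp add: algebra_simps sum_subtractf)
qed

end

section \<open>The Bochner formula\<close>

lemma sum_rotate:
  fixes f :: "'i \<Rightarrow> 'j \<Rightarrow> 'k \<Rightarrow> real"
  shows "(\<Sum>i\<in>I. \<Sum>j\<in>J. \<Sum>k\<in>K. f i j k) = (\<Sum>k\<in>K. \<Sum>i\<in>I. \<Sum>j\<in>J. f i j k)"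
proof -
  have "(\<Sum>i\<in>I. \<Sum>j\<in>J. \<Sum>k\<in>K. f i j k) = (\<Sum>i\<in>I. \<Sum>k\<in>K. \<Sum>j\<in>J. f i j k)"
    by (intro sum.cong refl sum.swap)
  also have "\<dots> = (\<Sum>k\<in>K. \<Sum>i\<in>I. \<Sum>j\<in>J. f i j k)" by (rule sum.swap)
  finally show ?thesis .
qed

text \<open>
  The Ricci identity \<open>\<nabla>_i \<nabla>_k V^i - \<nabla>_k \<nabla>_i V^i = R_kj V^j\<close>, contracted with \<open>V^k\<close>, at one point. The
  variables are the values of a vector field (\<open>v\<close>), its first and second derivatives (\<open>d1\<close>, \<open>d2\<close>),
  Christoffel symbols (\<open>C\<close>), their derivatives (\<open>dC\<close>), and the covariant derivative (\<open>a\<close>).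
\<close>

lemma bochner_algebra:
  fixes v :: "'n::finite \<Rightarrow> real" and a d1 :: "'n \<Rightarrow> 'n \<Rightarrow> real" and d2 C :: "'n \<Rightarrow> 'n \<Rightarrow> 'n \<Rightarrow> real"
    and dC :: "'n \<Rightarrow> 'n \<Rightarrow> 'n \<Rightarrow> 'n \<Rightarrow> real"
  assumes d2: "\<And>i k j. d2 i k j = d2 k i j"
    and C: "\<And>k i j. C k i j = C k j i"
    and a: "\<And>k i. a k i = d1 i k + (\<Sum>j. C k i j * v j)"
  shows "(\<Sum>i q. (d2 i q i + (\<Sum>j. dC i i q j * v j + C i q j * d1 i j)) * v q + a i q * d1 i q)
      + (\<Sum>i l. C i i l * (\<Sum>q. a l q * v q))
    = (\<Sum>k. v k * ((\<Sum>i. d2 k i i) + (\<Sum>i l. dC k i i l * v l + C i i l * d1 k l)))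
      + (\<Sum>i k. a i k * a k i)
      + (\<Sum>j k. (\<Sum>i. dC i i j k - dC j i i k + (\<Sum>q. C i i q * C q j k - C i j q * C q i k)) * v j * v k)"
    (is "?L1 + ?L2 = ?R1 + ?R2 + ?R3")
proof -
  define T1 where "T1 = (\<Sum>i q. d2 i q i * v q)"
  define T2 where "T2 = (\<Sum>i q j. dC i i q j * v j * v q)"
  define T3 where "T3 = (\<Sum>i q j. C i q j * d1 i j * v q)"
  define T4 where "T4 = (\<Sum>i q. a i q * d1 i q)"
  define T5 where "T5 = (\<Sum>i l q. C i i l * d1 q l * v q)"
  define T6 where "T6 = (\<Sum>i l q j. C i i l * C l q j * v j * v q)"
  define T7 where "T7 = (\<Sum>k i l. v k * dC k i i l * v l)"
  define T8 where "T8 = (\<Sum>i q j k. C i j q * C q i k * v j * v k)"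
  have L1: "?L1 = T1 + T2 + T3 + T4"
    unfolding T1_def T2_def T3_def T4_def
    by (simp add: distrib_right sum.distrib sum_distrib_right)
  have L2: "?L2 = T5 + T6"
    unfolding T5_def T6_def a
    by (simp add: distrib_right distrib_left sum.distrib sum_distrib_right sum_distrib_left mult.assoc)
  have R1: "?R1 = T1 + T7 + T5"
  proof -
    have "?R1 = (\<Sum>k i. d2 k i i * v k) + T7 + (\<Sum>k i l. C i i l * d1 k l * v k)"
      unfolding T7_def by (simp add: distrib_left sum.distrib sum_distrib_left mult_ac)
    also have "(\<Sum>k i. d2 k i i * v k) = T1"
      unfolding T1_def by (subst sum.swap) (simp add: d2)
    also have "(\<Sum>k i l. C i i l * d1 k l * v k) = T5"
      unfolding T5_def by (rule sum_rotate[symmetric])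
    finally show ?thesis .
  qed
  have R2: "?R2 = T4 + T3 + T8"
  proof -
    have "?R2 = (\<Sum>i k. a i k * d1 i k) + (\<Sum>i k j. a i k * (C k i j * v j))"
      by (subst (2) a) (simp add: distrib_left sum.distrib sum_distrib_left)
    also have "(\<Sum>i k j. a i k * (C k i j * v j))
      = (\<Sum>i k j. C k i j * d1 k i * v j) + (\<Sum>i k j l. C i k l * C k i j * v l * v j)"
      unfolding a by (simp add: distrib_right distrib_left sum.distrib sum_distrib_right sum_distrib_left mult_ac)
    also have "(\<Sum>i k j. C k i j * d1 k i * v j) = T3"
    proof -
      have "(\<Sum>i k j. C k i j * d1 k i * v j) = (\<Sum>k i j. C k i j * d1 k i * v j)" by (rule sum.swap)
      also have "\<dots> = (\<Sum>k j i. C k i j * d1 k i * v j)" by (intro sum.cong refl sum.swap)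
      also have "\<dots> = (\<Sum>k j i. C k j i * d1 k i * v j)" using C by (intro sum.cong refl) simp
      finally show ?thesis by (simp add: T3_def)
    qed
    also have "(\<Sum>i k j l. C i k l * C k i j * v l * v j) = T8"
    proof -
      have "(\<Sum>i k j l. C i k l * C k i j * v l * v j) = (\<Sum>i k l j. C i k l * C k i j * v l * v j)"
        by (intro sum.cong refl sum.swap)
      also have "\<dots> = (\<Sum>i k l j. C i l k * C k i j * v l * v j)"
        by (intro sum.cong refl) (subst C, rule refl)
      finally show ?thesis unfolding T8_def .
    qed
    finally show ?thesis by (simp add: T4_def)
  qed
  have R3: "?R3 = T2 - T7 + T6 - T8"
  proof -
    have "?R3 = (\<Sum>j k i. dC i i j k * v j * v k) - (\<Sum>j k i. dC j i i k * v j * v k)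
      + (\<Sum>j k i q. C i i q * C q j k * v j * v k) - (\<Sum>j k i q. C i j q * C q i k * v j * v k)"
      by (simp add: distrib_right left_diff_distrib sum.distrib sum_subtractf sum_distrib_right)
    also have "(\<Sum>j k i. dC i i j k * v j * v k) = T2"
      unfolding T2_def by (subst sum_rotate) (simp add: mult_ac)
    also have "(\<Sum>j k i. dC j i i k * v j * v k) = T7"
    proof -
      have "(\<Sum>j k i. dC j i i k * v j * v k) = (\<Sum>j i k. dC j i i k * v j * v k)"
        by (intro sum.cong refl sum.swap)
      then show ?thesis unfolding T7_def by (simp add: mult_ac)
    qed
    also have "(\<Sum>j k i q. C i i q * C q j k * v j * v k) = T6"
      unfolding T6_def by (subst sum_swap_pairs) (simp add: mult_ac)
    also have "(\<Sum>j k i q. C i j q * C q i k * v j * v k) = T8"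
      unfolding T8_def by (rule sum_swap_pairs)
    finally show ?thesis .
  qed
  show ?thesis unfolding L1 L2 R1 R2 R3 by simp
qed

definition wlap :: "(real^'n \<Rightarrow> real^'n^'n) \<Rightarrow> (real^'n \<Rightarrow> real) \<Rightarrow> (real^'n \<Rightarrow> real) \<Rightarrow> real^'n::finite \<Rightarrow> real" where
  "wlap G \<phi> f y = lap G f y - ginner G \<phi> f y"

context coordinate_metric
begin

text \<open>
  The component \<open>\<nabla>_i V^k\<close>.
\<close>

definition cov_deriv :: "('n \<Rightarrow> real^'n \<Rightarrow> real) \<Rightarrow> 'n \<Rightarrow> 'n \<Rightarrow> real^'n \<Rightarrow> real" where
  "cov_deriv V k i y = pd i (V k) y + (\<Sum>j. chr G k i j y * V j y)"

definition divergence :: "('n \<Rightarrow> real^'n \<Rightarrow> real) \<Rightarrow> real^'n \<Rightarrow> real" where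
  "divergence V y = (\<Sum>i. pd i (V i) y) + (\<Sum>i l. chr G i i l y * V l y)"

lemma divergence_cong:
  assumes "y \<in> U" "\<And>i z. z \<in> U \<Longrightarrow> V i z = W i z"
  shows "divergence V y = divergence W y"
proof -
  have "pd i (V i) y = pd i (W i) y" for i using pd_cong[OF open_U assms(1)] assms(2) by blast
  then show ?thesis using assms by (simp add: divergence_def)
qed

text \<open>
  After the products are differentiated, this is the contracted Ricci identity
  \<open>bochner_algebra\<close>. Symmetry of the Christoffel symbols is the only property of the connection that enters;
  that \<open>V\<close> is a gradient is used only later, to interpret both sides.
\<close>

lemma bochner_vector_field:
  assumes V: "\<And>i. smooth_on U (V i)" and y: "y \<in> U"
  shows "divergence (\<lambda>i z. \<Sum>q. cov_deriv V i q z * V q z) y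
    = (\<Sum>k. V k y * pd k (divergence V) y) + (\<Sum>i k. cov_deriv V i k y * cov_deriv V k i y)
      + (\<Sum>j k. ric G j k y * V j y * V k y)"
proof -
  have cV: "smooth_on U (cov_deriv V k i)" for k i
    unfolding cov_deriv_def[abs_def] by (intro smooth_intros open_U V smooth_chr)
  have pc: "pd i (cov_deriv V k q) y = pd i (pd q (V k)) y
    + (\<Sum>j. pd i (chr G k q j) y * V j y + chr G k q j y * pd i (V j) y)" for i k q
  proof -
    have "pd i (cov_deriv V k q) y = pd i (pd q (V k)) y + pd i (\<lambda>z. \<Sum>j. chr G k q j z * V j z) y"
      unfolding cov_deriv_def[abs_def]
      by (intro pd_add diffable smooth_intros open_U V smooth_chr y)
    also have "pd i (\<lambda>z. \<Sum>j. chr G k q j z * V j z) y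
      = (\<Sum>j. pd i (chr G k q j) y * V j y + chr G k q j y * pd i (V j) y)"
      by (subst pd_sum) (simp_all add: pd_mult diffable V smooth_chr y differentiable_mult)
    finally show ?thesis .
  qed
  have pW: "pd i (\<lambda>z. \<Sum>q. cov_deriv V i q z * V q z) y
    = (\<Sum>q. pd i (cov_deriv V i q) y * V q y + cov_deriv V i q y * pd i (V q) y)" for i
    by (subst pd_sum) (simp_all add: pd_mult diffable V cV y differentiable_mult)
  have pD: "pd k (divergence V) y = (\<Sum>i. pd k (pd i (V i)) y)
    + (\<Sum>i l. pd k (chr G i i l) y * V l y + chr G i i l y * pd k (V l) y)" for k
  proof -
    have "pd k (divergence V) y = pd k (\<lambda>z. \<Sum>i. pd i (V i) z) y + pd k (\<lambda>z. \<Sum>i l. chr G i i l z * V l z) y"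
      unfolding divergence_def[abs_def]
      by (intro pd_add diffable smooth_intros open_U V smooth_chr y)
    also have "pd k (\<lambda>z. \<Sum>i. pd i (V i) z) y = (\<Sum>i. pd k (pd i (V i)) y)"
      by (intro pd_sum diffable smooth_intros open_U V y)
    also have "pd k (\<lambda>z. \<Sum>i l. chr G i i l z * V l z) y = (\<Sum>i. pd k (\<lambda>z. \<Sum>l. chr G i i l z * V l z) y)"
      by (intro pd_sum diffable smooth_intros open_U V smooth_chr y)
    also have "\<dots> = (\<Sum>i l. pd k (\<lambda>z. chr G i i l z * V l z) y)"
      by (intro sum.cong refl pd_sum diffable smooth_intros open_U V smooth_chr y)
    also have "\<dots> = (\<Sum>i l. pd k (chr G i i l) y * V l y + chr G i i l y * pd k (V l) y)"
      by (intro sum.cong refl pd_mult diffable V smooth_chr y)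
    finally show ?thesis .
  qed
  show ?thesis
    unfolding divergence_def[of "\<lambda>i z. \<Sum>q. cov_deriv V i q z * V q z"] pW pc pD ric_def
      sum.distrib[symmetric]
    using bochner_algebra[of "\<lambda>i k j. pd i (pd k (V j)) y" "\<lambda>k i j. chr G k i j y" "\<lambda>k i. cov_deriv V k i y"
        "\<lambda>i k. pd i (V k) y" "\<lambda>j. V j y" "\<lambda>i k p q. pd i (chr G k p q) y",
        OF pd_commute[OF open_U smooth_on_Ck[OF V] y] chr_sym[OF y] cov_deriv_def]
    by (simp only: sum.distrib[symmetric])
qed

lemma cov_deriv_grad:
  assumes "smooth_on U f" "y \<in> U"
  shows "cov_deriv (grad G f) k i y = hess_raised G f k i y"
  by (simp add: cov_deriv_def pd_grad[OF assms])

lemma divergence_grad: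
  assumes "smooth_on U f" "y \<in> U"
  shows "divergence (grad G f) y = lap G f y"
  by (simp add: divergence_def pd_grad[OF assms] hess_raised_def lap_def sum_subtractf)

text \<open>
  For \<open>V = \<nabla>f\<close> the field \<open>\<nabla>_V V\<close> is the gradient of \<open>|\<nabla>f|\<^sup>2/2\<close>, because the Hessian is symmetric.
\<close>

lemma bochner:
  assumes f: "smooth_on U f" and y: "y \<in> U"
  shows "lap G (\<lambda>z. 1/2 * ginner G f f z) y
    = ginner G f (lap G f) y + (\<Sum>i k. hess_raised G f i k y * hess_raised G f k i y)
      + (\<Sum>j k. ric G j k y * grad G f j y * grad G f k y)"
proof -
  let ?e = "\<lambda>z. 1/2 * ginner G f f z"
  have e: "smooth_on U ?e" by (intro smooth_intros open_U smooth_inner f)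
  have grad_e: "grad G ?e i z = (\<Sum>q. cov_deriv (grad G f) i q z * grad G f q z)" if z: "z \<in> U" for i z
  proof -
    have pe: "pd l ?e z = (\<Sum>q. hess G f l q z * grad G f q z)" for l
      using pd_cmult[OF diffable[OF smooth_inner[OF f f] z], of l "1/2"] pd_inner[OF f f z, of l] by simp
    have "grad G ?e i z = (\<Sum>l q. ginv G i l z * (hess G f l q z * grad G f q z))"
      unfolding grad_def[of G ?e] pe sum_distrib_left ..
    also have "\<dots> = (\<Sum>q. (\<Sum>l. ginv G i l z * hess G f q l z) * grad G f q z)"
      unfolding sum_distrib_right by (subst sum.swap) (simp add: hess_sym[OF f z] mult.assoc)
    finally show ?thesis by (simp add: cov_deriv_grad[OF f z] hess_raised_def)
  qed
  have pd_div: "pd k (divergence (grad G f)) y = pd k (lap G f) y" for k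
    by (rule pd_cong[OF open_U y divergence_grad[OF f]])
  have "lap G ?e y = divergence (grad G ?e) y" by (rule divergence_grad[OF e y, symmetric])
  also have "\<dots> = divergence (\<lambda>i z. \<Sum>q. cov_deriv (grad G f) i q z * grad G f q z) y"
    by (rule divergence_cong[OF y grad_e])
  also have "\<dots> = (\<Sum>k. grad G f k y * pd k (divergence (grad G f)) y)
      + (\<Sum>i k. hess_raised G f i k y * hess_raised G f k i y)
      + (\<Sum>j k. ric G j k y * grad G f j y * grad G f k y)"
    unfolding bochner_vector_field[OF smooth_grad[OF f] y] cov_deriv_grad[OF f y] ..
  finally show ?thesis unfolding pd_div ginner_def[of G f "lap G f"] .
qed

lemma smooth_wlap: "smooth_on U \<phi> \<Longrightarrow> smooth_on U f \<Longrightarrow> smooth_on U (wlap G \<phi> f)"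
  unfolding wlap_def[abs_def] by (intro smooth_intros open_U smooth_lap smooth_inner)

text \<open>
  The two terms of \<open>\<nabla>\<langle>\<nabla>\<phi>, \<nabla>f\<rangle>\<close> contribute the Hessian of \<open>\<phi>\<close> and cancel the drift
  term of the left-hand side.
\<close>

lemma weighted_bochner:
  assumes \<phi>: "smooth_on U \<phi>" and f: "smooth_on U f" and y: "y \<in> U"
  shows "wlap G \<phi> (\<lambda>z. 1/2 * ginner G f f z) y
    = ginner G f (wlap G \<phi> f) y + (\<Sum>i k. hess_raised G f i k y * hess_raised G f k i y)
      + (\<Sum>j k. (ric G j k y + hess G \<phi> j k y) * grad G f j y * grad G f k y)"
proof -
  have pw: "pd k (wlap G \<phi> f) y = pd k (lap G f) y - pd k (ginner G \<phi> f) y" for k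
    unfolding wlap_def[abs_def] by (intro pd_diff diffable smooth_lap smooth_inner \<phi> f y)
  have "ginner G f (wlap G \<phi> f) y = ginner G f (lap G f) y - (\<Sum>k. grad G f k y * pd k (ginner G \<phi> f) y)"
    unfolding ginner_def[of G f] pw by (simp add: algebra_simps sum_subtractf)
  also have "(\<Sum>k. grad G f k y * pd k (ginner G \<phi> f) y)
    = (\<Sum>j k. hess G \<phi> j k y * grad G f j y * grad G f k y)
     + (\<Sum>k l. hess G f k l y * grad G \<phi> l y * grad G f k y)"
    unfolding pd_inner[OF \<phi> f y]
    by (simp add: distrib_left sum.distrib sum_distrib_left mult_ac)
  finally have 1: "ginner G f (wlap G \<phi> f) y = ginner G f (lap G f) y
     - (\<Sum>j k. hess G \<phi> j k y * grad G f j y * grad G f k y)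
     - (\<Sum>k l. hess G f k l y * grad G \<phi> l y * grad G f k y)" by simp
  have pe: "pd k (\<lambda>z. 1/2 * ginner G f f z) y = (\<Sum>l. hess G f k l y * grad G f l y)" for k
    using pd_cmult[OF diffable[OF smooth_inner[OF f f] y], of k "1/2"] pd_inner[OF f f y, of k] by simp
  have "ginner G \<phi> (\<lambda>z. 1/2 * ginner G f f z) y = (\<Sum>k l. grad G \<phi> k y * (hess G f k l y * grad G f l y))"
    unfolding ginner_def[of G \<phi>] pe by (simp add: sum_distrib_left)
  also have "\<dots> = (\<Sum>k l. hess G f k l y * grad G \<phi> l y * grad G f k y)"
    by (subst sum.swap) (simp add: hess_sym[OF f y] mult_ac)
  finally have 2: "ginner G \<phi> (\<lambda>z. 1/2 * ginner G f f z) y = (\<Sum>k l. hess G f k l y * grad G \<phi> l y * grad G f k y)" .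
  show ?thesis
    unfolding wlap_def[of G \<phi> "\<lambda>z. 1/2 * ginner G f f z"] 1 2 bochner[OF f y]
    by (simp add: distrib_right sum.distrib)
qed

section \<open>Differential rules for the weighted Laplacian\<close>

lemma C2_diffable:
  assumes "Ck_on 2 U f" "y \<in> U"
  shows "f differentiable (at y)" "pd j f differentiable (at y)"
  using assms axis_Basis
  by (auto simp: pd_dirderiv numeral_2_eq_2 Ck_on_Suc_open[OF open_U] simp del: Ck_on.simps)

lemma ginner_eqI:
  assumes "\<And>i. pd i f y = c * pd i h y + d * pd i k y"
  shows "ginner G \<phi> f y = c * ginner G \<phi> h y + d * ginner G \<phi> k y"
  unfolding ginner_def assms by (simp add: algebra_simps sum.distrib sum_distrib_left)

text \<open>
  The product and chain rules for the Laplacian only differ in the second-order term \<open>q\<close>.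
\<close>

lemma lap_eqI:
  assumes "\<And>i. pd i f y = c * pd i h y + d * pd i k y"
    and "\<And>i j. pd i (pd j f) y = c * pd i (pd j h) y + d * pd i (pd j k) y + q i j"
  shows "lap G f y = c * lap G h y + d * lap G k y + (\<Sum>i j. ginv G i j y * q i j)"
proof -
  have "hess G f i j y = c * hess G h i j y + d * hess G k i j y + q i j" for i j
    unfolding hess_def assms by (simp add: algebra_simps sum.distrib sum_distrib_left)
  then show ?thesis
    unfolding lap_def by (simp add: algebra_simps sum.distrib sum_distrib_left)
qed

lemma wlap_add:
  assumes f: "Ck_on 2 U f" and h: "Ck_on 2 U h" and y: "y \<in> U"
  shows "wlap G \<phi> (\<lambda>z. f z + h z) y = wlap G \<phi> f y + wlap G \<phi> h y"
proof -
  have 1: "pd i (\<lambda>z. f z + h z) z = 1 * pd i f z + 1 * pd i h z" if "z \<in> U" for i z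
    using pd_add[OF C2_diffable(1)[OF f that] C2_diffable(1)[OF h that]] by simp
  have 2: "pd i (pd j (\<lambda>z. f z + h z)) y = 1 * pd i (pd j f) y + 1 * pd i (pd j h) y + 0" for i j
  proof -
    have "pd i (pd j (\<lambda>z. f z + h z)) y = pd i (\<lambda>z. pd j f z + pd j h z) y"
      by (rule pd_cong[OF open_U y]) (simp add: 1)
    then show ?thesis using pd_add[OF C2_diffable(2)[OF f y] C2_diffable(2)[OF h y]] by simp
  qed
  show ?thesis
    using ginner_eqI[OF 1[OF y], of \<phi>] lap_eqI[OF 1[OF y] 2] by (simp add: wlap_def)
qed

lemma wlap_cmult:
  assumes f: "Ck_on 2 U f" and y: "y \<in> U"
  shows "wlap G \<phi> (\<lambda>z. c * f z) y = c * wlap G \<phi> f y"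
proof -
  have 1: "pd i (\<lambda>z. c * f z) z = c * pd i f z + 0 * pd i f z" if "z \<in> U" for i z
    using pd_cmult[OF C2_diffable(1)[OF f that]] by simp
  have 2: "pd i (pd j (\<lambda>z. c * f z)) y = c * pd i (pd j f) y + 0 * pd i (pd j f) y + 0" for i j
  proof -
    have "pd i (pd j (\<lambda>z. c * f z)) y = pd i (\<lambda>z. c * pd j f z) y"
      by (rule pd_cong[OF open_U y]) (simp add: 1)
    then show ?thesis using pd_cmult[OF C2_diffable(2)[OF f y]] by simp
  qed
  show ?thesis
    using ginner_eqI[OF 1[OF y], of \<phi>] lap_eqI[OF 1[OF y] 2] by (simp add: wlap_def algebra_simps)
qed

lemma wlap_mult:
  assumes f: "Ck_on 2 U f" and h: "Ck_on 2 U h" and y: "y \<in> U"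
  shows "wlap G \<phi> (\<lambda>z. f z * h z) y = h y * wlap G \<phi> f y + f y * wlap G \<phi> h y + 2 * ginner G f h y"
proof -
  have 1: "pd i (\<lambda>z. f z * h z) z = h z * pd i f z + f z * pd i h z" if "z \<in> U" for i z
    using pd_mult[OF C2_diffable(1)[OF f that] C2_diffable(1)[OF h that]] by simp
  have 2: "pd i (pd j (\<lambda>z. f z * h z)) y = h y * pd i (pd j f) y + f y * pd i (pd j h) y
      + (pd i h y * pd j f y + pd i f y * pd j h y)" for i j
  proof -
    note d = C2_diffable[OF f y] C2_diffable[OF h y]
    have "pd i (pd j (\<lambda>z. f z * h z)) y = pd i (\<lambda>z. h z * pd j f z + f z * pd j h z) y"
      by (rule pd_cong[OF open_U y]) (simp add: 1)
    also have "\<dots> = pd i (\<lambda>z. h z * pd j f z) y + pd i (\<lambda>z. f z * pd j h z) y"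
      by (intro pd_add differentiable_mult d)
    finally show ?thesis using pd_mult[OF d(3,2)] pd_mult[OF d(1,4)] by simp
  qed
  have "(\<Sum>i j. ginv G i j y * (pd i h y * pd j f y)) = ginner G f h y"
    unfolding inner_grad by (simp add: mult_ac)
  moreover have "(\<Sum>i j. ginv G i j y * (pd i f y * pd j h y)) = ginner G h f y"
    unfolding inner_grad by (simp add: mult_ac)
  ultimately have 3: "(\<Sum>i j. ginv G i j y * (pd i h y * pd j f y + pd i f y * pd j h y)) = 2 * ginner G f h y"
    using inner_sym[OF y, of h f] by (simp add: distrib_left sum.distrib)
  show ?thesis
    using ginner_eqI[OF 1[OF y], of \<phi>] lap_eqI[OF 1[OF y] 2] 3 by (simp add: wlap_def algebra_simps)
qed

lemma wlap_compose_real: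
  assumes "open S" "Ck_on 2 S h" "smooth_on U f" "\<And>z. z \<in> U \<Longrightarrow> f z \<in> S" "y \<in> U"
  shows "wlap G \<phi> (\<lambda>z. h (f z)) y = deriv h (f y) * wlap G \<phi> f y + deriv (deriv h) (f y) * ginner G f f y"
proof -
  note P = pd_pd_compose_real[OF open_U assms]
  have 1: "pd i (\<lambda>z. h (f z)) y = deriv h (f y) * pd i f y + 0 * pd i f y" for i
    using P(1) by simp
  have 2: "pd i (pd j (\<lambda>z. h (f z))) y = deriv h (f y) * pd i (pd j f) y + 0 * pd i (pd j f) y
      + deriv (deriv h) (f y) * (pd i f y * pd j f y)" for i j
    using P(2) by simp
  have "(\<Sum>i j. ginv G i j y * (deriv (deriv h) (f y) * (pd i f y * pd j f y)))
    = deriv (deriv h) (f y) * ginner G f f y"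
    unfolding inner_grad sum_distrib_left by (simp add: mult_ac)
  then show ?thesis
    using ginner_eqI[OF 1, of \<phi>] lap_eqI[OF 1 2] by (simp add: wlap_def algebra_simps)
qed

text \<open>
  At a critical point the Hessian is the matrix of second derivatives, so \<open>\<Delta>_\<phi> F\<close> is the trace of
  the product of \<open>g^(-1)\<close> and a negative semidefinite matrix.
\<close>

lemma wlap_nonpos_at_max:
  assumes F: "Ck_on 2 U F" and y: "y \<in> U" and max: "\<And>z. z \<in> U \<Longrightarrow> F z \<le> F y"
  shows "pd i F y = 0" "wlap G \<phi> F y \<le> 0"
proof -
  show 0: "pd i F y = 0" for i
    using pd_eq_0_at_max[OF open_U y C2_diffable(1)[OF F y] max] .
  have "(\<Sum>i j. ginv G i j y * (- pd i (pd j F) y)) \<ge> 0"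
  proof (rule sum_psd_product_nonneg[OF ginv_sym[OF y] ginv_pos(1)[OF y]])
    fix \<xi> :: "'n \<Rightarrow> real"
    show "(\<Sum>i j. \<xi> i * (- pd i (pd j F) y) * \<xi> j) \<ge> 0"
      using second_derivative_nonpos_at_max[OF open_U y F max, of "\<chi> i. \<xi> i"]
      by (simp add: sum_negf mult_ac)
  qed
  then show "wlap G \<phi> F y \<le> 0"
    by (simp add: wlap_def lap_def hess_def ginner_def 0 sum_negf)
qed

end

section \<open>Invariance under changes of coordinates\<close>

lemma pd_nth: "pd i (\<lambda>z. z $ a) y = (if i = a then 1 else 0)"
  unfolding pd_dirderiv
  by (subst dirderiv_eqI[OF bounded_linear.has_derivative[OF bounded_linear_vec_nth has_derivative_ident]])
    (simp add: axis_def)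

lemma smooth_on_nth:
  fixes D :: "(real^'n::finite) set"
  assumes "open D"
  shows "smooth_on D (\<lambda>z. z $ a)"
proof -
  have der: "((\<lambda>z. z $ a) has_derivative (\<lambda>h. h $ a)) (at y)" for y :: "real^'n"
    by (rule bounded_linear.has_derivative[OF bounded_linear_vec_nth has_derivative_ident])
  have "dirderiv b (\<lambda>z. z $ a) = (\<lambda>y. b $ a)" for b :: "real^'n"
    by (simp add: fun_eq_iff dirderiv_eqI[OF der])
  then have "Ck_on (Suc k) D (\<lambda>z. z $ a)" for k
    using der by (auto simp: Ck_on_Suc_open[OF assms] Ck_on_const[OF assms] differentiable_def simp del: Ck_on.simps)
  then show ?thesis unfolding smooth_on_def using Ck_on_Suc_imp by blast
qed

lemma has_derivative_components:
  fixes \<tau> :: "'e::euclidean_space \<Rightarrow> real^'n"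
  assumes "\<And>a. (\<lambda>z. \<tau> z $ a) differentiable (at y)"
  shows "(\<tau> has_derivative (\<lambda>h. \<chi> a. dirderiv h (\<lambda>z. \<tau> z $ a) y)) (at y)"
  unfolding has_derivative_componentwise_within[of \<tau>]
proof
  fix b :: "real^'n" assume "b \<in> Basis"
  then obtain a where b: "b = axis a 1" by (auto simp: Basis_vec_def)
  show "((\<lambda>x. \<tau> x \<bullet> b) has_derivative (\<lambda>h. (\<chi> a. dirderiv h (\<lambda>z. \<tau> z $ a) y) \<bullet> b)) (at y)"
    using has_derivative_dirderiv[OF assms, of a] by (simp add: b inner_axis)
qed

lemma matrix_triple_product:
  fixes A :: "real^'k^'m" and B :: "real^'l^'k" and C :: "real^'n^'l"
  shows "(A ** B ** C) $ i $ j = (\<Sum>a b. A $ i $ a * B $ a $ b * C $ b $ j)"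
  by (simp add: matrix_matrix_mult_def sum_distrib_right sum.swap[of _ "UNIV :: 'l set"])

context coordinate_metric
begin

lemma ginner_cong:
  assumes "y \<in> U" "\<And>z. z \<in> U \<Longrightarrow> f z = f' z" "\<And>z. z \<in> U \<Longrightarrow> h z = h' z"
  shows "ginner G f h y = ginner G f' h' y"
  unfolding inner_grad using pd_cong[OF open_U assms(1,2)] pd_cong[OF open_U assms(1,3)] by simp

lemma lap_cong:
  assumes "y \<in> U" "\<And>z. z \<in> U \<Longrightarrow> f z = f' z"
  shows "lap G f y = lap G f' y"
proof -
  have 1: "pd i f z = pd i f' z" if "z \<in> U" for i z using pd_cong[OF open_U that assms(2)] .
  have "pd i (pd j f) y = pd i (pd j f') y" for i j by (rule pd_cong[OF open_U assms(1) 1])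
  then show ?thesis unfolding lap_def hess_def using 1[OF assms(1)] by simp
qed

text \<open>
  As in Koszul's formula, the Hessian on gradients is an expression in inner products of gradients
  alone. This transfers the invariance of inner products to second-order
  operators without second derivatives of a coordinate change.
\<close>

lemma hess_polarization:
  assumes f: "smooth_on U f" and a: "smooth_on U a" and b: "smooth_on U b" and y: "y \<in> U"
  shows "ginner G a (ginner G f b) y + ginner G b (ginner G f a) y - ginner G f (ginner G a b) y
    = 2 * (\<Sum>i j. hess G f i j y * grad G a i y * grad G b j y)"
proof -
  define Q where "Q h p q = (\<Sum>i j. hess G h i j y * grad G p i y * grad G q j y)" for h p q
  have Q: "Q h p q = Q h q p" if "smooth_on U h" for h p q
    unfolding Q_def by (subst sum.swap) (simp add: hess_sym[OF that y] mult_ac)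
  have e: "ginner G p (ginner G h q) y = Q h p q + Q q p h" if "smooth_on U h" "smooth_on U q" for p h q
    unfolding ginner_def[of G p] pd_inner[OF that y] Q_def
    by (simp add: distrib_left sum.distrib sum_distrib_left mult_ac)
  show ?thesis
    unfolding e[OF f b] e[OF f a] e[OF a b] Q_def[symmetric]
    using Q[OF f, of a b] Q[OF a, of b f] Q[OF b, of a f] by simp
qed

text \<open>
  The trace of the Hessian, expressed by the gradients of functions \<open>X a\<close> in whose terms the inverse
  metric has coefficients \<open>c\<close>. For \<open>X\<close> the coordinates of another chart,
  each ingredient is invariant.
\<close>

lemma lap_frame:
  fixes c :: "'n \<Rightarrow> 'n \<Rightarrow> real"
  assumes f: "smooth_on U f" and X: "\<And>a. smooth_on U (X a)" and y: "y \<in> U"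
    and frame: "\<And>i j. (\<Sum>a b. grad G (X a) i y * c a b * grad G (X b) j y) = ginv G i j y"
  shows "lap G f y = (\<Sum>a b. c a b / 2 *
    (ginner G (X a) (ginner G f (X b)) y + ginner G (X b) (ginner G f (X a)) y - ginner G f (ginner G (X a) (X b)) y))"
proof -
  have "(\<Sum>a b. c a b / 2 *
    (ginner G (X a) (ginner G f (X b)) y + ginner G (X b) (ginner G f (X a)) y - ginner G f (ginner G (X a) (X b)) y))
    = (\<Sum>a b i j. hess G f i j y * (grad G (X a) i y * c a b * grad G (X b) j y))"
    unfolding hess_polarization[OF f X X y] by (simp add: sum_distrib_left mult_ac)
  also have "\<dots> = (\<Sum>i j a b. hess G f i j y * (grad G (X a) i y * c a b * grad G (X b) j y))"
    by (rule sum_swap_pairs)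
  also have "\<dots> = (\<Sum>i j. hess G f i j y * ginv G i j y)"
    unfolding sum_distrib_left[symmetric] frame ..
  finally show ?thesis by (simp add: lap_def mult.commute)
qed

end

text \<open>
  The metric \<open>G1\<close> is the pullback of \<open>G2\<close> by the map \<open>\<tau>\<close>.
\<close>

locale coordinate_change =
  M1: coordinate_metric U1 G1 + M2: coordinate_metric U2 G2
  for U1 U2 :: "(real^'n::finite) set" and G1 G2 +
  fixes \<tau> :: "real^'n \<Rightarrow> real^'n"
  assumes maps: "y \<in> U1 \<Longrightarrow> \<tau> y \<in> U2"
    and \<tau>_smooth: "smooth_on U1 (\<lambda>z. \<tau> z $ a)"
    and G_transform: "y \<in> U1 \<Longrightarrow> G1 y $ i $ j =
      (\<Sum>a b. pd i (\<lambda>z. \<tau> z $ a) y * G2 (\<tau> y) $ a $ b * pd j (\<lambda>z. \<tau> z $ b) y)"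
begin

lemma pd_pullback:
  assumes "f differentiable (at (\<tau> y))" "y \<in> U1"
  shows "pd i (\<lambda>z. f (\<tau> z)) y = (\<Sum>a. pd a f (\<tau> y) * pd i (\<lambda>z. \<tau> z $ a) y)"
proof -
  have "pd i (\<lambda>z. f (\<tau> z)) y = dirderiv (\<chi> a. pd i (\<lambda>z. \<tau> z $ a) y) f (\<tau> y)"
    unfolding pd_dirderiv
    by (rule dirderiv_eqI[OF has_derivative_compose[OF has_derivative_components[OF M1.diffable[OF \<tau>_smooth assms(2)]] has_derivative_dirderiv[OF assms(1)]]])
  then show ?thesis by (simp add: dirderiv_expand[OF assms(1)] mult.commute)
qed

text \<open>
  The Jacobian matrix \<open>J\<close> is invertible because \<open>J^T G2 J\<close> is, and \<open>J G1^(-1) J^T\<close> is then an inverse of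
  \<open>G2\<close>.
\<close>

lemma ginv_transform:
  assumes y: "y \<in> U1"
  shows "(\<Sum>i j. pd i (\<lambda>z. \<tau> z $ a) y * ginv G1 i j y * pd j (\<lambda>z. \<tau> z $ b) y) = ginv G2 a b (\<tau> y)"
proof -
  define J :: "real^'n^'n" where "J = (\<chi> a i. pd i (\<lambda>z. \<tau> z $ a) y)"
  let ?I = "matrix_inv (G1 y)"
  have G1: "G1 y = transpose J ** G2 (\<tau> y) ** J"
    by (simp add: vec_eq_iff G_transform[OF y] matrix_triple_product transpose_def J_def)
  note I = invertible_matrix_inv[OF M1.invertible_G[OF y]]
  have "?I ** (transpose J ** G2 (\<tau> y)) ** J = mat 1"
    using I(2) unfolding G1 by (simp add: matrix_mul_assoc)
  then have JJ: "J ** (?I ** (transpose J ** G2 (\<tau> y))) = mat 1"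
    using matrix_left_right_inverse by blast
  then have "(J ** ?I ** transpose J) ** G2 (\<tau> y) = mat 1"
    by (simp add: matrix_mul_assoc)
  then have "(J ** ?I ** transpose J) ** G2 (\<tau> y) ** matrix_inv (G2 (\<tau> y)) = matrix_inv (G2 (\<tau> y))"
    by simp
  then have "J ** ?I ** transpose J = matrix_inv (G2 (\<tau> y))"
    using invertible_matrix_inv(1)[OF M2.invertible_G[OF maps[OF y]]] by (simp flip: matrix_mul_assoc)
  then have "(J ** ?I ** transpose J) $ a $ b = ginv G2 a b (\<tau> y)" by (simp add: ginv_def)
  then show ?thesis
    unfolding matrix_triple_product by (simp add: transpose_def J_def ginv_def)
qed

lemma inner_pullback:
  assumes f: "f differentiable (at (\<tau> y))" and h: "h differentiable (at (\<tau> y))" and y: "y \<in> U1"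
  shows "ginner G1 (\<lambda>z. f (\<tau> z)) (\<lambda>z. h (\<tau> z)) y = ginner G2 f h (\<tau> y)"
proof -
  let ?J = "\<lambda>a i. pd i (\<lambda>z. \<tau> z $ a) y"
  have "ginner G1 (\<lambda>z. f (\<tau> z)) (\<lambda>z. h (\<tau> z)) y
    = (\<Sum>i j a b. (pd b f (\<tau> y) * ?J b j) * ginv G1 i j y * (pd a h (\<tau> y) * ?J a i))"
    unfolding M1.inner_grad pd_pullback[OF f y] pd_pullback[OF h y] sum_distrib_left sum_distrib_right
    by simp
  also have "\<dots> = (\<Sum>a b i j. (pd b f (\<tau> y) * ?J b j) * ginv G1 i j y * (pd a h (\<tau> y) * ?J a i))"
    by (rule sum_swap_pairs)
  also have "\<dots> = (\<Sum>a b. pd b f (\<tau> y) * (\<Sum>i j. ?J a i * ginv G1 i j y * ?J b j) * pd a h (\<tau> y))"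
    unfolding sum_distrib_left sum_distrib_right by (simp add: mult_ac)
  finally show ?thesis unfolding ginv_transform[OF y] M2.inner_grad .
qed

text \<open>
  The coordinates of the second chart serve as the frame in both charts.
\<close>

lemma lap_pullback:
  assumes f: "smooth_on U2 f" and f\<tau>: "smooth_on U1 (\<lambda>z. f (\<tau> z))" and y: "y \<in> U1"
  shows "lap G1 (\<lambda>z. f (\<tau> z)) y = lap G2 f (\<tau> y)"
proof -
  define c where "c a b = G2 (\<tau> y) $ a $ b" for a b
  note X2 = smooth_on_nth[OF M2.open_U]
  have inner: "ginner G1 (\<lambda>z. h (\<tau> z)) (\<lambda>z. k (\<tau> z)) z = ginner G2 h k (\<tau> z)"
    if "smooth_on U2 h" "smooth_on U2 k" "z \<in> U1" for h k z
    by (intro inner_pullback M2.diffable that maps)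
  have nested: "ginner G1 (\<lambda>z. h (\<tau> z)) (ginner G1 (\<lambda>z. k (\<tau> z)) (\<lambda>z. l (\<tau> z))) y = ginner G2 h (ginner G2 k l) (\<tau> y)"
    if "smooth_on U2 h" "smooth_on U2 k" "smooth_on U2 l" for h k l
  proof -
    have "ginner G1 (\<lambda>z. h (\<tau> z)) (ginner G1 (\<lambda>z. k (\<tau> z)) (\<lambda>z. l (\<tau> z))) y
      = ginner G1 (\<lambda>z. h (\<tau> z)) (\<lambda>z. ginner G2 k l (\<tau> z)) y"
      using inner[OF that(2,3)] by (intro M1.ginner_cong[OF y]) auto
    also have "\<dots> = ginner G2 h (ginner G2 k l) (\<tau> y)"
      by (rule inner[OF that(1) M2.smooth_inner[OF that(2,3)] y])
    finally show ?thesis .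
  qed
  have frame2: "(\<Sum>a b. grad G2 (\<lambda>z. z $ a) i (\<tau> y) * c a b * grad G2 (\<lambda>z. z $ b) j (\<tau> y)) = ginv G2 i j (\<tau> y)" for i j
  proof -
    have g: "grad G2 (\<lambda>z. z $ a) i (\<tau> y) = ginv G2 i a (\<tau> y)" for a i
      by (simp add: grad_def pd_nth if_distrib sum.delta cong: if_cong)
    have "(\<Sum>a b. ginv G2 i a (\<tau> y) * c a b * ginv G2 j b (\<tau> y)) = ginv G2 j i (\<tau> y)"
      using M2.raise_lower[OF maps[OF y], of i "\<lambda>q. ginv G2 j q (\<tau> y)"]
      by (simp add: c_def sum_distrib_left mult.assoc)
    then show ?thesis unfolding g using M2.ginv_sym[OF maps[OF y]] by simp
  qed
  have frame1: "(\<Sum>a b. grad G1 (\<lambda>z. \<tau> z $ a) i y * c a b * grad G1 (\<lambda>z. \<tau> z $ b) j y) = ginv G1 i j y" for i j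
  proof -
    let ?J = "\<lambda>a i. pd i (\<lambda>z. \<tau> z $ a) y"
    have "(\<Sum>a b. grad G1 (\<lambda>z. \<tau> z $ a) i y * c a b * grad G1 (\<lambda>z. \<tau> z $ b) j y)
      = (\<Sum>a b k l. ginv G1 i k y * ?J a k * c a b * (ginv G1 j l y * ?J b l))"
      unfolding grad_def by (simp add: sum_distrib_left sum_distrib_right) (intro sum.cong refl sum.swap)
    also have "\<dots> = (\<Sum>k l a b. ginv G1 i k y * ?J a k * c a b * (ginv G1 j l y * ?J b l))"
      by (rule sum_swap_pairs)
    also have "\<dots> = (\<Sum>k. ginv G1 i k y * (\<Sum>l. G1 y $ k $ l * ginv G1 j l y))"
      unfolding G_transform[OF y] c_def sum_distrib_left sum_distrib_right by (simp add: mult_ac)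
    also have "\<dots> = ginv G1 i j y"
      using M1.raise_lower[OF y, of i "\<lambda>q. ginv G1 j q y"] M1.ginv_sym[OF y] by simp
    finally show ?thesis .
  qed
  show ?thesis
    unfolding M1.lap_frame[OF f\<tau> \<tau>_smooth y frame1] M2.lap_frame[OF f X2 maps[OF y] frame2]
    using nested[OF X2 f X2] nested[OF f X2 X2] by simp
qed

end

section \<open>The estimate at a spatial maximum\<close>

text \<open>
  The algebra at a spatial maximum, with \<open>b = p - 1\<close>. The numbers stand for the following values at the
  point: \<open>v\<close>, \<open>w = |\<nabla>v|\<^sup>2\<close>, \<open>L = \<Delta>_\<phi> v\<close>, \<open>\<mu>\<close> the eigenvalue of the Hessian, \<open>e\<close> the factor
  \<open>e^(-\<kappa> t)\<close>, \<open>G1\<close>, \<open>G2\<close> the derivatives of \<open>\<Gamma>\<close>, \<open>\<sigma>\<close> and \<open>Sr\<close> the values of \<open>\<Sigma>\<close> and \<open>\<Sigma>_v\<close>,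
  \<open>sx = \<langle>\<nabla>v, \<Sigma>_x\<rangle>\<close>, \<open>bL = \<langle>\<nabla>v, \<nabla>L\<rangle>\<close>, \<open>Q\<close> the Hessian and Ricci terms of the Bochner
  formula, \<open>W = \<Delta>_\<phi> w/2\<close>, \<open>Vt\<close> and \<open>fVt\<close> the values of \<open>\<partial>_t v\<close> and \<open>\<langle>\<nabla>v, \<nabla>\<partial>_t v\<rangle>\<close>, \<open>P0\<close>, \<open>P1\<close>, \<open>P2\<close> the
  powers \<open>v^\<beta>\<close>, \<open>v^(\<beta>-1)\<close>, \<open>v^(\<beta>-2)\<close>, and \<open>D = \<partial>_t F\<close>.
\<close>

lemma maximum_point_inequality:
  fixes b v w e L \<mu> G1 G2 \<sigma> Sr sx bL Q Vt fVt W D \<kappa> M K a k m P0 P1 P2 :: real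
  assumes pos: "b > 0" "v > 0" "w > 0" "e > 0" "P0 > 0" "m > 1" "k \<ge> 0"
    and P: "P1 = P0 / v" "P2 = P0 / (v * v)"
    and Vt: "Vt = b * v * L + w + \<sigma>"
    and fVt: "fVt = b * (w * L + v * bL) + 2 * \<mu> * w + sx + Sr * w"
    and W: "W = bL + Q"
    and lap: "e * (w * (1/b * P1 * L + 1/b * (1/b - 1) * P2 * w) + P0 * (2 * W) + 4 * (1/b) * P1 * \<mu> * w)
      + G1 * L + G2 * w \<le> 0"
    and D: "D = e * (- \<kappa> * P0 * w + 1/b * P1 * w * Vt + P0 * (2 * fVt)) + G1 * Vt"
    and \<mu>: "e * (1/b * P1 * w + 2 * P0 * \<mu>) + G1 = 0"
    and Q: "Q \<ge> \<mu>\<^sup>2 + (L - \<mu>)\<^sup>2 / (m - 1) - (m - 1) * k * w"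
    and c1: "G1 * \<sigma> \<le> 0" and c2: "G1 + v * G2 \<ge> 0" and c3: "sx \<le> 0" and c4: "Sr + \<sigma> / (2 * b * v) \<le> a"
    and \<kappa>: "\<kappa> = 2 * (M * K + a)" and M: "v \<le> M" and K: "K = b * (m - 1) * k"
    and b: "b * b * (m - 1) \<le> 1"
  shows "D \<le> 0"
proof -
  define E where "E = e * P0"
  have E: "E > 0" using pos by (simp add: E_def)
  define X where "X = - \<kappa> * w + w * w / v + w * \<sigma> / (b * v) + 2 * b * w * L + 2 * sx + 2 * Sr * w - 2 * b * v * Q"
  define La where "La = e * (w * (1/b * P1 * L + 1/b * (1/b - 1) * P2 * w) + P0 * (2 * W) + 4 * (1/b) * P1 * \<mu> * w)
      + G1 * L + G2 * w"
  \<comment> \<open>The factor \<open>b v\<close> is that of \<open>\<Delta>_\<phi>\<close> in the equation; the terms with \<open>bL\<close> and those with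
    \<open>\<mu> w\<close> cancel.\<close>
  have "D - b * v * La = E * X + G1 * (w + \<sigma>) - b * v * G2 * w"
    using pos unfolding D La_def Vt fVt W P E_def X_def by (simp add: field_simps)
  moreover have "b * v * La \<le> 0" using lap pos unfolding La_def[symmetric] by (simp add: mult_nonneg_nonpos)
  ultimately have D_le: "D \<le> E * X + G1 * (w + \<sigma>) - b * v * G2 * w" by linarith
  define Y where "Y = w * w / v + w * w / (2 * b * v) + 2 * b * w * \<mu> - 2 * b * v * (\<mu> * \<mu>)"
  have XY: "X \<le> Y"
  proof -
    have "w * (Sr + \<sigma> / (2 * b * v)) \<le> w * a" using c4 pos by (intro mult_left_mono) auto
    then have 1: "2 * Sr * w + w * \<sigma> / (b * v) \<le> 2 * a * w" using pos by (simp add: field_simps)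
    have "K \<ge> 0" using K pos by simp
    with M have "v * K \<le> M * K" by (rule mult_right_mono)
    then have "v * K * w \<le> M * K * w" by (rule mult_right_mono) (use pos in simp)
    then have 2: "2 * b * v * ((m - 1) * k * w) \<le> 2 * (M * K) * w"
    proof -
      have e2: "2 * b * v * ((m - 1) * k * w) = 2 * (v * K * w)" unfolding K by (simp only: mult_ac)
      show ?thesis unfolding e2 using \<open>v * K * w \<le> M * K * w\<close> by simp
    qed
    define Z where "Z = (m - 1) * k * w"
    define X2 where "X2 = (L - \<mu>)\<^sup>2 / (m - 1)"
    have "b * v * (\<mu> * \<mu> + X2 - Z) \<le> b * v * Q"
      using Q pos by (intro mult_left_mono) (auto simp: X2_def Z_def power2_eq_square)
    then have 3: "- 2 * b * v * Q \<le> - 2 * b * v * (\<mu> * \<mu>) - 2 * b * v * X2 + 2 * b * v * Z"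
      by (simp add: algebra_simps)
    \<comment> \<open>The maximum over \<open>L - \<mu>\<close> is found by completing the square.\<close>
    have "0 \<le> 2 * b * v / (m - 1) * (L - \<mu> - (m - 1) * w / (2 * v))\<^sup>2" using pos by simp
    also have "\<dots> = 2 * b * v * X2 - 2 * b * w * (L - \<mu>) + b * (m - 1) * (w * w) / (2 * v)"
      using pos unfolding X2_def by (simp add: power2_eq_square field_simps)
    finally have 4: "2 * b * w * (L - \<mu>) - 2 * b * v * X2 \<le> b * (m - 1) * (w * w) / (2 * v)" by simp
    have "b * (m - 1) \<le> 1 / b" using b pos by (simp add: field_simps)
    then have "b * (m - 1) * (w * w / (2 * v)) \<le> 1 / b * (w * w / (2 * v))" using pos by (intro mult_right_mono) auto
    then have 5: "b * (m - 1) * (w * w) / (2 * v) \<le> w * w / (2 * b * v)" by (simp add: mult_ac)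
    have "- \<kappa> * w = - 2 * (M * K) * w - 2 * a * w" by (simp add: \<kappa> algebra_simps)
    moreover have "2 * b * w * (L - \<mu>) = 2 * b * w * L - 2 * b * w * \<mu>" by (simp add: algebra_simps)
    ultimately show ?thesis unfolding X_def Y_def using 1 2[folded Z_def] 3 4 5 c3 by linarith
  qed
  \<comment> \<open>The eigenvalue differs from its value for \<open>\<Gamma> = 0\<close>, which makes \<open>Y\<close> vanish, by \<open>\<gamma>\<close>.\<close>
  define \<gamma> where "\<gamma> = G1 / (2 * E)"
  have G1: "G1 = 2 * E * \<gamma>" using E by (simp add: \<gamma>_def)
  have "e * P0 * (w / (b * v) + 2 * \<mu> + 2 * \<gamma>) = 0"
    using \<mu> unfolding G1 E_def P using pos by (simp add: field_simps)
  then have "w / (b * v) + 2 * \<mu> + 2 * \<gamma> = 0" using pos by simp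
  moreover have "w / (2 * b * v) = w / (b * v) / 2" by simp
  ultimately have mu: "\<mu> = - (w / (2 * b * v)) - \<gamma>" by linarith
  have "Y = - 2 * (b + 1) * w * \<gamma> - 2 * b * v * (\<gamma> * \<gamma>)"
    unfolding Y_def mu using pos by (simp add: field_simps)
  also have "\<dots> \<le> - 2 * (b + 1) * w * \<gamma>" using pos by simp
  finally have "E * X \<le> E * (- 2 * (b + 1) * w * \<gamma>)" using XY E by (intro mult_left_mono) auto
  also have "\<dots> = - (b + 1) * w * G1" by (simp add: G1 algebra_simps)
  finally have "D \<le> - (b + 1) * w * G1 + G1 * (w + \<sigma>) - b * v * G2 * w" using D_le by linarith
  also have "\<dots> = - (b * w * (G1 + v * G2)) + G1 * \<sigma>" by (simp add: algebra_simps)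
  also have "\<dots> \<le> 0" using c1 c2 pos by (smt (verit) mult_nonneg_nonneg mult_pos_pos)
  finally show ?thesis .
qed

lemma deriv_powr:
  assumes "r > 0"
  shows "deriv (\<lambda>x::real. x powr \<alpha>) r = \<alpha> * r powr (\<alpha> - 1)"
    and "deriv (deriv (\<lambda>x::real. x powr \<alpha>)) r = \<alpha> * (\<alpha> - 1) * r powr (\<alpha> - 2)"
proof -
  have 1: "deriv (\<lambda>x::real. x powr \<alpha>) r = \<alpha> * r powr (\<alpha> - 1)" if "r > 0" for r \<alpha>
    using has_real_derivative_powr[OF that] by (rule DERIV_imp_deriv)
  show "deriv (\<lambda>x::real. x powr \<alpha>) r = \<alpha> * r powr (\<alpha> - 1)" using 1[OF assms] .
  have "((\<lambda>x. \<alpha> * x powr (\<alpha> - 1)) has_real_derivative \<alpha> * ((\<alpha> - 1) * r powr (\<alpha> - 1 - 1))) (at r)"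
    by (intro DERIV_cmult has_real_derivative_powr assms)
  then have "(deriv (\<lambda>x. x powr \<alpha>) has_real_derivative \<alpha> * ((\<alpha> - 1) * r powr (\<alpha> - 1 - 1))) (at r)"
    by (rule has_field_derivative_transform_within_open[of _ _ _ "{0<..}"]) (use assms 1 in auto)
  then show "deriv (deriv (\<lambda>x::real. x powr \<alpha>)) r = \<alpha> * (\<alpha> - 1) * r powr (\<alpha> - 2)"
    using DERIV_imp_deriv by (fastforce simp: algebra_simps)
qed

text \<open>
  The Cauchy--Schwarz inequality for \<open>x = (x + q) - q\<close>. With \<open>A = n - 1\<close> and \<open>B = m - n\<close> it
  combines the dimension of the manifold with that contributed by the weight.
\<close>

lemma square_quotient_sum:
  assumes "A > 0" "B > (0::real)"
  shows "x\<^sup>2 / (A + B) \<le> (x + q)\<^sup>2 / A + q\<^sup>2 / B"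
proof -
  have "(x + q)\<^sup>2 / A + q\<^sup>2 / B - x\<^sup>2 / (A + B) = (B * (x + q) + A * q)\<^sup>2 / (A * B * (A + B))"
    using assms by (simp add: field_simps power2_eq_square)
  also have "\<dots> \<ge> 0" using assms by simp
  finally show ?thesis by simp
qed

context coordinate_metric
begin

text \<open>
  Time and space derivatives commute.
\<close>

lemma inner_time_derivative:
  assumes J: "open J" "t \<in> J" and V: "smooth_on (U \<times> J) V" and y: "y \<in> U"
  shows "((\<lambda>s. ginner G (\<lambda>z. V (z, s)) (\<lambda>z. V (z, s)) y) has_real_derivative
    2 * ginner G (\<lambda>z. V (z, t)) (\<lambda>z. dirderiv (0, 1) V (z, t)) y) (at t)"
proof -
  have o: "open (U \<times> J)" using open_U J by (simp add: open_Times)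
  have B: "(axis i 1, 0) \<in> (Basis :: ((real^'n) \<times> real) set)" for i :: 'n by (rule Prod_Basis(1)[OF axis_Basis])
  have sp: "pd i (\<lambda>z. V (z, s)) y = dirderiv (axis i 1, 0) V (y, s)" if "s \<in> J" for s i
    unfolding pd_dirderiv using smooth_on_differentiable[OF o V, of "(y, s)"] that y by (intro dirderiv_slice(1)) simp
  have der: "((\<lambda>s. pd i (\<lambda>z. V (z, s)) y) has_real_derivative pd i (\<lambda>z. dirderiv (0, 1) V (z, t)) y) (at t)" for i
  proof -
    have d: "dirderiv (axis i 1, 0) V differentiable (at (y, t))" "dirderiv (0, 1) V differentiable (at (y, t))"
      using smooth_on_differentiable[OF o smooth_on_dirderiv[OF o V]] B Prod_Basis(2) y J by auto
    have "((\<lambda>s. dirderiv (axis i 1, 0) V (y, s)) has_real_derivative dirderiv (0, 1) (dirderiv (axis i 1, 0) V) (y, t)) (at t)"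
      by (rule dirderiv_slice(3)[OF d(1)])
    also have "dirderiv (0, 1) (dirderiv (axis i 1, 0) V) (y, t) = dirderiv (axis i 1, 0) (dirderiv (0, 1) V) (y, t)"
      using y J by (intro dirderiv_commute[OF o smooth_on_Ck[OF V] Prod_Basis(2) B]) simp
    also have "\<dots> = pd i (\<lambda>z. dirderiv (0, 1) V (z, t)) y"
      unfolding pd_dirderiv by (rule dirderiv_slice(1)[OF d(2), symmetric])
    finally show ?thesis
      by (rule has_field_derivative_transform_within_open[OF _ J]) (simp add: sp)
  qed
  have "((\<lambda>s. ginner G (\<lambda>z. V (z, s)) (\<lambda>z. V (z, s)) y) has_real_derivative
    (\<Sum>i j. (pd j (\<lambda>z. dirderiv (0, 1) V (z, t)) y * ginv G i j y) * pd i (\<lambda>z. V (z, t)) y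
      + pd i (\<lambda>z. dirderiv (0, 1) V (z, t)) y * (pd j (\<lambda>z. V (z, t)) y * ginv G i j y))) (at t)"
    unfolding inner_grad
    by (intro DERIV_sum DERIV_mult DERIV_cmult_right der)
  also have "(\<Sum>i j. (pd j (\<lambda>z. dirderiv (0, 1) V (z, t)) y * ginv G i j y) * pd i (\<lambda>z. V (z, t)) y
      + pd i (\<lambda>z. dirderiv (0, 1) V (z, t)) y * (pd j (\<lambda>z. V (z, t)) y * ginv G i j y))
    = ginner G (\<lambda>z. dirderiv (0, 1) V (z, t)) (\<lambda>z. V (z, t)) y + ginner G (\<lambda>z. V (z, t)) (\<lambda>z. dirderiv (0, 1) V (z, t)) y"
    unfolding inner_grad sum.distrib[symmetric] by (simp add: mult_ac)
  finally show ?thesis using inner_sym[OF y, of "\<lambda>z. dirderiv (0, 1) V (z, t)"] by simp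
qed

text \<open>
  The derivative of the right-hand side of the pressure equation in the direction of \<open>\<nabla>f\<close>; the term
  \<open>S\<close> contributes its space derivative and its derivative in the function value.
\<close>

lemma reaction_diffusion_gradient:
  assumes f: "smooth_on U f" and \<phi>: "smooth_on U \<phi>" and y: "y \<in> U"
    and h: "\<And>z. z \<in> U \<Longrightarrow> h z = b * f z * wlap G \<phi> f z + ginner G f f z + S z (f z)"
    and S: "(\<lambda>(z, r). S z r) differentiable (at (y, f y))"
  shows "ginner G f h y = b * (ginner G f f y * wlap G \<phi> f y + f y * ginner G f (wlap G \<phi> f) y)
    + ginner G f (ginner G f f) y + ginner G f (\<lambda>z. S z (f y)) y + deriv (S y) (f y) * ginner G f f y"
proof -
  let ?S = "\<lambda>(z, r). S z r"
  note dS = has_derivative_dirderiv[OF S]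
  have "((\<lambda>z. (z, f z)) has_derivative (\<lambda>h. (h, dirderiv h f y))) (at y)"
    by (rule has_derivative_Pair[OF has_derivative_ident has_derivative_dirderiv[OF diffable[OF f y]]])
  from has_derivative_compose[OF this dS]
  have comp: "((\<lambda>z. S z (f z)) has_derivative (\<lambda>h. dirderiv (h, dirderiv h f y) ?S (y, f y))) (at y)" by simp
  have dr: "(S y has_real_derivative dirderiv (0, 1) ?S (y, f y)) (at (f y))"
    using dirderiv_slice(3)[OF S] by simp
  have dz: "dirderiv b (\<lambda>z. S z (f y)) y = dirderiv (b, 0) ?S (y, f y)" for b
    using dirderiv_slice(1)[OF S, of b] by simp
  interpret D: linear "\<lambda>b. dirderiv b ?S (y, f y)"
    using linear_frechet_derivative[OF S] by (simp add: dirderiv_def[abs_def])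
  have pS: "pd i (\<lambda>z. S z (f z)) y = pd i (\<lambda>z. S z (f y)) y + deriv (S y) (f y) * pd i f y" for i
  proof -
    have "pd i (\<lambda>z. S z (f z)) y = dirderiv ((axis i 1, 0) + pd i f y *\<^sub>R (0, 1)) ?S (y, f y)"
      unfolding pd_dirderiv dirderiv_eqI[OF comp] by simp
    also have "\<dots> = pd i (\<lambda>z. S z (f y)) y + pd i f y * deriv (S y) (f y)"
      unfolding D.add D.scale by (simp add: pd_dirderiv dz DERIV_imp_deriv[OF dr])
    finally show ?thesis by (simp add: mult.commute)
  qed
  have dL: "wlap G \<phi> f differentiable (at y)" by (intro diffable smooth_wlap \<phi> f y)
  have pfL: "pd i (\<lambda>z. f z * wlap G \<phi> f z) y = pd i f y * wlap G \<phi> f y + f y * pd i (wlap G \<phi> f) y" for i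
    by (intro pd_mult diffable smooth_wlap \<phi> f y)
  have d1: "(\<lambda>z. f z * wlap G \<phi> f z) differentiable (at y)"
    by (intro differentiable_mult diffable smooth_wlap \<phi> f y)
  have d2: "ginner G f f differentiable (at y)" by (intro diffable smooth_inner f y)
  have d3: "(\<lambda>z. S z (f z)) differentiable (at y)" using comp by (rule differentiableI)
  have ph: "pd i h y = b * (pd i f y * wlap G \<phi> f y + f y * pd i (wlap G \<phi> f) y) + pd i (ginner G f f) y
      + (pd i (\<lambda>z. S z (f y)) y + deriv (S y) (f y) * pd i f y)" for i
  proof -
    have "pd i h y = pd i (\<lambda>z. b * (f z * wlap G \<phi> f z) + ginner G f f z + S z (f z)) y"
      by (rule pd_cong[OF open_U y]) (simp add: h mult.assoc)
    also have "\<dots> = pd i (\<lambda>z. b * (f z * wlap G \<phi> f z) + ginner G f f z) y + pd i (\<lambda>z. S z (f z)) y"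
      by (intro pd_add differentiable_add differentiable_mult[OF differentiable_const] d1 d2 d3)
    also have "pd i (\<lambda>z. b * (f z * wlap G \<phi> f z) + ginner G f f z) y
      = pd i (\<lambda>z. b * (f z * wlap G \<phi> f z)) y + pd i (ginner G f f) y"
      by (intro pd_add differentiable_mult[OF differentiable_const] d1 d2)
    finally show ?thesis unfolding pd_cmult[OF d1] pfL pS .
  qed
  show ?thesis
    unfolding ginner_def[of G f] ph by (simp add: algebra_simps sum.distrib sum_distrib_left)
qed

lemma inner_nonneg: "y \<in> U \<Longrightarrow> ginner G f f y \<ge> 0"
  using ginv_pos(1)[of y "\<lambda>i. pd i f y"] unfolding inner_grad by (subst sum.swap) (simp add: ginv_sym mult_ac)

lemma inner_pos: "y \<in> U \<Longrightarrow> pd i f y \<noteq> 0 \<Longrightarrow> ginner G f f y > 0"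
  using ginv_pos(2)[of y "\<lambda>i. pd i f y"] unfolding inner_grad by (subst sum.swap) (simp add: ginv_sym mult_ac)

lemma trace_hess_raised_square_nonneg:
  assumes "smooth_on U f" "y \<in> U"
  shows "(\<Sum>i k. hess_raised G f i k y * hess_raised G f k i y) \<ge> 0"
  using trace_square_nonneg[of "\<lambda>i j. ginv G i j y" "\<lambda>i j. hess G f i j y",
      OF ginv_sym[OF assms(2)] ginv_pos(1)[OF assms(2)] hess_sym[OF assms]]
  unfolding hess_raised_def .

text \<open>
  The trace of the Hessian is the unweighted Laplacian \<open>L + q\<close> with \<open>q = \<langle>\<nabla>\<phi>, \<nabla>f\<rangle>\<close>. Replacing it by
  \<open>L\<close> costs the term \<open>q\<^sup>2/(m - n)\<close> and changes the dimension from \<open>n\<close> to \<open>m\<close>.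
\<close>

lemma hess_trace_bound:
  assumes f: "smooth_on U f" and y: "y \<in> U"
    and eigen: "\<And>i. (\<Sum>l. hess G f i l y * grad G f l y) = \<mu> * pd i f y"
    and w: "ginner G f f y > 0" and n: "CARD('n) \<ge> 2" and m: "m \<ge> real CARD('n)"
    and q: "q = ginner G \<phi> f y" "m = real CARD('n) \<Longrightarrow> q = 0"
  shows "\<mu>\<^sup>2 + (wlap G \<phi> f y - \<mu>)\<^sup>2 / (m - 1)
    \<le> (\<Sum>i k. hess_raised G f i k y * hess_raised G f k i y) + (if m = real CARD('n) then 0 else q\<^sup>2 / (m - real CARD('n)))"
proof -
  let ?n = "real CARD('n)"
  have n1: "?n - 1 > 0" using n by simp
  have tr: "(\<Sum>i. hess_raised G f i i y) = lap G f y" by (simp add: hess_raised_def lap_def)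
  have "\<mu>\<^sup>2 + (lap G f y - \<mu>)\<^sup>2 / (?n - 1) \<le> (\<Sum>i k. hess_raised G f i k y * hess_raised G f k i y)"
    using trace_square_eigenvector_bound[of "\<lambda>i j. ginv G i j y" "\<lambda>i j. G y $ i $ j" "\<lambda>i j. hess G f i j y"
        "\<lambda>i. grad G f i y" "\<lambda>i. pd i f y" \<mu> "ginner G f f y" "\<lambda>i k. hess_raised G f i k y",
        OF ginv_sym[OF y] ginv_pos(1)[OF y] G_sym[OF y] ginv_left[OF y] hess_sym[OF f y] grad_def eigen ginner_def w hess_raised_def n]
    unfolding tr .
  moreover have "(wlap G \<phi> f y - \<mu>)\<^sup>2 / (m - 1)
    \<le> (lap G f y - \<mu>)\<^sup>2 / (?n - 1) + (if m = ?n then 0 else q\<^sup>2 / (m - ?n))"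
  proof (cases "m = ?n")
    case True
    then show ?thesis using q by (simp add: wlap_def)
  next
    case False
    then have "m - ?n > 0" using m by simp
    from square_quotient_sum[OF n1 this, of "wlap G \<phi> f y - \<mu>" q]
    show ?thesis using False by (simp add: wlap_def q(1) algebra_simps)
  qed
  ultimately show ?thesis by linarith
qed

text \<open>
  If \<open>\<nabla>v \<noteq> 0\<close> at the maximum, then the critical point equation identifies \<open>\<nabla>v\<close> as an eigenvector of the
  Hessian, and \<open>maximum_point_inequality\<close> applies. If \<open>\<nabla>v = 0\<close>, then
  \<open>\<partial>_t F = \<Gamma>'(v) \<partial>_t v\<close>, whose sign is seen from \<open>\<Delta>_\<phi> F \<le> 0\<close>.
\<close>

lemma spacetime_maximum:
  fixes V :: "(real^'n) \<times> real \<Rightarrow> real"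
  assumes J: "open J" "t \<in> J" and V: "smooth_on (U \<times> J) V" and V_pos: "\<And>z s. z \<in> U \<Longrightarrow> s \<in> J \<Longrightarrow> V (z, s) > 0"
    and \<phi>: "smooth_on U \<phi>" and y: "y \<in> U"
    and eq: "\<And>z. z \<in> U \<Longrightarrow> dirderiv (0, 1) V (z, t) = b * V (z, t) * wlap G \<phi> (\<lambda>x. V (x, t)) z
        + ginner G (\<lambda>x. V (x, t)) (\<lambda>x. V (x, t)) z + S z (V (z, t))"
    and S: "(\<lambda>(z, r). S z r) differentiable (at (y, V (y, t)))"
    and \<Gamma>: "Ck_on 2 {0<..} \<Gamma>"
    and b: "b > 0" "b * b * (m - 1) \<le> 1" and n: "CARD('n) \<ge> 2" "m \<ge> real CARD('n)" and k: "k \<ge> 0"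
    and w: "w = ginner G (\<lambda>x. V (x, t)) (\<lambda>x. V (x, t)) y"
    and q: "q = ginner G \<phi> (\<lambda>x. V (x, t)) y" "m = real CARD('n) \<Longrightarrow> q = 0"
    and ric: "(\<Sum>i j. (ric G i j y + hess G \<phi> i j y) * grad G (\<lambda>x. V (x, t)) i y * grad G (\<lambda>x. V (x, t)) j y)
        \<ge> (if m = real CARD('n) then 0 else q\<^sup>2 / (m - real CARD('n))) - (m - 1) * k * w"
    and c1: "deriv \<Gamma> (V (y, t)) * S y (V (y, t)) \<le> 0"
    and c2: "deriv \<Gamma> (V (y, t)) + V (y, t) * deriv (deriv \<Gamma>) (V (y, t)) \<ge> 0"
    and c3: "ginner G (\<lambda>x. V (x, t)) (\<lambda>z. S z (V (y, t))) y \<le> 0"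
    and c4: "deriv (S y) (V (y, t)) + S y (V (y, t)) / (2 * b * V (y, t)) \<le> a"
    and M: "V (y, t) \<le> M" and K: "K = b * (m - 1) * k" and \<kappa>: "\<kappa> = 2 * (M * K + a)"
    and F: "F = (\<lambda>z s. exp (- \<kappa> * s) * (V (z, s) powr (1 / b) * ginner G (\<lambda>x. V (x, s)) (\<lambda>x. V (x, s)) z) + \<Gamma> (V (z, s)))"
    and max: "\<And>z. z \<in> U \<Longrightarrow> F z t \<le> F y t"
  shows "\<exists>D. ((\<lambda>s. F y s) has_real_derivative D) (at t) \<and> D \<le> 0"
proof -
  define f where "f z = V (z, t)" for z
  define h where "h z = dirderiv (0, 1) V (z, t)" for z
  define W where "W = ginner G f f"
  define L where "L = wlap G \<phi> f y"
  define v where "v = f y"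
  define \<beta> where "\<beta> = 1 / b"
  define e where "e = exp (- \<kappa> * t)"
  define G1 where "G1 = deriv \<Gamma> v"
  define G2 where "G2 = deriv (deriv \<Gamma>) v"
  define P0 where "P0 = v powr \<beta>"
  define P1 where "P1 = v powr (\<beta> - 1)"
  define P2 where "P2 = v powr (\<beta> - 2)"
  define tr where "tr = (\<Sum>i k. hess_raised G f i k y * hess_raised G f k i y)"
  define R where "R = (\<Sum>i j. (ric G i j y + hess G \<phi> i j y) * grad G f i y * grad G f j y)"
  note fold_f = f_def[abs_def, symmetric]
  have o: "open (U \<times> J)" using open_U J by (simp add: open_Times)
  have f: "smooth_on U f" unfolding f_def[abs_def] by (rule smooth_on_slice[OF open_U J(1) V J(2)])
  have f_pos: "f z > 0" if "z \<in> U" for z using V_pos[OF that J(2)] by (simp add: f_def)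
  have v: "v > 0" using f_pos[OF y] by (simp add: v_def)
  have e: "e > 0" by (simp add: e_def)
  have P0: "P0 > 0" using v by (simp add: P0_def)
  have P1: "P1 = P0 / v" using v by (simp add: P0_def P1_def powr_diff)
  have P2: "P2 = P0 / (v * v)" using v by (simp add: P0_def P2_def powr_diff powr_numeral power2_eq_square)
  have W: "smooth_on U W" unfolding W_def by (rule smooth_inner[OF f f])
  have w_W: "w = W y" unfolding w fold_f W_def ..
  have w0: "w \<ge> 0" unfolding w_W W_def by (rule inner_nonneg[OF y])
  have f\<beta>: "smooth_on U (\<lambda>z. f z powr \<beta>)" by (rule smooth_on_powr[OF open_U f f_pos])
  have \<Gamma>f: "Ck_on 2 U (\<lambda>z. \<Gamma> (f z))"
    by (rule Ck_on_compose_real[OF open_U open_greaterThan _ \<Gamma> smooth_on_Ck[OF f]]) (simp add: f_pos)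
  have prod: "smooth_on U (\<lambda>z. f z powr \<beta> * W z)" by (rule smooth_on_mult[OF open_U f\<beta> W])
  have eprod: "smooth_on U (\<lambda>z. e * (f z powr \<beta> * W z))" by (intro smooth_on_mult smooth_on_const open_U f\<beta> W)
  have Ft: "F z t = e * (f z powr \<beta> * W z) + \<Gamma> (f z)" for z
    by (simp add: F e_def f_def[abs_def] W_def \<beta>_def)
  have FC2: "Ck_on 2 U (\<lambda>z. e * (f z powr \<beta> * W z) + \<Gamma> (f z))"
    by (rule Ck_on_add[OF open_U smooth_on_Ck[OF eprod] \<Gamma>f])
  note at_max = wlap_nonpos_at_max[OF FC2 y max[unfolded Ft]]
  have dpowr: "deriv (\<lambda>x. x powr \<beta>) v = \<beta> * P1" "deriv (deriv (\<lambda>x. x powr \<beta>)) v = \<beta> * (\<beta> - 1) * P2"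
    using deriv_powr[OF v, of \<beta>] by (simp_all add: P1_def P2_def)
  have p\<beta>: "pd i (\<lambda>z. f z powr \<beta>) y = \<beta> * P1 * pd i f y" for i
    unfolding dpowr(1)[symmetric] v_def
    by (rule pd_pd_compose_real(1)[OF open_U open_greaterThan Ck_on_powr f _ y]) (simp add: f_pos)
  have p\<Gamma>: "pd i (\<lambda>z. \<Gamma> (f z)) y = G1 * pd i f y" for i
    unfolding G1_def v_def by (rule pd_pd_compose_real(1)[OF open_U open_greaterThan \<Gamma> f _ y]) (simp add: f_pos)
  have pW: "pd i W y = 2 * (\<Sum>l. hess G f i l y * grad G f l y)" for i
    unfolding W_def pd_inner[OF f f y] by simp
  have critical: "e * (\<beta> * P1 * w * pd i f y + P0 * pd i W y) + G1 * pd i f y = 0" for i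
  proof -
    have "pd i (\<lambda>z. f z powr \<beta> * W z) y = \<beta> * P1 * pd i f y * W y + P0 * pd i W y"
      using pd_mult[OF diffable[OF f\<beta> y] diffable[OF W y]] by (simp add: p\<beta> P0_def v_def)
    moreover have "pd i (\<lambda>z. e * (f z powr \<beta> * W z) + \<Gamma> (f z)) y
      = e * pd i (\<lambda>z. f z powr \<beta> * W z) y + pd i (\<lambda>z. \<Gamma> (f z)) y"
      using pd_add[OF diffable[OF eprod y] C2_diffable(1)[OF \<Gamma>f y]] pd_cmult[OF diffable[OF prod y]] by simp
    ultimately show ?thesis using at_max(1)[of i] by (simp add: p\<Gamma> w_W algebra_simps)
  qed
  have inner_\<beta>W: "ginner G (\<lambda>z. f z powr \<beta>) W y = \<beta> * P1 * ginner G f W y"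
    using ginner_eqI[of "\<lambda>z. f z powr \<beta>" y "\<beta> * P1" f 0 f W] p\<beta> inner_sym[OF y] by simp
  have lap: "e * (w * (\<beta> * P1 * L + \<beta> * (\<beta> - 1) * P2 * w) + P0 * wlap G \<phi> W y + 2 * (\<beta> * P1 * ginner G f W y))
    + G1 * L + G2 * w \<le> 0"
  proof -
    have "wlap G \<phi> (\<lambda>z. f z powr \<beta>) y = \<beta> * P1 * L + \<beta> * (\<beta> - 1) * P2 * w"
      unfolding dpowr[symmetric] v_def L_def w_W W_def
      by (rule wlap_compose_real[OF open_greaterThan Ck_on_powr f _ y]) (simp add: f_pos)
    moreover have "wlap G \<phi> (\<lambda>z. \<Gamma> (f z)) y = G1 * L + G2 * w"
      unfolding G1_def G2_def v_def L_def w_W W_def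
      by (rule wlap_compose_real[OF open_greaterThan \<Gamma> f _ y]) (simp add: f_pos)
    ultimately show ?thesis
      using at_max(2)[of \<phi>] wlap_add[OF smooth_on_Ck[OF eprod] \<Gamma>f y, of \<phi>] wlap_cmult[OF smooth_on_Ck[OF prod] y, of \<phi> e]
        wlap_mult[OF smooth_on_Ck[OF f\<beta>] smooth_on_Ck[OF W] y, of \<phi>] inner_\<beta>W
      by (simp add: w_W P0_def v_def)
  qed
  have bochner_W: "wlap G \<phi> W y = 2 * (ginner G f (wlap G \<phi> f) y + (tr + R))"
    using weighted_bochner[OF \<phi> f y] wlap_cmult[OF smooth_on_Ck[OF W] y, of \<phi> "1/2"]
    by (simp add: W_def tr_def R_def)
  have h_eq: "h z = b * f z * wlap G \<phi> f z + ginner G f f z + S z (f z)" if "z \<in> U" for z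
    using eq[OF that] by (simp add: h_def f_def[abs_def])
  have Vt: "h y = b * v * L + w + S y v"
    using h_eq[OF y] by (simp add: v_def L_def w_W W_def)
  have fVt: "ginner G f h y = b * (w * L + v * ginner G f (wlap G \<phi> f) y) + ginner G f W y
      + ginner G f (\<lambda>z. S z v) y + deriv (S y) v * w"
    using reaction_diffusion_gradient[of f \<phi> y h b S, OF f \<phi> y h_eq] S by (simp add: v_def f_def[of y] w_W W_def L_def)
  define D where "D = e * (- \<kappa> * P0 * w + \<beta> * P1 * w * h y + P0 * (2 * ginner G f h y)) + G1 * h y"
  have time: "((\<lambda>s. F y s) has_real_derivative D) (at t)"
  proof -
    have dV: "((\<lambda>s. V (y, s)) has_real_derivative h y) (at t)"
      unfolding h_def using smooth_on_differentiable[OF o V] y J by (intro dirderiv_slice(3)) simp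
    have dpow: "((\<lambda>x. x powr \<beta>) has_real_derivative \<beta> * P1) (at (V (y, t)))"
      using has_real_derivative_powr[OF v, of \<beta>] by (simp add: P1_def v_def f_def)
    have dG: "(\<Gamma> has_real_derivative G1) (at (V (y, t)))"
    proof -
      have "(\<Gamma> has_real_derivative dirderiv 1 \<Gamma> v) (at v)"
        using has_real_derivative_line[of \<Gamma> 0 v 1] \<Gamma> v
        by (auto simp: numeral_2_eq_2 Ck_on_Suc_open[OF open_greaterThan] simp del: Ck_on.simps)
      then show ?thesis using DERIV_imp_deriv unfolding G1_def by (fastforce simp: v_def f_def)
    qed
    have dexp: "((\<lambda>s. exp (- \<kappa> * s)) has_real_derivative - \<kappa> * e) (at t)"
      unfolding e_def by (auto intro!: derivative_eq_intros)
    have dW: "((\<lambda>s. ginner G (\<lambda>x. V (x, s)) (\<lambda>x. V (x, s)) y) has_real_derivative 2 * ginner G f h y) (at t)"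
      using inner_time_derivative[OF J V y] by (simp add: f_def[abs_def] h_def[abs_def])
    have "((\<lambda>s. F y s) has_real_derivative
      (- \<kappa> * e * (V (y, t) powr \<beta> * ginner G (\<lambda>x. V (x, t)) (\<lambda>x. V (x, t)) y)
        + (\<beta> * P1 * h y * ginner G (\<lambda>x. V (x, t)) (\<lambda>x. V (x, t)) y + 2 * ginner G f h y * V (y, t) powr \<beta>) * exp (- \<kappa> * t))
      + G1 * h y) (at t)"
      unfolding F \<beta>_def[symmetric]
      by (intro DERIV_add DERIV_mult dexp dW DERIV_chain2[OF dpow dV] DERIV_chain2[OF dG dV])
    moreover have "V (y, t) powr \<beta> = P0" "ginner G (\<lambda>x. V (x, t)) (\<lambda>x. V (x, t)) y = w"
      by (simp_all add: P0_def v_def f_def w)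
    ultimately show ?thesis by (simp add: D_def e_def algebra_simps)
  qed
  have "D \<le> 0"
  proof (cases "w = 0")
    case True
    have pf: "pd i f y = 0" for i
      using inner_pos[OF y, of i f] True unfolding w_W W_def by auto
    have grad0: "grad G f i y = 0" for i by (simp add: grad_def pf)
    have inner0: "ginner G f u y = 0" for u by (simp add: ginner_def grad0)
    have "R = 0" by (simp add: R_def grad0)
    then have "e * P0 * (2 * tr) + G1 * L \<le> 0" using lap unfolding bochner_W True inner0 by simp
    moreover have "e * P0 * (2 * tr) \<ge> 0"
      using trace_hess_raised_square_nonneg[OF f y] e P0 by (simp add: tr_def)
    ultimately have "G1 * L \<le> 0" by linarith
    then have "b * v * (G1 * L) \<le> 0" using b v by (simp add: mult_nonneg_nonpos)
    moreover have "D = b * v * (G1 * L) + G1 * S y v"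
      unfolding D_def inner0 True Vt by (simp add: algebra_simps)
    moreover have "G1 * S y v \<le> 0" using c1 by (simp add: G1_def v_def f_def)
    ultimately show ?thesis by linarith
  next
    case False
    with w0 have wpos: "w > 0" by simp
    \<comment> \<open>This value solves the critical point equation in the direction of \<open>\<nabla>v\<close>.\<close>
    define \<mu> where "\<mu> = - (G1 / e + \<beta> * P1 * w) / (2 * P0)"
    have mu: "e * (\<beta> * P1 * w + 2 * P0 * \<mu>) + G1 = 0"
      using e P0 by (simp add: \<mu>_def field_simps)
    have eigen: "(\<Sum>l. hess G f i l y * grad G f l y) = \<mu> * pd i f y" for i
    proof -
      let ?H = "\<Sum>l. hess G f i l y * grad G f l y"
      have "e * (\<beta> * P1 * w * pd i f y + P0 * (2 * ?H)) + G1 * pd i f y = 0"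
        using critical[of i] unfolding pW .
      moreover have "e * (\<beta> * P1 * w + 2 * P0 * \<mu>) * pd i f y + G1 * pd i f y = 0"
        using mu by (simp flip: distrib_right)
      moreover have "2 * (e * P0 * (?H - \<mu> * pd i f y))
        = (e * (\<beta> * P1 * w * pd i f y + P0 * (2 * ?H)) + G1 * pd i f y)
          - (e * (\<beta> * P1 * w + 2 * P0 * \<mu>) * pd i f y + G1 * pd i f y)" by (simp add: algebra_simps)
      ultimately have "e * P0 * (?H - \<mu> * pd i f y) = 0" by simp
      then show ?thesis using e P0 by simp
    qed
    have fW: "ginner G f W y = 2 * \<mu> * w"
    proof -
      have "w = (\<Sum>k. grad G f k y * pd k f y)" by (simp add: w_W W_def ginner_def)
      then show ?thesis
        unfolding ginner_def[of G f W] pW eigen by (simp add: sum_distrib_left mult_ac)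
    qed
    have "\<mu>\<^sup>2 + (L - \<mu>)\<^sup>2 / (m - 1) \<le> tr + (if m = real CARD('n) then 0 else q\<^sup>2 / (m - real CARD('n)))"
      unfolding L_def tr_def using wpos q
      by (intro hess_trace_bound[OF f y eigen _ n]) (simp_all add: w_W W_def f_def[abs_def])
    moreover have "(if m = real CARD('n) then 0 else q\<^sup>2 / (m - real CARD('n))) - (m - 1) * k * w \<le> R"
      using ric by (simp add: R_def f_def[abs_def])
    ultimately have Q: "\<mu>\<^sup>2 + (L - \<mu>)\<^sup>2 / (m - 1) - (m - 1) * k * w \<le> tr + R" by linarith
    show ?thesis
    proof (rule maximum_point_inequality[OF b(1) v wpos e P0 _ k P1 P2 Vt _ refl _ _ _ Q _ _ _ _ \<kappa> _ K b(2)])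
      show "m > 1" using n by simp
      show "ginner G f h y = b * (w * L + v * ginner G f (wlap G \<phi> f) y) + 2 * \<mu> * w
        + ginner G f (\<lambda>z. S z v) y + deriv (S y) v * w" using fVt fW by simp
      show "e * (w * (1 / b * P1 * L + 1 / b * (1 / b - 1) * P2 * w)
        + P0 * (2 * (ginner G f (wlap G \<phi> f) y + (tr + R))) + 4 * (1 / b) * P1 * \<mu> * w) + G1 * L + G2 * w \<le> 0"
        using lap unfolding bochner_W fW \<beta>_def by (simp add: algebra_simps)
      show "D = e * (- \<kappa> * P0 * w + 1 / b * P1 * w * h y + P0 * (2 * ginner G f h y)) + G1 * h y"
        unfolding D_def \<beta>_def ..
      show "e * (1 / b * P1 * w + 2 * P0 * \<mu>) + G1 = 0" using mu unfolding \<beta>_def .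
      show "G1 * S y v \<le> 0" using c1 by (simp add: G1_def v_def f_def)
      show "0 \<le> G1 + v * G2" using c2 by (simp add: G1_def G2_def v_def f_def)
      show "ginner G f (\<lambda>z. S z v) y \<le> 0" using c3 by (simp add: v_def f_def[abs_def])
      show "deriv (S y) v + S y v / (2 * b * v) \<le> a" using c4 by (simp add: v_def f_def)
      show "v \<le> M" using M by (simp add: v_def f_def)
    qed
  qed
  with time show ?thesis by blast
qed

end

section \<open>Charts\<close>

context smooth_manifold
begin

lemma cdom_subset: "c \<in> A \<Longrightarrow> cdom c \<subseteq> topspace X"
  using cdom_open openin_subset by blast

lemma cinv_cmap: "c \<in> A \<Longrightarrow> x \<in> cdom c \<Longrightarrow> cinv c (cmap c x) = x"
  unfolding cinv_def
  using homeomorphic_imp_injective_map[OF chart_homeomorphic[of c]] cdom_subset[of c]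
  by (intro inv_into_f_f) (auto simp: Int_absorb1)

lemma cmap_cinv: "y \<in> crange c \<Longrightarrow> cmap c (cinv c y) = y"
  unfolding cinv_def by (simp add: f_inv_into_f)

lemma cinv_cdom: "y \<in> crange c \<Longrightarrow> cinv c y \<in> cdom c"
  unfolding cinv_def by (simp add: inv_into_into)

lemma cinv_topspace: "c \<in> A \<Longrightarrow> y \<in> crange c \<Longrightarrow> cinv c y \<in> topspace X"
  using cinv_cdom[of y c] cdom_subset[of c] by (simp add: subset_iff)

lemma chart_at:
  assumes "x \<in> topspace X"
  shows "chart_at A x \<in> A" "x \<in> cdom (chart_at A x)"
proof -
  have "\<exists>c. c \<in> A \<and> x \<in> cdom c" using assms charts_cover by blast
  from someI_ex[OF this] show "chart_at A x \<in> A" "x \<in> cdom (chart_at A x)"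
    unfolding chart_at_def by auto
qed

lemma overlap_open:
  assumes "c \<in> A" "d \<in> A"
  shows "open (cmap c ` (cdom c \<inter> cdom d))"
proof -
  have "openin (subtopology X (cdom c)) (cdom c \<inter> cdom d)"
    using cdom_open[OF assms(2)] by (auto simp: openin_subtopology)
  then have "openin (top_of_set (crange c)) (cmap c ` (cdom c \<inter> cdom d))"
    using homeomorphic_imp_open_map[OF chart_homeomorphic[OF assms(1)]] by (simp add: open_map_def)
  then show ?thesis using crange_open[OF assms(1)] by (simp add: openin_open_eq)
qed

lemma continuous_map_spacetime:
  assumes "\<And>c. c \<in> A \<Longrightarrow> continuous_on (crange c \<times> I) (\<lambda>(y, t). F (cinv c y) t)"
  shows "continuous_map (prod_topology X (top_of_set I)) euclideanreal (\<lambda>(x, t). F x t)"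
proof (rule pasting_lemma[where I = A and T = "\<lambda>c. cdom c \<times> I" and f = "\<lambda>c (x, t). F x t"])
  fix c assume c: "c \<in> A"
  show "openin (prod_topology X (top_of_set I)) (cdom c \<times> I)"
    using cdom_open[OF c] by (simp add: openin_prod_Times_iff)
  have top: "subtopology (prod_topology X (top_of_set I)) (cdom c \<times> I)
    = prod_topology (subtopology X (cdom c)) (top_of_set I)"
    by (simp add: subtopology_Times subtopology_subtopology)
  have "continuous_map (prod_topology (subtopology X (cdom c)) (top_of_set I))
      (prod_topology (top_of_set (crange c)) (top_of_set I)) (\<lambda>(x, t). (cmap c x, t))"
    unfolding continuous_map_prod_top
    using homeomorphic_imp_continuous_map[OF chart_homeomorphic[OF c]] by simp
  moreover have "continuous_map (prod_topology (top_of_set (crange c)) (top_of_set I)) euclideanreal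
      (\<lambda>(y, t). F (cinv c y) t)"
    using assms[OF c] by simp
  ultimately have "continuous_map (prod_topology (subtopology X (cdom c)) (top_of_set I)) euclideanreal
      ((\<lambda>(y, t). F (cinv c y) t) \<circ> (\<lambda>(x, t). (cmap c x, t)))"
    by (rule continuous_map_compose)
  then show "continuous_map (subtopology (prod_topology X (top_of_set I)) (cdom c \<times> I)) euclideanreal (\<lambda>(x, t). F x t)"
    unfolding top by (rule continuous_map_eq) (auto simp: cinv_cmap[OF c])
next
  show "\<exists>j. j \<in> A \<and> z \<in> cdom j \<times> I \<and> (case z of (x, t) \<Rightarrow> F x t) = (case z of (x, t) \<Rightarrow> F x t)"
    if "z \<in> topspace (prod_topology X (top_of_set I))" for z
    using that chart_at by (intro exI[of _ "chart_at A (fst z)"]) auto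
qed auto

end

context closed_manifold
begin

lemma spacetime_image_compact:
  assumes "continuous_map (prod_topology X (top_of_set I)) euclideanreal (\<lambda>(x, t). F x t)" "compact I"
  shows "compact ((\<lambda>(x, t). F x t) ` (topspace X \<times> I))"
proof -
  have "compact_space (prod_topology X (top_of_set I))"
    using compact assms(2) by (simp add: compact_space_prod_topology compact_space_subtopology)
  then have "compactin euclideanreal ((\<lambda>(x, t). F x t) ` topspace (prod_topology X (top_of_set I)))"
    using assms(1) unfolding compact_space_def by (rule image_compactin)
  then show ?thesis by simp
qed

lemma spacetime_attains_max:
  assumes "continuous_map (prod_topology X (top_of_set I)) euclideanreal (\<lambda>(x, t). F x t)"
    and "compact I" "I \<noteq> {}" "topspace X \<noteq> {}"
  shows "\<exists>x\<in>topspace X. \<exists>t\<in>I. \<forall>z\<in>topspace X. \<forall>s\<in>I. F z s \<le> F x t"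
proof -
  obtain r where r: "r \<in> (\<lambda>(x, t). F x t) ` (topspace X \<times> I)"
    "\<forall>s\<in>(\<lambda>(x, t). F x t) ` (topspace X \<times> I). s \<le> r"
    using compact_attains_sup[OF spacetime_image_compact[OF assms(1,2)]] assms(3,4) by auto
  then obtain x t where "x \<in> topspace X" "t \<in> I" "r = F x t" by auto
  with r(2) show ?thesis by (intro bexI[of _ x] bexI[of _ t]) auto
qed

text \<open>
  Subtracting \<open>\<epsilon> t\<close> makes the time derivative strictly negative at a maximum over earlier times, so that
  the maximum is attained at time zero. Only times in the open interval are used in the
  hypothesis; the final time is reached by continuity.
\<close>

lemma parabolic_maximum_principle:
  assumes cont: "continuous_map (prod_topology X (top_of_set {0..T})) euclideanreal (\<lambda>(x, t). F x t)"
    and step: "\<And>x t. x \<in> topspace X \<Longrightarrow> 0 < t \<Longrightarrow> t < T \<Longrightarrow> (\<And>z. z \<in> topspace X \<Longrightarrow> F z t \<le> F x t)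
      \<Longrightarrow> \<exists>D. ((\<lambda>s. F x s) has_real_derivative D) (at t) \<and> D \<le> 0"
    and R: "\<And>z. z \<in> topspace X \<Longrightarrow> F z 0 \<le> R"
    and x: "x \<in> topspace X" and t: "0 \<le> t" "t \<le> T"
  shows "F x t \<le> R"
proof -
  have before: "F x t \<le> R + \<epsilon> * t" if t: "0 < t" "t < T" and \<epsilon>: "\<epsilon> > 0" for t \<epsilon>
  proof -
    have sub: "continuous_map (prod_topology X (top_of_set {0..t})) euclideanreal (\<lambda>(x, s). F x s)"
      using continuous_map_from_subtopology[OF cont, of "topspace X \<times> {0..t}"] t
      by (simp add: subtopology_Times subtopology_subtopology min_def inf_min)
    have "continuous_map (prod_topology X (top_of_set {0..t})) euclideanreal
        (\<lambda>p. (case p of (x, s) \<Rightarrow> F x s) - \<epsilon> * snd p)"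
    proof (intro continuous_map_diff sub)
      have "continuous_map (top_of_set {0..t}) euclideanreal (\<lambda>s. \<epsilon> * s)" by (auto intro!: continuous_intros)
      from continuous_map_compose[OF continuous_map_snd this]
      show "continuous_map (prod_topology X (top_of_set {0..t})) euclideanreal (\<lambda>p. \<epsilon> * snd p)"
        by (simp add: o_def)
    qed
    then have "continuous_map (prod_topology X (top_of_set {0..t})) euclideanreal (\<lambda>(x, s). F x s - \<epsilon> * s)"
      by (simp add: case_prod_unfold)
    moreover have "{0..t} \<noteq> {}" "topspace X \<noteq> {}" using x t by (simp, blast)
    ultimately have "\<exists>y\<in>topspace X. \<exists>s\<in>{0..t}. \<forall>z\<in>topspace X. \<forall>r\<in>{0..t}. F z r - \<epsilon> * r \<le> F y s - \<epsilon> * s"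
      by (rule spacetime_attains_max[OF _ compact_Icc])
    then obtain y s where ys: "y \<in> topspace X" "s \<in> {0..t}"
      and max: "\<And>z r. z \<in> topspace X \<Longrightarrow> r \<in> {0..t} \<Longrightarrow> F z r - \<epsilon> * r \<le> F y s - \<epsilon> * s"
      by blast
    have "s = 0"
    proof (rule ccontr)
      assume "s \<noteq> 0"
      then have s: "0 < s" "s < T" using ys t by auto
      have "F z s \<le> F y s" if "z \<in> topspace X" for z using max[OF that ys(2)] by simp
      from step[OF ys(1) s this] obtain D where D: "((\<lambda>s. F y s) has_real_derivative D) (at s)" "D \<le> 0"
        by blast
      have "((\<lambda>s. F y s - \<epsilon> * s) has_real_derivative (D - \<epsilon>)) (at s)"
        using D(1) by (auto intro!: derivative_eq_intros)
      from DERIV_neg_dec_left[OF this] obtain d where d: "d > 0"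
        "\<And>h. 0 < h \<Longrightarrow> h < d \<Longrightarrow> F y s - \<epsilon> * s < F y (s - h) - \<epsilon> * (s - h)"
        using D(2) \<epsilon> by auto
      have "F y s - \<epsilon> * s < F y (s - min (d/2) s) - \<epsilon> * (s - min (d/2) s)"
        using d s by auto
      moreover have "F y (s - min (d/2) s) - \<epsilon> * (s - min (d/2) s) \<le> F y s - \<epsilon> * s"
        using max[OF ys(1), of "s - min (d/2) s"] d(1) s ys(2) by auto
      ultimately show False by simp
    qed
    then have "F x t - \<epsilon> * t \<le> F y 0" using max[OF x, of t] t by simp
    with R[OF ys(1)] show ?thesis by simp
  qed
  have inner: "F x t \<le> R" if t: "0 < t" "t < T" for t
  proof (rule field_le_epsilon)
    fix e :: real assume "e > 0"
    with before[OF t, of "e / t"] t show "F x t \<le> R + e" by simp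
  qed
  show ?thesis
  proof (cases "t = 0 \<or> t < T")
    case True
    then show ?thesis using R[OF x] inner[of t] t by force
  next
    case False
    then have T: "t = T" "T > 0" using t by auto
    have "continuous_map (top_of_set {0..T}) (prod_topology X (top_of_set {0..T})) (\<lambda>s. (x, s))"
      by (intro continuous_map_pairedI) (simp_all add: x)
    from continuous_map_compose[OF this cont] have "continuous_on {0..T} (F x)" by (simp add: o_def)
    then have "(F x \<longlongrightarrow> F x T) (at T within {0..T})" using T by (simp add: continuous_on_def)
    then have lim: "(F x \<longlongrightarrow> F x T) (at_left T)"
      using T by (simp add: at_within_Icc_at_left)
    have "eventually (\<lambda>s. F x s \<le> R) (at_left T)"
      using eventually_at_left_real[OF T(2)] by eventually_elim (simp add: inner)
    with lim have "F x T \<le> R" by (rule tendsto_upperbound) simp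
    then show ?thesis using T by simp
  qed
qed

end

section \<open>Intrinsic quantities in charts\<close>

lemma christoffel_eq: "christoffel g c k i j = chr (g c) k i j"
  by (simp add: fun_eq_iff christoffel_def chr_def ginv_def)

lemma ricci_eq: "ricci g c y $ j $ k = ric (g c) j k y"
  by (simp add: ricci_def riemann_def ric_def christoffel_eq)

lemma hessian_eq: "hessian g f c y $ i $ j = hess (g c) (\<lambda>z. f (cinv c z)) i j y"
  by (simp add: hessian_def hess_def christoffel_eq Let_def)

lemma gradient_eq: "gradient g f c y $ k = grad (g c) (\<lambda>z. f (cinv c z)) k y"
  by (simp add: gradient_def differential_def grad_def ginv_def matrix_vector_mult_def)

context riemannian_manifold
begin

lemma coordinate_metric_subset:
  assumes "c \<in> A" "open U" "U \<subseteq> crange c"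
  shows "coordinate_metric U (g c)"
proof
  show "smooth_on U (\<lambda>y. g c y $ i $ j)" for i j
    using smooth_on_open_subset[OF assms(2,3) metric_smooth[OF assms(1)]] .
  show "g c y $ i $ j = g c y $ j $ i" if "y \<in> U" for y i j
    using metric_symmetric[OF assms(1), of y] that assms(3)
    by (metis (no_types, lifting) subsetD transpose_def vec_lambda_beta)
  show "0 < \<xi> \<bullet> (g c y *v \<xi>)" if "y \<in> U" "\<xi> \<noteq> 0" for y \<xi>
    using metric_positive[OF assms(1)] that assms(3) by blast
qed (rule assms(2))

lemma coordinate_metric: "c \<in> A \<Longrightarrow> coordinate_metric (crange c) (g c)"
  by (rule coordinate_metric_subset[OF _ crange_open]) auto

text \<open>
  Transition maps satisfy the assumptions of the abstract coordinate change by the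
  transformation law of the metric.
\<close>

lemma coordinate_change_charts:
  assumes "c \<in> A" "d \<in> A"
  shows "coordinate_change (cmap c ` (cdom c \<inter> cdom d)) (crange d) (g c) (g d) (transition c d)"
proof -
  let ?U = "cmap c ` (cdom c \<inter> cdom d)"
  interpret M1: coordinate_metric ?U "g c"
    by (rule coordinate_metric_subset[OF assms(1) overlap_open[OF assms]]) auto
  interpret M2: coordinate_metric "crange d" "g d" by (rule coordinate_metric[OF assms(2)])
  show ?thesis
  proof
    fix y assume y: "y \<in> ?U"
    then obtain x where x: "x \<in> cdom c \<inter> cdom d" "y = cmap c x" by blast
    have tx: "transition c d y = cmap d x" using x by (simp add: transition_def cinv_cmap[OF assms(1)])
    show "transition c d y \<in> crange d" unfolding tx using x by blast
    have "(transition c d has_derivative (\<lambda>h. \<chi> a. dirderiv h (\<lambda>z. transition c d z $ a) y)) (at y)"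
      by (rule has_derivative_components[OF M1.diffable[OF transition_smooth[OF assms] y]])
    then have J: "jacobian (transition c d) (at y) $ a $ i = pd i (\<lambda>z. transition c d z $ a) y" for a i
      by (simp add: jacobian_def matrix_def pd_dirderiv flip: frechet_derivative_at)
    show "g c y $ i $ j = (\<Sum>a b. pd i (\<lambda>z. transition c d z $ a) y * g d (transition c d y) $ a $ b
        * pd j (\<lambda>z. transition c d z $ b) y)" for i j
      using metric_transform[OF assms x(1)]
      by (simp add: Let_def tx matrix_triple_product flip: x(2)) (simp add: transpose_def J)
  qed (rule transition_smooth[OF assms])
qed

text \<open>
  The value of the inner product, which is defined in a chart chosen at the point, can be computed in any
  chart. It is stated for differentiable functions, since it is also used at the
  initial and final times.
\<close>

lemma grad_inner_chart:
  assumes c: "c \<in> A" "x \<in> cdom c"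
    and f: "\<And>e. e \<in> A \<Longrightarrow> x \<in> cdom e \<Longrightarrow> (\<lambda>z. f (cinv e z)) differentiable (at (cmap e x))"
    and h: "\<And>e. e \<in> A \<Longrightarrow> x \<in> cdom e \<Longrightarrow> (\<lambda>z. h (cinv e z)) differentiable (at (cmap e x))"
  shows "grad_inner A g f h x = ginner (g c) (\<lambda>z. f (cinv c z)) (\<lambda>z. h (cinv c z)) (cmap c x)"
proof -
  define d where "d = chart_at A x"
  have "x \<in> topspace X" using c cdom_subset by blast
  from chart_at[OF this] have d: "d \<in> A" "x \<in> cdom d" by (simp_all add: d_def)
  let ?U = "cmap c ` (cdom c \<inter> cdom d)" and ?y = "cmap d x"
  interpret C: coordinate_change ?U "crange d" "g c" "g d" "transition c d"
    by (rule coordinate_change_charts[OF c(1) d(1)])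
  have y: "?y \<in> crange d" and cx: "cmap c x \<in> ?U" using c d by auto
  have tx: "transition c d (cmap c x) = ?y" by (simp add: transition_def cinv_cmap[OF c])
  have "grad_inner A g f h x = (\<Sum>k. grad (g d) (\<lambda>z. f (cinv d z)) k ?y *
      (\<Sum>q. g d ?y $ k $ q * grad (g d) (\<lambda>z. h (cinv d z)) q ?y))"
    by (simp add: grad_inner_def Let_def inner_vec_def gradient_eq matrix_vector_mult_def flip: d_def)
  also have "\<dots> = ginner (g d) (\<lambda>z. f (cinv d z)) (\<lambda>z. h (cinv d z)) ?y"
    unfolding grad_def[of _ "\<lambda>z. h (cinv d z)"] C.M2.lower_raise[OF y] ginner_def ..
  also have "\<dots> = ginner (g c) (\<lambda>z. f (cinv d (transition c d z))) (\<lambda>z. h (cinv d (transition c d z))) (cmap c x)"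
    using C.inner_pullback[of "\<lambda>z. f (cinv d z)" "cmap c x" "\<lambda>z. h (cinv d z)"] f[OF d] h[OF d] cx by (simp add: tx)
  also have "\<dots> = ginner (g c) (\<lambda>z. f (cinv c z)) (\<lambda>z. h (cinv c z)) (cmap c x)"
    by (rule C.M1.ginner_cong[OF cx]) (auto simp: transition_def cinv_cmap c d)
  finally show ?thesis .
qed

text \<open>
  With a chart that is fixed near a point, the Laplacian becomes a
  function of the coordinates that can be differentiated.
\<close>

lemma laplace_beltrami_chart:
  assumes c: "c \<in> A" "x \<in> cdom c" and f: "smooth_function A f"
  shows "laplace_beltrami A g f x = lap (g c) (\<lambda>z. f (cinv c z)) (cmap c x)"
proof -
  define d where "d = chart_at A x"
  have "x \<in> topspace X" using c cdom_subset by blast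
  from chart_at[OF this] have d: "d \<in> A" "x \<in> cdom d" by (simp_all add: d_def)
  let ?U = "cmap c ` (cdom c \<inter> cdom d)" and ?y = "cmap d x"
  interpret C: coordinate_change ?U "crange d" "g c" "g d" "transition c d"
    by (rule coordinate_change_charts[OF c(1) d(1)])
  have y: "?y \<in> crange d" and cx: "cmap c x \<in> ?U" using c d by auto
  have tx: "transition c d (cmap c x) = ?y" by (simp add: transition_def cinv_cmap[OF c])
  have fd: "smooth_on (crange d) (\<lambda>z. f (cinv d z))" and fc: "smooth_on (crange c) (\<lambda>z. f (cinv c z))"
    using f c d by (auto simp: smooth_function_def)
  have eq: "f (cinv d (transition c d z)) = f (cinv c z)" if "z \<in> ?U" for z
    using that by (auto simp: transition_def cinv_cmap c d)
  have f\<tau>: "smooth_on ?U (\<lambda>z. f (cinv d (transition c d z)))"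
    by (rule smooth_on_cong[THEN iffD1, OF C.M1.open_U _ smooth_on_open_subset[OF C.M1.open_U _ fc]])
      (use eq in auto)
  have "laplace_beltrami A g f x = (\<Sum>i l. ginv (g d) i l ?y * hess (g d) (\<lambda>z. f (cinv d z)) l i ?y)"
    by (simp add: laplace_beltrami_def Let_def trace_def matrix_matrix_mult_def hessian_eq ginv_def flip: d_def)
  also have "\<dots> = lap (g d) (\<lambda>z. f (cinv d z)) ?y"
    unfolding lap_def by (simp add: C.M2.hess_sym[OF fd y])
  also have "\<dots> = lap (g c) (\<lambda>z. f (cinv d (transition c d z))) (cmap c x)"
    using C.lap_pullback[OF fd f\<tau> cx] by (simp add: tx)
  also have "\<dots> = lap (g c) (\<lambda>z. f (cinv c z)) (cmap c x)"
    by (rule C.M1.lap_cong[OF cx eq])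
  finally show ?thesis .
qed

lemma smooth_function_differentiable:
  assumes "smooth_function A f" "e \<in> A" "x \<in> cdom e"
  shows "(\<lambda>z. f (cinv e z)) differentiable (at (cmap e x))"
  using assms by (intro smooth_on_differentiable[OF crange_open]) (auto simp: smooth_function_def)

lemma weighted_laplacian_chart:
  assumes c: "c \<in> A" "x \<in> cdom c" and \<phi>: "smooth_function A \<phi>" and f: "smooth_function A f"
  shows "weighted_laplacian A g \<phi> f x
    = wlap (g c) (\<lambda>z. \<phi> (cinv c z)) (\<lambda>z. f (cinv c z)) (cmap c x)"
  unfolding weighted_laplacian_def wlap_def laplace_beltrami_chart[OF c f]
  using grad_inner_chart[OF c] smooth_function_differentiable \<phi> f by simp

end

section \<open>Space-time regularity\<close>

text \<open>
  A space derivative at a time in \<open>I\<close>, possibly an end point, is a component of the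
  derivative within the cylinder and inherits its continuity.
\<close>

lemma spacetime_slice_derivative:
  fixes f :: "(real^'n::finite) \<times> real \<Rightarrow> real"
  assumes U: "open U" "y \<in> U" and t: "t \<in> I" and f: "f differentiable (at (y, t) within U \<times> I)"
  shows "(\<lambda>z. f (z, t)) differentiable (at y)"
    and "pd i (\<lambda>z. f (z, t)) y = frechet_derivative f (at (y, t) within U \<times> I) (axis i 1, 0)"
proof -
  have "((\<lambda>z. (z, t)) has_derivative (\<lambda>h. (h, 0))) (at y within U)"
    by (rule has_derivative_Pair[OF has_derivative_ident has_derivative_const])
  moreover have "(f has_derivative frechet_derivative f (at (y, t) within U \<times> I)) (at (y, t) within (\<lambda>z. (z, t)) ` U)"
    using f[unfolded frechet_derivative_works] by (rule has_derivative_subset) (use t in auto)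
  ultimately have "((\<lambda>z. f (z, t)) has_derivative (\<lambda>h. frechet_derivative f (at (y, t) within U \<times> I) (h, 0))) (at y within U)"
    by (rule has_derivative_in_compose)
  then have d: "((\<lambda>z. f (z, t)) has_derivative (\<lambda>h. frechet_derivative f (at (y, t) within U \<times> I) (h, 0))) (at y)"
    by (simp add: at_within_open[OF U(2,1)])
  show "(\<lambda>z. f (z, t)) differentiable (at y)" using d by (rule differentiableI)
  show "pd i (\<lambda>z. f (z, t)) y = frechet_derivative f (at (y, t) within U \<times> I) (axis i 1, 0)"
    unfolding pd_dirderiv by (rule dirderiv_eqI[OF d])
qed

section \<open>The pressure equation\<close>

text \<open>
  The identities for \<open>v = p/(p-1) u^(p-1)\<close> that turn the equation for \<open>u\<close> into that for \<open>v\<close>.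
  Here \<open>u^p = h(v)\<close> with \<open>h(r) = C r^\<alpha>\<close>, and the third and fourth identities say that the factor \<open>p u^(p-2)\<close>
  of \<open>\<partial>_t u\<close> multiplies \<open>h'(v)\<close> to \<open>(p - 1) v\<close> and \<open>h''(v)\<close> to \<open>1\<close>.
\<close>

lemma porous_medium_powers:
  fixes u p v :: real
  assumes u: "u > 0" and p: "p > 1" and v: "v = p / (p - 1) * u powr (p - 1)"
  defines "\<alpha> \<equiv> p / (p - 1)" and "C \<equiv> ((p - 1) / p) powr (p / (p - 1))"
  shows "v > 0" "u powr p = C * v powr \<alpha>"
    "p * u powr (p - 2) * (C * (\<alpha> * v powr (\<alpha> - 1))) = (p - 1) * v"
    "p * u powr (p - 2) * (C * (\<alpha> * (\<alpha> - 1) * v powr (\<alpha> - 2))) = 1"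
    "((p - 1) * v / p) powr (1 / (p - 1)) = u"
    "((p - 1) * v / p) powr ((p - 2) / (p - 1)) = u powr (p - 2)"
proof -
  show v0: "v > 0" using u p by (simp add: v)
  have e: "(p - 1) * v / p = u powr (p - 1)" using p by (simp add: v)
  show "((p - 1) * v / p) powr (1 / (p - 1)) = u" "((p - 1) * v / p) powr ((p - 2) / (p - 1)) = u powr (p - 2)"
    unfolding e using u p by (simp_all add: powr_powr)
  have "C * v powr \<alpha> = ((p - 1) / p * v) powr \<alpha>"
    unfolding C_def \<alpha>_def using p v0 by (subst powr_mult) auto
  also have "\<dots> = (u powr (p - 1)) powr \<alpha>" using e by simp
  also have "\<dots> = u powr p" using p by (simp add: powr_powr \<alpha>_def)
  finally show up: "u powr p = C * v powr \<alpha>" by simp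
  have prod: "u powr (p - 2) * u powr p = (u powr (p - 1)) * (u powr (p - 1))"
    by (simp flip: powr_add)
  have prod': "u powr (p - 2) * (C * v powr \<alpha>) = ((p - 1) * v / p) * ((p - 1) * v / p)"
    unfolding up[symmetric] prod e ..
  have "p * u powr (p - 2) * (C * (\<alpha> * v powr (\<alpha> - 1))) = p * \<alpha> / v * (u powr (p - 2) * (C * v powr \<alpha>))"
    using v0 by (simp add: powr_diff[of v])
  also have "\<dots> = (p - 1) * v" unfolding prod' unfolding \<alpha>_def using p v0 by (simp add: field_simps)
  finally show "p * u powr (p - 2) * (C * (\<alpha> * v powr (\<alpha> - 1))) = (p - 1) * v" .
  have "p * u powr (p - 2) * (C * (\<alpha> * (\<alpha> - 1) * v powr (\<alpha> - 2)))
    = p * \<alpha> * (\<alpha> - 1) / (v * v) * (u powr (p - 2) * (C * v powr \<alpha>))"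
    using v0 by (simp add: powr_diff[of v] powr_numeral power2_eq_square)
  also have "\<dots> = p * \<alpha> * (\<alpha> - 1) * ((p - 1) / p * ((p - 1) / p))" unfolding prod' using v0 by simp
  also have "\<dots> = 1"
  proof -
    have "\<alpha> - 1 = 1 / (p - 1)" using p by (simp add: \<alpha>_def field_simps)
    then show ?thesis using p by (simp add: \<alpha>_def)
  qed
  finally show "p * u powr (p - 2) * (C * (\<alpha> * (\<alpha> - 1) * v powr (\<alpha> - 2))) = 1" .
qed

context riemannian_manifold
begin

lemma spacetime_regularity:
  assumes u: "smooth_spacetime A T u" and c: "c \<in> A"
  shows "continuous_on (crange c \<times> {0..T}) (\<lambda>(y, t). u (cinv c y) t)"
    and "y \<in> crange c \<Longrightarrow> t \<in> {0..T} \<Longrightarrow> (\<lambda>z. u (cinv c z) t) differentiable (at y)"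
    and "continuous_on (crange c \<times> {0..T}) (\<lambda>(y, t). pd i (\<lambda>z. u (cinv c z) t) y)"
proof -
  let ?D = "crange c \<times> {0..T}"
  define f where "f = (\<lambda>(y, t). u (cinv c y) t)"
  have C1: "Ck_on 1 ?D f" and C0: "Ck_on 0 ?D f"
    using u c unfolding smooth_spacetime_def smooth_on_def f_def by blast+
  have d: "f differentiable (at (y, t) within ?D)" if "y \<in> crange c" "t \<in> {0..T}" for y t
  proof -
    have "f differentiable_on ?D" using C1 by simp
    then show ?thesis using that unfolding differentiable_on_def by blast
  qed
  have f: "f (z, t) = u (cinv c z) t" for z t by (simp add: f_def)
  note slice = spacetime_slice_derivative[OF crange_open[OF c] _ _ d, unfolded f]
  show "continuous_on ?D (\<lambda>(y, t). u (cinv c y) t)" using C0 by (simp add: f_def)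
  show "(\<lambda>z. u (cinv c z) t) differentiable (at y)" if "y \<in> crange c" "t \<in> {0..T}"
    using slice(1) that by blast
  have "continuous_on ?D (\<lambda>q. frechet_derivative f (at q within ?D) (axis i 1, 0))"
  proof -
    have "(axis i (1::real), 0::real) \<in> Basis" by (rule Prod_Basis(1)[OF axis_Basis])
    then show ?thesis using C1 by simp
  qed
  then show "continuous_on ?D (\<lambda>(y, t). pd i (\<lambda>z. u (cinv c z) t) y)"
    by (rule continuous_on_cong[THEN iffD1, OF refl, rotated]) (use slice(2) in auto)
qed

lemma grad_inner_spacetime_continuous:
  assumes v_d: "\<And>c y t. c \<in> A \<Longrightarrow> y \<in> crange c \<Longrightarrow> t \<in> {0..T} \<Longrightarrow> (\<lambda>z. v (cinv c z) t) differentiable (at y)"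
    and v_pd: "\<And>c i. c \<in> A \<Longrightarrow> continuous_on (crange c \<times> {0..T}) (\<lambda>(y, t). pd i (\<lambda>z. v (cinv c z) t) y)"
    and c: "c \<in> A"
  shows "continuous_on (crange c \<times> {0..T}) (\<lambda>(y, t). grad_inner A g (\<lambda>z. v z t) (\<lambda>z. v z t) (cinv c y))"
    and "y \<in> crange c \<Longrightarrow> t \<in> {0..T} \<Longrightarrow> grad_inner A g (\<lambda>z. v z t) (\<lambda>z. v z t) (cinv c y)
      = ginner (g c) (\<lambda>z. v (cinv c z) t) (\<lambda>z. v (cinv c z) t) y"
proof -
  interpret M: coordinate_metric "crange c" "g c" by (rule coordinate_metric[OF c])
  have eq: "grad_inner A g (\<lambda>z. v z t) (\<lambda>z. v z t) (cinv c y)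
      = ginner (g c) (\<lambda>z. v (cinv c z) t) (\<lambda>z. v (cinv c z) t) y" if "y \<in> crange c" "t \<in> {0..T}" for y t
    using grad_inner_chart[OF c cinv_cdom[OF that(1)], of "\<lambda>z. v z t" "\<lambda>z. v z t"] v_d that
    by (simp add: cmap_cinv)
  then show "y \<in> crange c \<Longrightarrow> t \<in> {0..T} \<Longrightarrow> grad_inner A g (\<lambda>z. v z t) (\<lambda>z. v z t) (cinv c y)
      = ginner (g c) (\<lambda>z. v (cinv c z) t) (\<lambda>z. v (cinv c z) t) y" .
  have ginv: "continuous_on (crange c \<times> {0..T}) (\<lambda>q. ginv (g c) i j (fst q))" for i j
  proof -
    have "continuous_on (crange c) (ginv (g c) i j)" using smooth_on_Ck[OF M.smooth_ginv, of 0 i j] by simp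
    then show ?thesis
      by (rule continuous_on_compose2) (auto intro: continuous_on_fst continuous_on_id)
  qed
  have pd: "continuous_on (crange c \<times> {0..T}) (\<lambda>q. pd i (\<lambda>z. v (cinv c z) (snd q)) (fst q))" for i
    using v_pd[OF c] by (simp add: case_prod_unfold)
  have "continuous_on (crange c \<times> {0..T})
      (\<lambda>q. ginner (g c) (\<lambda>z. v (cinv c z) (snd q)) (\<lambda>z. v (cinv c z) (snd q)) (fst q))"
    unfolding M.inner_grad by (intro continuous_intros ginv pd)
  then show "continuous_on (crange c \<times> {0..T}) (\<lambda>(y, t). grad_inner A g (\<lambda>z. v z t) (\<lambda>z. v z t) (cinv c y))"
    by (rule continuous_on_cong[THEN iffD1, OF refl, rotated]) (auto simp: eq)
qed

lemma nonlinearity_differentiable: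
  assumes N: "C1_nonlinearity A T N" and c: "c \<in> A" and y: "y \<in> crange c" and t: "0 < t" "t < T"
    and r: "r > 0" and p: "p > 1"
  shows "(\<lambda>(z, w). p * ((p - 1) * w / p) powr \<alpha> * N t (cinv c z) (((p - 1) * w / p) powr \<gamma>)) differentiable (at (y, r))"
proof -
  let ?E = "{0<..<T} \<times> crange c \<times> {0::real<..}"
  let ?N = "\<lambda>(s, y, r). N s (cinv c y) r"
  have o: "open ?E" by (intro open_Times crange_open c open_greaterThanLessThan open_greaterThan)
  have "Ck_on 1 ?E ?N"
    using N c by (intro Ck_on_open_subset[OF o, of "{0..T} \<times> crange c \<times> {0<..}"]) (auto simp: C1_nonlinearity_def)
  then have dN: "?N differentiable (at q)" if "q \<in> ?E" for q
    using that unfolding One_nat_def Ck_on_Suc_open[OF o] by blast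
  have pw: "(\<lambda>q::(real^'n) \<times> real. ((p - 1) * snd q / p) powr \<alpha>) differentiable (at (y, r))" for \<alpha>
  proof -
    have "((\<lambda>w. ((p - 1) * w / p) powr \<alpha>) has_real_derivative \<alpha> * ((p - 1) * r / p) powr (\<alpha> - 1) * ((p - 1) / p)) (at r)"
      using r p by (auto intro!: derivative_eq_intros simp: divide_simps)
    then show ?thesis
      by (intro dirderiv_compose_real(2)[of snd "(y, r)" "\<lambda>w. ((p - 1) * w / p) powr \<alpha>"])
        (auto intro!: differentiableI has_derivative_snd[OF has_derivative_ident])
  qed
  let ?\<psi> = "\<lambda>q. (t, fst q, ((p - 1) * snd q / p) powr \<gamma>)"
  obtain P where P: "((\<lambda>q::(real^'n) \<times> real. ((p - 1) * snd q / p) powr \<gamma>) has_derivative P) (at (y, r))"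
    using pw[of \<gamma>] unfolding differentiable_def by blast
  have "?\<psi> differentiable (at (y, r))"
    by (rule differentiableI[OF has_derivative_Pair[OF has_derivative_const
          has_derivative_Pair[OF has_derivative_fst[OF has_derivative_ident] P]]])
  moreover have "?N differentiable (at (?\<psi> (y, r)))" using y t r p by (intro dN) simp
  ultimately have "(\<lambda>q. ?N (?\<psi> q)) differentiable (at (y, r))"
    unfolding differentiable_def using has_derivative_compose by blast
  then have "(\<lambda>q. p * ((p - 1) * snd q / p) powr \<alpha> * ?N (?\<psi> q)) differentiable (at (y, r))"
    by (intro differentiable_mult differentiable_const pw)
  then show ?thesis by (simp add: case_prod_unfold)
qed

lemma smooth_spacetime_interior:
  assumes u: "smooth_spacetime A T u" and c: "c \<in> A"
  shows "smooth_on (crange c \<times> {0<..<T}) (\<lambda>(y, s). u (cinv c y) s)"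
proof (rule smooth_on_open_subset)
  show "open (crange c \<times> {0<..<T})" by (intro open_Times crange_open c open_greaterThanLessThan)
  show "crange c \<times> {0<..<T} \<subseteq> crange c \<times> {0..T}" by (intro Sigma_mono) auto
  show "smooth_on (crange c \<times> {0..T}) (\<lambda>(y, s). u (cinv c y) s)"
    using u c unfolding smooth_spacetime_def by blast
qed

lemma smooth_function_slice:
  assumes u: "smooth_spacetime A T u" and t: "0 < t" "t < T"
  shows "smooth_function A (\<lambda>x. u x t)"
  unfolding smooth_function_def
proof
  fix c assume c: "c \<in> A"
  from smooth_on_slice[OF crange_open[OF c] _ smooth_spacetime_interior[OF u c], of t]
  show "smooth_on (crange c) (\<lambda>y. u (cinv c y) t)" using t by simp
qed

lemma smooth_function_powr:
  assumes f: "smooth_function A f" and pos: "\<And>x. x \<in> topspace X \<Longrightarrow> f x > 0"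
  shows "smooth_function A (\<lambda>x. C * f x powr \<alpha>)"
  unfolding smooth_function_def
proof
  fix c assume c: "c \<in> A"
  show "smooth_on (crange c) (\<lambda>y. C * f (cinv c y) powr \<alpha>)"
    using f c pos cinv_topspace[OF c]
    by (intro smooth_on_mult smooth_on_const smooth_on_powr crange_open) (auto simp: smooth_function_def)
qed

end

context metric_measure_space
begin

text \<open>
  By the chain rule \<open>\<Delta>_\<phi> u^p = h'(v) \<Delta>_\<phi> v + h''(v) |\<nabla>v|\<^sup>2\<close>, where \<open>u^p = h(v)\<close>; multiplication by
  \<open>p u^(p-2)\<close> gives the equation for the pressure.
\<close>

lemma pressure_equation:
  assumes p: "p > 1" and t: "0 < t" "t < T"
    and u_smooth: "smooth_spacetime A T u"
    and u_pos: "\<forall>x\<in>topspace X. \<forall>t\<in>{0..T}. u x t > 0"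
    and u_solution: "\<forall>x\<in>topspace X. \<forall>t\<in>{0..T}.
      ((\<lambda>s. u x s) has_real_derivative
         weighted_laplacian A g \<phi> (\<lambda>z. u z t powr p) x + N t x (u x t)) (at t within {0..T})"
    and v_eq: "\<And>x t. v x t = p / (p - 1) * u x t powr (p - 1)"
    and c: "c \<in> A" and z: "z \<in> crange c"
  defines "f \<equiv> \<lambda>z. v (cinv c z) t" and "\<psi> \<equiv> \<lambda>z. \<phi> (cinv c z)"
  shows "((\<lambda>s. v (cinv c z) s) has_real_derivative
      (p - 1) * f z * wlap (g c) \<psi> f z + ginner (g c) f f z
      + p * ((p - 1) * f z / p) powr ((p - 2) / (p - 1))
          * N t (cinv c z) (((p - 1) * f z / p) powr (1 / (p - 1)))) (at t)"
proof -
  interpret M: coordinate_metric "crange c" "g c" by (rule coordinate_metric[OF c])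
  define x where "x = cinv c z"
  have x: "x \<in> topspace X" "x \<in> cdom c" "cmap c x = z"
    using cinv_topspace[OF c z] cinv_cdom[OF z] cmap_cinv[OF z] by (simp_all add: x_def)
  have t_in: "t \<in> {0..T}" using t by simp
  note in_X = cinv_topspace[OF c]
  note powers = porous_medium_powers[OF _ p v_eq]
  have pos: "u x t > 0" if "x \<in> topspace X" for x using u_pos that t_in by blast
  have f_pos: "f z > 0" if "z \<in> crange c" for z
    unfolding f_def by (rule powers(1)[OF pos[OF in_X[OF that]]])
  have f_smooth: "smooth_on (crange c) f"
    using smooth_function_powr[OF smooth_function_slice[OF u_smooth t] pos, of "p / (p - 1)" "p - 1"] c
    unfolding smooth_function_def f_def v_eq by blast
  have up_smooth: "smooth_function A (\<lambda>z. u z t powr p)"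
    using smooth_function_powr[OF smooth_function_slice[OF u_smooth t] pos, of 1 p] by simp
  define Lu where "Lu = weighted_laplacian A g \<phi> (\<lambda>z. u z t powr p) x"
  have ut: "((\<lambda>s. u x s) has_real_derivative Lu + N t x (u x t)) (at t)"
    using bspec[OF bspec[OF u_solution x(1)] t_in] unfolding Lu_def at_within_Icc_at[OF t] .
  have "((\<lambda>s. p / (p - 1) * u x s powr (p - 1)) has_real_derivative
      p / (p - 1) * ((p - 1) * u x t powr (p - 1 - 1) * (Lu + N t x (u x t)))) (at t)"
    by (intro DERIV_cmult DERIV_chain2[OF has_real_derivative_powr[OF pos[OF x(1)]] ut])
  then have vt: "((\<lambda>s. v x s) has_real_derivative p * u x t powr (p - 2) * (Lu + N t x (u x t))) (at t)"
    using p by (simp add: v_eq mult.assoc)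
  define \<alpha> where "\<alpha> = p / (p - 1)"
  define C where "C = ((p - 1) / p) powr (p / (p - 1))"
  have f\<alpha>: "smooth_on (crange c) (\<lambda>z. f z powr \<alpha>)" by (rule smooth_on_powr[OF crange_open[OF c] f_smooth f_pos])
  have "Lu = wlap (g c) \<psi> (\<lambda>z. u (cinv c z) t powr p) z"
    using weighted_laplacian_chart[OF c x(2) weight_smooth up_smooth] by (simp add: Lu_def x(3) \<psi>_def)
  also have "\<dots> = wlap (g c) \<psi> (\<lambda>z. C * f z powr \<alpha>) z"
  proof -
    have pow_eq: "u (cinv c z) t powr p = C * f z powr \<alpha>" if "z \<in> crange c" for z
      using powers(2)[OF pos[OF in_X[OF that]]] by (simp add: f_def \<alpha>_def C_def)
    have "lap (g c) (\<lambda>z. u (cinv c z) t powr p) z = lap (g c) (\<lambda>z. C * f z powr \<alpha>) z"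
      by (rule M.lap_cong[OF z]) (rule pow_eq)
    moreover have "ginner (g c) \<psi> (\<lambda>z. u (cinv c z) t powr p) z = ginner (g c) \<psi> (\<lambda>z. C * f z powr \<alpha>) z"
      by (rule M.ginner_cong[OF z refl]) (rule pow_eq)
    ultimately show ?thesis by (simp add: wlap_def)
  qed
  also have "\<dots> = C * wlap (g c) \<psi> (\<lambda>z. f z powr \<alpha>) z"
    by (rule M.wlap_cmult[OF smooth_on_Ck[OF f\<alpha>] z])
  also have "wlap (g c) \<psi> (\<lambda>z. f z powr \<alpha>) z = \<alpha> * f z powr (\<alpha> - 1) * wlap (g c) \<psi> f z
      + \<alpha> * (\<alpha> - 1) * f z powr (\<alpha> - 2) * ginner (g c) f f z"
    unfolding deriv_powr[OF f_pos[OF z], of \<alpha>, symmetric]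
    by (rule M.wlap_compose_real[OF open_greaterThan Ck_on_powr f_smooth _ z]) (simp add: f_pos)
  finally have Lu: "Lu = C * (\<alpha> * f z powr (\<alpha> - 1) * wlap (g c) \<psi> f z
      + \<alpha> * (\<alpha> - 1) * f z powr (\<alpha> - 2) * ginner (g c) f f z)" .
  have fz: "f z = v x t" by (simp add: f_def x_def)
  note pw = powers[OF pos[OF x(1)], folded \<alpha>_def C_def, folded fz]
  have "p * u x t powr (p - 2) * Lu = (p * u x t powr (p - 2) * (C * (\<alpha> * f z powr (\<alpha> - 1)))) * wlap (g c) \<psi> f z
      + (p * u x t powr (p - 2) * (C * (\<alpha> * (\<alpha> - 1) * f z powr (\<alpha> - 2)))) * ginner (g c) f f z"
    unfolding Lu by (simp add: algebra_simps)
  also have "\<dots> = (p - 1) * f z * wlap (g c) \<psi> f z + ginner (g c) f f z"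
    unfolding pw(3,4) by simp
  finally have "p * u x t powr (p - 2) * (Lu + N t x (u x t))
    = (p - 1) * f z * wlap (g c) \<psi> f z + ginner (g c) f f z
      + p * ((p - 1) * f z / p) powr ((p - 2) / (p - 1)) * N t x (((p - 1) * f z / p) powr (1 / (p - 1)))"
    unfolding pw(5,6) by (simp add: distrib_left)
  with vt show ?thesis by (simp add: x_def)
qed

text \<open>
  The curvature bound evaluated on \<open>\<nabla>f\<close>. For \<open>m = n\<close> the weight is constant, so its Hessian and \<open>q\<close> vanish and both cases
  take the same form.
\<close>

lemma bakry_emery_lower_bound:
  fixes f :: "real^'n \<Rightarrow> real"
  assumes curvature: "tensor_ge A g (bakry_emery_ricci g \<phi> m) (- (m - 1) * k)"
    and m_eq: "m = real CARD('n) \<longrightarrow> \<phi> constant_on topspace X"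
    and c: "c \<in> A" and y: "y \<in> crange c"
  defines "q \<equiv> ginner (g c) (\<lambda>z. \<phi> (cinv c z)) f y"
  shows "(\<Sum>i j. (ric (g c) i j y + hess (g c) (\<lambda>z. \<phi> (cinv c z)) i j y) * grad (g c) f i y * grad (g c) f j y)
      \<ge> (if m = real CARD('n) then 0 else q\<^sup>2 / (m - real CARD('n))) - (m - 1) * k * ginner (g c) f f y"
    and "m = real CARD('n) \<Longrightarrow> q = 0"
proof -
  interpret M: coordinate_metric "crange c" "g c" by (rule coordinate_metric[OF c])
  let ?\<phi> = "\<lambda>z. \<phi> (cinv c z)"
  let ?n = "real CARD('n)"
  define \<xi> :: "real^'n" where "\<xi> = (\<chi> i. grad (g c) f i y)"
  have quad: "\<xi> \<bullet> (B *v \<xi>) = (\<Sum>i j. B $ i $ j * grad (g c) f i y * grad (g c) f j y)" for B :: "real^'n^'n"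
    by (simp add: \<xi>_def inner_vec_def matrix_vector_mult_def sum_distrib_left mult_ac)
  have norm: "\<xi> \<bullet> (g c y *v \<xi>) = ginner (g c) f f y"
  proof -
    have "\<xi> \<bullet> (g c y *v \<xi>) = (\<Sum>i. grad (g c) f i y * (\<Sum>j. g c y $ i $ j * grad (g c) f j y))"
      by (simp add: \<xi>_def inner_vec_def matrix_vector_mult_def)
    also have "\<dots> = ginner (g c) f f y"
      unfolding ginner_def grad_def[of _ f _ y] M.lower_raise[OF y] ..
    finally show ?thesis .
  qed
  have bound: "- (m - 1) * k * ginner (g c) f f y
      \<le> (\<Sum>i j. bakry_emery_ricci g \<phi> m c y $ i $ j * grad (g c) f i y * grad (g c) f j y)"
    using curvature c y unfolding tensor_ge_def norm[symmetric] quad[symmetric] by blast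
  have const: "hess (g c) ?\<phi> i j y = 0" "q = 0" if "m = ?n" for i j
  proof -
    have "\<phi> constant_on topspace X" using m_eq that by blast
    then obtain C where C: "\<And>x. x \<in> topspace X \<Longrightarrow> \<phi> x = C"
      unfolding constant_on_def by blast
    have p0: "pd j ?\<phi> z = 0" if "z \<in> crange c" for j z
      using pd_cong[OF M.open_U that, of ?\<phi> "\<lambda>z. C" j] C[OF cinv_topspace[OF c]] by simp
    have "pd i (pd j ?\<phi>) y = 0"
      using pd_cong[OF M.open_U y, of "pd j ?\<phi>" "\<lambda>z. 0" i] p0 by simp
    then show "hess (g c) ?\<phi> i j y = 0" by (simp add: hess_def p0[OF y])
    show "q = 0" by (simp add: q_def ginner_def grad_def p0[OF y])
  qed
  then show "m = ?n \<Longrightarrow> q = 0" by simp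
  show "(\<Sum>i j. (ric (g c) i j y + hess (g c) ?\<phi> i j y) * grad (g c) f i y * grad (g c) f j y)
      \<ge> (if m = ?n then 0 else q\<^sup>2 / (m - ?n)) - (m - 1) * k * ginner (g c) f f y"
  proof (cases "m = ?n")
    case True
    have "(\<Sum>i j. (ric (g c) i j y + hess (g c) ?\<phi> i j y) * grad (g c) f i y * grad (g c) f j y)
      = (\<Sum>i j. bakry_emery_ricci g \<phi> m c y $ i $ j * grad (g c) f i y * grad (g c) f j y)"
      by (simp add: True bakry_emery_ricci_def ricci_eq const(1)[OF True])
    then show ?thesis using bound True by (simp add: algebra_simps)
  next
    case False
    have qsq: "q\<^sup>2 = (\<Sum>i j. (pd i ?\<phi> y * grad (g c) f i y) * (pd j ?\<phi> y * grad (g c) f j y))"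
    proof -
      have "q = (\<Sum>i. pd i ?\<phi> y * grad (g c) f i y)"
        unfolding q_def M.inner_sym[OF y, of ?\<phi>] by (simp add: ginner_def mult.commute)
      then show ?thesis by (simp add: power2_eq_square sum_product)
    qed
    have "(\<Sum>i j. bakry_emery_ricci g \<phi> m c y $ i $ j * grad (g c) f i y * grad (g c) f j y)
      = (\<Sum>i j. (ric (g c) i j y + hess (g c) ?\<phi> i j y) * grad (g c) f i y * grad (g c) f j y)
        - q\<^sup>2 / (m - ?n)"
      unfolding qsq sum_divide_distrib
      by (simp add: False bakry_emery_ricci_def ricci_eq hessian_eq differential_def algebra_simps
          sum_subtractf sum.distrib)
    then show ?thesis using bound by (simp only: False if_False)
  qed
qed

end

section \<open>The gradient estimate\<close>

theorem theorem5p3: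
  fixes X :: "'a topology" and A :: "('a, 'n::finite) chart set" and g :: "('a, 'n) tensor2"
    and \<phi> :: "'a \<Rightarrow> real" and \<mu> :: "'a measure"
    and m k p T a M K :: real
    and u v :: "'a \<Rightarrow> real \<Rightarrow> real"
    and N \<Sigma> :: "real \<Rightarrow> 'a \<Rightarrow> real \<Rightarrow> real"
    and \<Gamma> :: "real \<Rightarrow> real"
  assumes dim: "CARD('n) \<ge> 2"
    and closed: "closed_manifold X A"
    and mms: "metric_measure_space X A g \<phi> \<mu>"
    and m: "m \<ge> real CARD('n)"
    and m_eq: "m = real CARD('n) \<longrightarrow> \<phi> constant_on topspace X"
    and k: "k \<ge> 0"
    and curvature: "tensor_ge A g (bakry_emery_ricci g \<phi> m) (- (m - 1) * k)"
    and p: "1 < p" "p \<le> 1 + 1 / sqrt (m - 1)"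
    and T: "T > 0"
    and N: "C1_nonlinearity A T N"
    and u_smooth: "smooth_spacetime A T u"
    and u_pos: "\<forall>x\<in>topspace X. \<forall>t\<in>{0..T}. u x t > 0"
    and u_solution: "\<forall>x\<in>topspace X. \<forall>t\<in>{0..T}.
      ((\<lambda>s. u x s) has_real_derivative
         weighted_laplacian A g \<phi> (\<lambda>z. u z t powr p) x + N t x (u x t)) (at t within {0..T})"
    and v: "v = (\<lambda>x t. p / (p - 1) * u x t powr (p - 1))"
    and Sigma: "\<Sigma> = (\<lambda>t x w. p * ((p - 1) * w / p) powr ((p - 2) / (p - 1))
                             * N t x (((p - 1) * w / p) powr (1 / (p - 1))))"
    and Gamma: "Ck_on 2 {0<..} \<Gamma>"
    and cond1: "\<forall>x\<in>topspace X. \<forall>t\<in>{0..T}. deriv \<Gamma> (v x t) * \<Sigma> t x (v x t) \<le> 0"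
    and cond2: "\<forall>x\<in>topspace X. \<forall>t\<in>{0..T}.
      deriv \<Gamma> (v x t) + v x t * deriv (deriv \<Gamma>) (v x t) \<ge> 0"
    and cond3: "\<forall>x\<in>topspace X. \<forall>t\<in>{0..T}.
      grad_inner A g (\<lambda>z. v z t) (\<lambda>z. \<Sigma> t z (v x t)) x \<le> 0"
    and cond4: "\<forall>x\<in>topspace X. \<forall>t\<in>{0..T}.
      deriv (\<lambda>w. \<Sigma> t x w) (v x t) + \<Sigma> t x (v x t) / (2 * (p - 1) * v x t) \<le> a"
    and M: "M = (SUP (x, t)\<in>topspace X \<times> {0..T}. v x t)"
    and K: "K = (p - 1) * (m - 1) * k"
  shows "\<forall>x\<in>topspace X. \<forall>t. 0 < t \<and> t \<le> T \<longrightarrow>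
    v x t powr (1 / (p - 1)) * grad_inner A g (\<lambda>z. v z t) (\<lambda>z. v z t) x
      \<le> exp (2 * (M * K + a) * t) *
         ((GREATEST r. r \<in> (\<lambda>z. v z 0 powr (1 / (p - 1)) * grad_inner A g (\<lambda>y. v y 0) (\<lambda>y. v y 0) z
                                + \<Gamma> (v z 0)) ` topspace X)
          - \<Gamma> (v x t))"
proof -
  interpret closed_manifold X A by (rule closed)
  interpret metric_measure_space X A g \<phi> \<mu> by (rule mms)
  define b where "b = p - 1"
  define \<kappa> where "\<kappa> = 2 * (M * K + a)"
  have b: "b > 0" using p by (simp add: b_def)
  have m2: "m \<ge> 2" using m dim by simp
  have bm: "b * b * (m - 1) \<le> 1"
  proof -
    have "p - 1 \<le> 1 / sqrt (m - 1)" "sqrt (m - 1) > 0" using p m2 by auto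
    then have "b * sqrt (m - 1) \<le> 1" by (simp only: pos_le_divide_eq b_def)
    moreover have "0 \<le> b * sqrt (m - 1)" using b m2 by simp
    ultimately have "(b * sqrt (m - 1)) * (b * sqrt (m - 1)) \<le> 1" using mult_le_one by blast
    moreover have "(b * sqrt (m - 1)) * (b * sqrt (m - 1)) = b * b * (sqrt (m - 1) * sqrt (m - 1))"
      by (simp add: mult_ac)
    ultimately show ?thesis using m2 by simp
  qed
  have v_eq: "v x t = p / (p - 1) * u x t powr (p - 1)" for x t by (simp add: v)
  note powers = porous_medium_powers[OF _ p(1) v_eq]
  have v_pos: "v x t > 0" if "x \<in> topspace X" "t \<in> {0..T}" for x t
    using powers(1) u_pos that by blast

  have v_chart: "(\<lambda>z. v (cinv c z) t) differentiable (at y)"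
    "pd i (\<lambda>z. v (cinv c z) t) y = p * u (cinv c y) t powr (p - 2) * pd i (\<lambda>z. u (cinv c z) t) y"
    if "c \<in> A" "y \<in> crange c" "t \<in> {0..T}" for c y t i
  proof -
    have up: "u (cinv c y) t > 0" using u_pos cinv_topspace that by blast
    have d: "(\<lambda>z. u (cinv c z) t) differentiable (at y)"
      by (rule spacetime_regularity(2)[OF u_smooth that])
    have "((\<lambda>r. p / (p - 1) * r powr (p - 1)) has_real_derivative
        p / (p - 1) * ((p - 1) * u (cinv c y) t powr (p - 1 - 1))) (at (u (cinv c y) t))"
      by (intro DERIV_cmult has_real_derivative_powr up)
    also have "p / (p - 1) * ((p - 1) * u (cinv c y) t powr (p - 1 - 1)) = p * u (cinv c y) t powr (p - 2)"
      using p by simp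
    finally have h: "((\<lambda>r. p / (p - 1) * r powr (p - 1)) has_real_derivative p * u (cinv c y) t powr (p - 2))
        (at (u (cinv c y) t))" .
    show "(\<lambda>z. v (cinv c z) t) differentiable (at y)"
      unfolding v_eq by (rule dirderiv_compose_real(2)[of "\<lambda>z. u (cinv c z) t", OF d h])
    show "pd i (\<lambda>z. v (cinv c z) t) y = p * u (cinv c y) t powr (p - 2) * pd i (\<lambda>z. u (cinv c z) t) y"
      unfolding v_eq by (rule pd_compose_real[of "\<lambda>z. u (cinv c z) t", OF d h])
  qed
  have u_cont: "continuous_on (crange c \<times> {0..T}) (\<lambda>q. u (cinv c (fst q)) (snd q))" if "c \<in> A" for c
    using spacetime_regularity(1)[OF u_smooth that] by (simp add: case_prod_unfold)
  have u_ne: "u (cinv c (fst q)) (snd q) \<noteq> 0" if "c \<in> A" "q \<in> crange c \<times> {0..T}" for c q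
  proof -
    have "cinv c (fst q) \<in> topspace X" "snd q \<in> {0..T}" using that cinv_topspace[OF that(1), of "fst q"] by (simp_all add: mem_Times_iff)
    then show ?thesis using u_pos by (metis less_irrefl)
  qed
  have v_cont: "continuous_on (crange c \<times> {0..T}) (\<lambda>(y, t). v (cinv c y) t)" if "c \<in> A" for c
    unfolding v_eq case_prod_unfold
    by (intro continuous_intros continuous_on_powr u_cont that) (use u_ne[OF that] in auto)
  have v_pd_cont: "continuous_on (crange c \<times> {0..T}) (\<lambda>(y, t). pd i (\<lambda>z. v (cinv c z) t) y)" if "c \<in> A" for c i
  proof -
    have "continuous_on (crange c \<times> {0..T})
      (\<lambda>q. p * u (cinv c (fst q)) (snd q) powr (p - 2) * pd i (\<lambda>z. u (cinv c z) (snd q)) (fst q))"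
      using spacetime_regularity(3)[OF u_smooth that, of i]
      by (intro continuous_intros continuous_on_powr u_cont that) (use u_ne[OF that] in \<open>auto simp: case_prod_unfold\<close>)
    then show ?thesis
      by (rule continuous_on_cong[THEN iffD1, OF refl, rotated]) (use v_chart(2)[OF that] in auto)
  qed
  note grad_v = grad_inner_spacetime_continuous[of T v, OF v_chart(1) v_pd_cont]

  define F where "F x t = exp (- \<kappa> * t) * (v x t powr (1 / (p - 1)) * grad_inner A g (\<lambda>z. v z t) (\<lambda>z. v z t) x) + \<Gamma> (v x t)" for x t
  have F_cont: "continuous_map (prod_topology X (top_of_set {0..T})) euclideanreal (\<lambda>(x, t). F x t)"
  proof (rule continuous_map_spacetime)
    fix c assume c: "c \<in> A"
    have vc: "continuous_on (crange c \<times> {0..T}) (\<lambda>q. v (cinv c (fst q)) (snd q))"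
      using v_cont[OF c] by (simp add: case_prod_unfold)
    have gc: "continuous_on (crange c \<times> {0..T}) (\<lambda>q. grad_inner A g (\<lambda>z. v z (snd q)) (\<lambda>z. v z (snd q)) (cinv c (fst q)))"
      using grad_v(1)[OF _ _ _ _ c] by (simp add: case_prod_unfold)
    have pos: "v (cinv c (fst q)) (snd q) > 0" if "q \<in> crange c \<times> {0..T}" for q
      using that v_pos cinv_topspace[OF c, of "fst q"] by (simp add: mem_Times_iff)
    have "continuous_on {0<..} \<Gamma>" using Gamma Ck_on_Suc_imp[of _ "{0<..}" \<Gamma>] by (metis Ck_on.simps(1) One_nat_def numeral_2_eq_2)
    then have \<Gamma>c: "continuous_on (crange c \<times> {0..T}) (\<lambda>q. \<Gamma> (v (cinv c (fst q)) (snd q)))"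
      by (rule continuous_on_compose2[OF _ vc]) (use pos in auto)
    show "continuous_on (crange c \<times> {0..T}) (\<lambda>(y, t). F (cinv c y) t)"
      unfolding F_def case_prod_unfold
      by (intro continuous_intros continuous_on_powr vc gc \<Gamma>c) (use pos in force)
  qed
  have v_M: "v x t \<le> M" if "x \<in> topspace X" "t \<in> {0..T}" for x t
  proof -
    have "compact ((\<lambda>(x, t). v x t) ` (topspace X \<times> {0..T}))"
      by (intro spacetime_image_compact continuous_map_spacetime v_cont) auto
    then have "bdd_above ((\<lambda>(x, t). v x t) ` (topspace X \<times> {0..T}))"
      by (intro bounded_imp_bdd_above compact_imp_bounded)
    from cSUP_upper[OF _ this, of "(x, t)"] that show ?thesis by (simp add: M)
  qed

  have step: "\<exists>D. ((\<lambda>s. F x s) has_real_derivative D) (at t) \<and> D \<le> 0"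
    if x: "x \<in> topspace X" and t: "0 < t" "t < T" and max: "\<And>z. z \<in> topspace X \<Longrightarrow> F z t \<le> F x t" for x t
  proof -
    \<comment> \<open>In the chart that defines scalar quantities at \<open>x\<close>, the hypothesis on \<open>\<Sigma>_x\<close> has its coordinate form by definition.\<close>
    define c where "c = chart_at A x"
    define y where "y = cmap c x"
    define J where "J = {0<..<T}"
    define V where "V = (\<lambda>(z, s). v (cinv c z) s)"
    define \<psi> where "\<psi> z = \<phi> (cinv c z)" for z
    define f where "f z = v (cinv c z) t" for z
    define S where "S z r = \<Sigma> t (cinv c z) r" for z r
    have c: "c \<in> A" "x \<in> cdom c" unfolding c_def by (rule chart_at[OF x])+
    have y: "y \<in> crange c" and xy: "cinv c y = x" using c cinv_cmap by (auto simp: y_def)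
    have t_in: "t \<in> {0..T}" and J: "open J" "t \<in> J" "J \<subseteq> {0..T}" using t by (auto simp: J_def)
    have in_X: "cinv c z \<in> topspace X" if "z \<in> crange c" for z using cinv_topspace[OF c(1) that] .
    interpret M: coordinate_metric "crange c" "g c" by (rule coordinate_metric[OF c(1)])
    have o: "open (crange c \<times> J)" using crange_open[OF c(1)] J by (simp add: open_Times)
    have V_pos: "V (z, s) > 0" if "z \<in> crange c" "s \<in> J" for z s
      using v_pos[OF in_X] that J by (auto simp: V_def)
    have fV: "(\<lambda>x. V (x, t)) = f" by (simp add: V_def f_def fun_eq_iff)
    have V_smooth: "smooth_on (crange c \<times> J) V"
    proof -
      let ?u = "\<lambda>(z, s). u (cinv c z) s"
      have "smooth_on (crange c \<times> J) ?u"
        unfolding J_def by (rule smooth_spacetime_interior[OF u_smooth c(1)])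
      then have "smooth_on (crange c \<times> J) (\<lambda>q. p / (p - 1) * ?u q powr (p - 1))"
        using u_pos in_X J(3) by (intro smooth_on_mult smooth_on_const smooth_on_powr o) auto
      then show ?thesis by (rule smooth_on_cong[THEN iffD1, OF o, rotated]) (auto simp: V_def v_eq)
    qed
    have \<psi>_smooth: "smooth_on (crange c) \<psi>"
      using weight_smooth c unfolding smooth_function_def \<psi>_def[abs_def] by blast
    have eq: "dirderiv (0, 1) V (z, t) = b * V (z, t) * wlap (g c) \<psi> f z + ginner (g c) f f z + S z (V (z, t))"
      if z: "z \<in> crange c" for z
    proof -
      have "((\<lambda>s. V (z, s)) has_real_derivative dirderiv (0, 1) V (z, t)) (at t)"
        using smooth_on_differentiable[OF o V_smooth] z J by (intro dirderiv_slice(3)) simp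
      from DERIV_unique[OF this[unfolded V_def case_prod_conv]
          pressure_equation[where N = N, OF p(1) t u_smooth u_pos u_solution v_eq c(1) z]]
      show ?thesis unfolding V_def by (simp add: f_def[abs_def] \<psi>_def[abs_def] b_def S_def Sigma)
    qed
    have Sd: "(\<lambda>(z, r). S z r) differentiable (at (y, V (y, t)))"
      unfolding S_def Sigma by (rule nonlinearity_differentiable[OF N c(1) y t V_pos[OF y J(2)] p(1)])
    note ric = bakry_emery_lower_bound[OF curvature m_eq c(1) y, of f, folded \<psi>_def[abs_def]]
    have f_y: "V (y, t) = v x t" by (simp add: V_def xy)
    have grad_F: "F (cinv c z) s = exp (- \<kappa> * s) * (V (z, s) powr (1 / b) * ginner (g c) (\<lambda>x. V (x, s)) (\<lambda>x. V (x, s)) z)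
        + \<Gamma> (V (z, s))" if "z \<in> crange c" "s \<in> J" for z s
      using grad_v(2)[OF _ _ _ _ c(1) that(1)] that(2) J(3) by (auto simp: F_def V_def b_def)
    have c3: "ginner (g c) f (\<lambda>z. S z (V (y, t))) y \<le> 0"
    proof -
      have "grad_inner A g (\<lambda>z. v z t) (\<lambda>z. \<Sigma> t z (v x t)) x = ginner (g c) f (\<lambda>z. S z (V (y, t))) y"
        unfolding grad_inner_def Let_def c_def[symmetric] y_def[symmetric]
        by (simp add: inner_vec_def gradient_eq matrix_vector_mult_def grad_def[of _ "\<lambda>z. \<Sigma> t (cinv c z) r" for r]
            M.lower_raise[OF y] ginner_def f_def[abs_def] S_def f_y)
      then show ?thesis using bspec[OF bspec[OF cond3 x] t_in] by simp
    qed
    have "\<exists>D. ((\<lambda>s. exp (- \<kappa> * s) * (V (y, s) powr (1 / b) * ginner (g c) (\<lambda>x. V (x, s)) (\<lambda>x. V (x, s)) y)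
        + \<Gamma> (V (y, s))) has_real_derivative D) (at t) \<and> D \<le> 0"
    proof (rule M.spacetime_maximum[OF J(1,2) V_smooth _ \<psi>_smooth y _ Sd Gamma b bm dim m k refl refl, unfolded fV, OF _ _ _ _ _ _ _ _ _ _ _ refl])
      show "V (z, s) > 0" if "z \<in> crange c" "s \<in> J" for z s by (rule V_pos[OF that])
      show "dirderiv (0, 1) V (z, t) = b * V (z, t) * wlap (g c) \<psi> f z + ginner (g c) f f z + S z (V (z, t))"
        if "z \<in> crange c" for z by (rule eq[OF that])
      show "ginner (g c) \<psi> f y = 0" if "m = real CARD('n)" using ric(2)[OF that] .
      show "(if m = real CARD('n) then 0 else (ginner (g c) \<psi> f y)\<^sup>2 / (m - real CARD('n))) - (m - 1) * k * ginner (g c) f f y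
        \<le> (\<Sum>i j. (ric (g c) i j y + hess (g c) \<psi> i j y) * grad (g c) f i y * grad (g c) f j y)"
        using ric(1) .
      show "deriv \<Gamma> (V (y, t)) * S y (V (y, t)) \<le> 0"
        using cond1 x t_in by (simp add: f_y S_def xy)
      show "0 \<le> deriv \<Gamma> (V (y, t)) + V (y, t) * deriv (deriv \<Gamma>) (V (y, t))"
        using cond2 x t_in by (simp add: f_y)
      show "ginner (g c) f (\<lambda>z. S z (V (y, t))) y \<le> 0" by (rule c3)
      show "deriv (S y) (V (y, t)) + S y (V (y, t)) / (2 * b * V (y, t)) \<le> a"
        using cond4 x t_in by (simp add: f_y S_def[abs_def] xy b_def)
      show "V (y, t) \<le> M" using v_M[OF x t_in] by (simp add: f_y)
      show "K = b * (m - 1) * k" by (simp add: K b_def)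
      show "\<kappa> = 2 * (M * K + a)" by (rule \<kappa>_def)
      show "exp (- \<kappa> * t) * (V (z, t) powr (1 / b) * ginner (g c) (\<lambda>x. V (x, t)) (\<lambda>x. V (x, t)) z) + \<Gamma> (V (z, t))
        \<le> exp (- \<kappa> * t) * (V (y, t) powr (1 / b) * ginner (g c) (\<lambda>x. V (x, t)) (\<lambda>x. V (x, t)) y) + \<Gamma> (V (y, t))"
        if "z \<in> crange c" for z
        using max[OF in_X[OF that]] grad_F[OF that J(2)] grad_F[OF y J(2)] by (simp add: xy)
    qed
    then obtain D where D: "((\<lambda>s. exp (- \<kappa> * s) * (V (y, s) powr (1 / b) * ginner (g c) (\<lambda>x. V (x, s)) (\<lambda>x. V (x, s)) y)
        + \<Gamma> (V (y, s))) has_real_derivative D) (at t)" "D \<le> 0" by blast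
    have "((\<lambda>s. F x s) has_real_derivative D) (at t)"
      by (rule has_field_derivative_transform_within_open[OF D(1) J(1,2)]) (use grad_F[OF y] in \<open>simp add: xy\<close>)
    with D(2) show ?thesis by blast
  qed

  show ?thesis
  proof (intro ballI allI impI)
    fix x t assume x: "x \<in> topspace X" and t: "0 < t \<and> t \<le> T"
    let ?F0 = "\<lambda>z. v z 0 powr (1 / (p - 1)) * grad_inner A g (\<lambda>y. v y 0) (\<lambda>y. v y 0) z + \<Gamma> (v z 0)"
    have F0: "F z 0 = ?F0 z" for z by (simp add: F_def)
    have "continuous_map (prod_topology X (top_of_set {0..0})) euclideanreal (\<lambda>(x, t). F x t)"
      using continuous_map_from_subtopology[OF F_cont, of "topspace X \<times> {0..0}"] T
      by (simp add: subtopology_Times subtopology_subtopology)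
    moreover have "compact {0..0::real}" "{0..0::real} \<noteq> {}" by simp_all
    moreover have "topspace X \<noteq> {}" using x by blast
    ultimately have "\<exists>z0\<in>topspace X. \<exists>s\<in>{0..0}. \<forall>z\<in>topspace X. \<forall>r\<in>{0..0}. F z r \<le> F z0 s"
      by (rule spacetime_attains_max)
    then obtain z0 where z0: "z0 \<in> topspace X" "\<And>z. z \<in> topspace X \<Longrightarrow> F z 0 \<le> F z0 0"
      by fastforce
    have "(GREATEST r. r \<in> ?F0 ` topspace X) = F z0 0"
      using z0 by (intro Greatest_equality) (auto simp: F0)
    moreover have "F x t \<le> F z0 0"
      by (rule parabolic_maximum_principle[OF F_cont step z0(2) x]) (use t in auto)
    ultimately have "exp (- \<kappa> * t) * (v x t powr (1 / (p - 1)) * grad_inner A g (\<lambda>z. v z t) (\<lambda>z. v z t) x)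
      \<le> (GREATEST r. r \<in> ?F0 ` topspace X) - \<Gamma> (v x t)" by (simp add: F_def)
    then have le: "exp (\<kappa> * t) * (exp (- \<kappa> * t) * (v x t powr (1 / (p - 1)) * grad_inner A g (\<lambda>z. v z t) (\<lambda>z. v z t) x))
      \<le> exp (\<kappa> * t) * ((GREATEST r. r \<in> ?F0 ` topspace X) - \<Gamma> (v x t))" by (intro mult_left_mono) auto
    have cancel: "exp (\<kappa> * t) * (exp (- \<kappa> * t) * r) = r" for r
      by (simp add: exp_minus)
    show "v x t powr (1 / (p - 1)) * grad_inner A g (\<lambda>z. v z t) (\<lambda>z. v z t) x
      \<le> exp (2 * (M * K + a) * t) * ((GREATEST r. r \<in> ?F0 ` topspace X) - \<Gamma> (v x t))"
      using le[unfolded cancel] unfolding \<kappa>_def .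
  qed
qed

end
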